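(* (Quanto foreign option, power loss.) In the two-dimensional Black–Scholes model of the context let $H=\left(S^1_T-\frac K{S^2_T}\right)^+$ with $K>0$, let $p>1$ and $c\ge0$. Put $X:=\frac{A_1}{p-1}W^1_T+\left(\frac{A_2}{p-1}-\sigma_2\right)W^2_T$, $Y:=\sigma_1W^1_T+\sigma_2W^2_T$, $\tilde X:=\frac{A_1}{p-1}\widetilde W^1_T+\left(\frac{A_2}{p-1}-\sigma_2\right)\widetilde W^2_T$, $\tilde Y:=\sigma_1\widetilde W^1_T+\sigma_2\widetilde W^2_T$. Denote by $k_1,k_2,k_3,k_4$ constants satisfying $W^1_T=k_1X+k_2Y$, $W^2_T=k_3X+k_4Y$, $\widetilde W^1_T=k_1\tilde X+k_2\tilde Y$, $\widetilde W^2_T=k_3\tilde X+k_4\tilde Y$. Let $$v(x)=\ln\left\{\frac{S^1_0S^2_0e^{(\alpha_1+\alpha_2-\frac12(\sigma_1^2+\sigma_2^2))T+x}-K}{c^{\frac1{p-1}}S^2_0e^{(\alpha_2-\frac12\sigma_2^2-\frac B{p-1})T}}\right\},\qquad \tilde v(x)=\ln\left\{\frac{S^1_0S^2_0e^{(2r-\frac12(\sigma_1^2+\sigma_2^2))T+x}-K}{c^{\frac1{p-1}}S^2_0e^{(r-\frac12\sigma_2^2-\frac{\tilde B}{p-1})T}}\right\}.$$ Then $$\Psi^p_1(c)=\frac1p\int_d^{+\infty}\int_{-\infty}^{v(y)}\left(S^1_0e^{(\alpha_1-\frac12\sigma_1^2)T+\sigma_1(k_1x+k_2y)}-\frac K{S^2_0e^{(\alpha_2-\frac12\sigma_2^2)T+\sigma_2(k_3x+k_4y)}}\right)^pf_{X\mid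 Y=y}(x)f_Y(y)\,dx\,dy$$ $$+\frac1pc^{\frac p{p-1}}e^{-\frac{pBT}{p-1}}\int_d^{+\infty}\int_{v(y)}^{+\infty}e^{-\frac{pA_1}{p-1}(k_1x+k_2y)-\frac{pA_2}{p-1}(k_3x+k_4y)}f_{X\mid Y=y}(x)f_Y(y)\,dx\,dy,$$ $$\Psi^p_2(c)=\int_{\tilde d}^{+\infty}\int_{\tilde v(y)}^{+\infty}\left(S^1_0e^{(r-\frac12\sigma_1^2)T+\sigma_1(k_1x+k_2y)}-\frac K{S^2_0e^{(r-\frac12\sigma_2^2)T+\sigma_2(k_3x+k_4y)}}\right)\tilde f_{\tilde X\mid\tilde Y=y}(x)\tilde f_{\tilde Y}(y)\,dx\,dy$$ $$-c^{\frac1{p-1}}e^{-\frac{\tilde BT}{p-1}}\int_{\tilde d}^{+\infty}\int_{\tilde v(y)}^{+\infty}e^{-\frac{A_1}{p-1}(k_1x+k_2y)-\frac{A_2}{p-1}(k_3x+k_4y)}\tilde f_{\tilde X\mid\tilde Y=y}(x)\tilde f_{\tilde Y}(y)\,dx\,dy.$$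
   Context: Model. $T>0$; $(W^1,W^2)$ is a Wiener process under $P$ with positive definite correlation matrix $Q=\begin{pmatrix}1&\rho\\\rho&1\end{pmatrix}$. Stocks $dS^i_t=S^i_t(\alpha_i\,dt+\sigma_i\,dW^i_t)$, $i=1,2$, with $\alpha_i\in\mathbb R$, $\sigma_i>0$, and constant interest rate $r$. Let $\theta_i=\frac{\alpha_i-r}{\sigma_i}$, $\theta=(\theta_1,\theta_2)^T$, $\widetilde W^i_t=W^i_t+\theta_it$. The martingale measure $\tilde P$ has density $\tilde Z_T=e^{-A_1W^1_T-A_2W^2_T-BT}=e^{-A_1\widetilde W^1_T-A_2\widetilde W^2_T-\tilde BT}$ with respect to $P$, where $(A_1,A_2)^T=Q^{-1}\theta$, $B=\frac12|Q^{-1/2}\theta|^2$, $\tilde B=B-A_1\theta_1-A_2\theta_2$; under $\tilde P$, $\widetilde W=(\widetilde W^1,\widetilde W^2)$ is a Wiener process with correlation matrix $Q$. $\mathbf E,\tilde{\mathbf E}$ are expectations under $P,\tilde P$; $f$ denotes (conditional) densities under $P$ and $\tilde f$ under $\tilde P$. Constants: $d=\ln\frac K{S^1_0S^2_0}-\left(\alpha_1+\alpha_2-\frac12(\sigma_1^2+\sigma_2^2)\right)T$, $\tilde d=\ln\frac K{S^1_0S^2_0}-\left(2r-\frac12(\sigma_1^2+\sigma_2^2)\right)T$. Risk auxiliary functions for the power loss $l(x)=x^p/p$, $p>1$: with $\varphi_c:=\left\{1-\left(\frac{(c\tilde Z_T)^{1/(p-1)}}{H}\wedge1\right)\right\}\mathbf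 1_{\{H>0\}}$, $\Psi^p_1(c)=\frac1p\mathbf E[((1-\varphi_c)H)^p]$ and $\Psi^p_2(c)=\tilde{\mathbf E}[H\varphi_c]$. Convention: $\ln0=-\infty$.
   Formalization: The fractions inside the logarithms defining v and ṽ are inverted (v and ṽ change sign): H ≤ (cZ̃_T)^{1/(p-1)} on {H>0} means X ≤ −ln of the printed fraction, so as printed the Ψ₁ formula is false for every c ≥ 0. *)

theory Defs
  imports "HOL-Probability.Probability"
begin

section \<open>Matrices and the multivariate normal density\<close>

definition pos_definite :: "real ^ 'n ^ 'n \<Rightarrow> bool" where
  "pos_definite Q \<longleftrightarrow> transpose Q = Q \<and> (\<forall>x. x \<noteq> 0 \<longrightarrow> x \<bullet> (Q *v x) > 0)"

text \<open>For positive definite \<open>Q\<close> exactly one matrix satisfies the condition, so the choice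
  made by \<open>SOME\<close> is forced.\<close>

definition matrix_sqrt :: "real ^ 'n ^ 'n \<Rightarrow> real ^ 'n ^ 'n" where
  "matrix_sqrt Q = (SOME R. pos_definite R \<and> R ** R = Q)"

definition corr_matrix :: "real \<Rightarrow> real ^ 2 ^ 2" where
  "corr_matrix \<rho> = vector [vector [1, \<rho>], vector [\<rho>, 1]]"

definition mvnormal_density :: "real ^ 'n ^ 'n \<Rightarrow> real ^ 'n \<Rightarrow> real" where
  "mvnormal_density \<Sigma> x =
     exp (- (x \<bullet> (matrix_inv \<Sigma> *v x)) / 2) / sqrt ((2 * pi) ^ CARD('n) * det \<Sigma>)"

section \<open>Wiener processes and stochastic differential equations\<close>

definition filtered_space :: "'a measure \<Rightarrow> (real \<Rightarrow> 'a measure) \<Rightarrow> bool" where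
  "filtered_space M F \<longleftrightarrow>
     prob_space M \<and> filtration (space M) F \<and> (\<forall>t. subalgebra M (F t))"

text \<open>Wiener process on \<open>[0, T]\<close> relative to the filtration \<open>F\<close> (for instance the one it
  generates), with positive definite matrix \<open>Q\<close> as covariance matrix per unit of time; when the
  diagonal entries are 1, this is the correlation matrix of the components.\<close>

definition wiener_process ::
    "'a measure \<Rightarrow> (real \<Rightarrow> 'a measure) \<Rightarrow> real \<Rightarrow> real ^ 'n ^ 'n \<Rightarrow> (real \<Rightarrow> 'a \<Rightarrow> real ^ 'n) \<Rightarrow> bool"
  where
  "wiener_process M F T Q W \<longleftrightarrow>
     filtered_space M F \<and>
     (\<forall>t\<in>{0..T}. W t \<in> borel_measurable (F t)) \<and>
     (AE \<omega> in M. W 0 \<omega> = 0) \<and>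
     (AE \<omega> in M. continuous_on {0..T} (\<lambda>t. W t \<omega>)) \<and>
     (\<forall>s t. 0 \<le> s \<and> s < t \<and> t \<le> T \<longrightarrow>
        distributed M lborel (\<lambda>\<omega>. W t \<omega> - W s \<omega>)
          (\<lambda>x. ennreal (mvnormal_density ((t - s) *\<^sub>R Q) x)) \<and>
        prob_space.indep_set M (sets (F s))
          {(\<lambda>\<omega>. W t \<omega> - W s \<omega>) -` B \<inter> space M | B. B \<in> sets borel})"

text \<open>A list entry \<open>(a, b, \<xi>)\<close> stands for the process \<open>\<xi> \<cdot> 1\<^bsub>(a,b]\<^esub>\<close>; the list stands for the sum
  of its entries.\<close>

type_synonym 'a simple_proc = "(real \<times> real \<times> ('a \<Rightarrow> real)) list"

definition simple_process ::
    "'a measure \<Rightarrow> (real \<Rightarrow> 'a measure) \<Rightarrow> real \<Rightarrow> 'a simple_proc \<Rightarrow> bool" where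
  "simple_process M F t \<phi> \<longleftrightarrow>
     (\<forall>(a, b, \<xi>) \<in> set \<phi>. 0 \<le> a \<and> a \<le> b \<and> b \<le> t \<and>
        \<xi> \<in> borel_measurable (F a) \<and> integrable M (\<lambda>\<omega>. (\<xi> \<omega>)\<^sup>2))"

definition simple_val :: "'a simple_proc \<Rightarrow> real \<Rightarrow> 'a \<Rightarrow> real" where
  "simple_val \<phi> s \<omega> = (\<Sum>(a, b, \<xi>) \<leftarrow> \<phi>. \<xi> \<omega> * indicator {a<..b} s)"

definition simple_ito :: "(real \<Rightarrow> 'a \<Rightarrow> real) \<Rightarrow> 'a simple_proc \<Rightarrow> 'a \<Rightarrow> real" where
  "simple_ito W \<phi> \<omega> = (\<Sum>(a, b, \<xi>) \<leftarrow> \<phi>. \<xi> \<omega> * (W b \<omega> - W a \<omega>))"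

text \<open>\<open>I\<close> is (a version of) the Ito integral of \<open>H\<close> with respect to \<open>W\<close> over \<open>[0, t]\<close>, that is,
  the mean-square limit of the integrals of simple processes approximating \<open>H\<close> in
  \<open>L\<^sup>2([0, t] \<times> \<Omega>)\<close>.\<close>

definition has_ito_integral ::
    "'a measure \<Rightarrow> (real \<Rightarrow> 'a measure) \<Rightarrow> (real \<Rightarrow> 'a \<Rightarrow> real) \<Rightarrow> (real \<Rightarrow> 'a \<Rightarrow> real) \<Rightarrow>
     real \<Rightarrow> ('a \<Rightarrow> real) \<Rightarrow> bool" where
  "has_ito_integral M F W H t I \<longleftrightarrow>
     I \<in> borel_measurable M \<and>
     (\<exists>\<phi> :: nat \<Rightarrow> 'a simple_proc.
        (\<forall>n. simple_process M F t (\<phi> n)) \<and>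
        (\<lambda>n. \<integral>\<^sup>+ s \<in> {0..t}. (\<integral>\<^sup>+ \<omega>. ennreal ((H s \<omega> - simple_val (\<phi> n) s \<omega>)\<^sup>2) \<partial>M) \<partial>lborel)
          \<longlonglongrightarrow> 0 \<and>
        (\<lambda>n. \<integral>\<^sup>+ \<omega>. ennreal ((I \<omega> - simple_ito W (\<phi> n) \<omega>)\<^sup>2) \<partial>M) \<longlonglongrightarrow> 0)"

definition ito_integrand ::
    "'a measure \<Rightarrow> (real \<Rightarrow> 'a measure) \<Rightarrow> real \<Rightarrow> (real \<Rightarrow> 'a \<Rightarrow> real) \<Rightarrow> bool" where
  "ito_integrand M F T H \<longleftrightarrow>
     (\<lambda>(t, \<omega>). H t \<omega>) \<in> borel_measurable (restrict_space borel {0..T} \<Otimes>\<^sub>M M) \<and>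
     (\<forall>t\<in>{0..T}. H t \<in> borel_measurable (F t)) \<and>
     (\<integral>\<^sup>+ t \<in> {0..T}. (\<integral>\<^sup>+ \<omega>. ennreal ((H t \<omega>)\<^sup>2) \<partial>M) \<partial>lborel) < \<infinity>"

text \<open>\<open>S\<close> solves \<open>dS\<^sub>t = S\<^sub>t (\<alpha> dt + \<sigma> dW\<^sub>t)\<close> on \<open>[0, T]\<close> with initial value \<open>s\<^sub>0\<close>.\<close>

definition black_scholes_stock ::
    "'a measure \<Rightarrow> (real \<Rightarrow> 'a measure) \<Rightarrow> real \<Rightarrow> (real \<Rightarrow> 'a \<Rightarrow> real) \<Rightarrow>
     real \<Rightarrow> real \<Rightarrow> real \<Rightarrow> (real \<Rightarrow> 'a \<Rightarrow> real) \<Rightarrow> bool" where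
  "black_scholes_stock M F T W \<alpha> \<sigma> s\<^sub>0 S \<longleftrightarrow>
     ito_integrand M F T S \<and>
     (\<forall>t\<in>{0..T}. \<exists>I. has_ito_integral M F W (\<lambda>s \<omega>. S s \<omega> * \<sigma>) t I \<and>
        (AE \<omega> in M. S t \<omega> = s\<^sub>0 + (LINT s:{0..t}|lborel. S s \<omega> * \<alpha>) + I \<omega>))"

section \<open>Densities of random variables\<close>

text \<open>Densities are determined up to Lebesgue null sets; \<open>RN_deriv\<close> picks one version.\<close>

definition pdf :: "'a measure \<Rightarrow> ('a \<Rightarrow> 'b::euclidean_space) \<Rightarrow> 'b \<Rightarrow> real" where
  "pdf M X x = enn2real (RN_deriv lborel (distr M lborel X) x)"

definition cond_pdf :: "'a measure \<Rightarrow> ('a \<Rightarrow> real) \<Rightarrow> ('a \<Rightarrow> real) \<Rightarrow> real \<Rightarrow> real \<Rightarrow> real" where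
  "cond_pdf M X Y y x = pdf M (\<lambda>\<omega>. (X \<omega>, Y \<omega>)) (x, y) / pdf M Y y"

section \<open>Risk auxiliary functions for the power loss\<close>

definition risk_phi :: "real \<Rightarrow> real \<Rightarrow> ('a \<Rightarrow> real) \<Rightarrow> ('a \<Rightarrow> real) \<Rightarrow> 'a \<Rightarrow> real" where
  "risk_phi p c Z H \<omega> =
     (1 - min ((c * Z \<omega>) powr (1 / (p - 1)) / H \<omega>) 1) * indicator {\<omega>. H \<omega> > 0} \<omega>"

definition risk_Psi1 :: "'a measure \<Rightarrow> real \<Rightarrow> ('a \<Rightarrow> real) \<Rightarrow> ('a \<Rightarrow> real) \<Rightarrow> real \<Rightarrow> real" where
  "risk_Psi1 M p Z H c = 1 / p * (\<integral>\<omega>. ((1 - risk_phi p c Z H \<omega>) * H \<omega>) powr p \<partial>M)"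

text \<open>Here the first argument is the martingale measure.\<close>

definition risk_Psi2 :: "'a measure \<Rightarrow> real \<Rightarrow> ('a \<Rightarrow> real) \<Rightarrow> ('a \<Rightarrow> real) \<Rightarrow> real \<Rightarrow> real" where
  "risk_Psi2 N p Z H c = (\<integral>\<omega>. H \<omega> * risk_phi p c Z H \<omega> \<partial>N)"

section \<open>Logarithm with \<open>ln 0 = -\<infinity>\<close>\<close>

definition ln_ext :: "real \<Rightarrow> ereal" where
  "ln_ext x = (if x = 0 then - \<infinity> else ereal (ln x))"

end

(* Only three features of the model enter. First, the equation for a stock determines its terminal
   value: with G = exp (\<sigma> b\<^sub>t) for the driving Brownian motion b, the numbers E S\<^sub>t\<^sup>2 and E (S\<^sub>t G)
   satisfy linear integral equations (the first by the Ito isometry and the martingale property, the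
   second because tilting by G gives b the drift \<sigma>), and the resulting values force
   E (S\<^sub>t - s\<^sub>0 exp ((\<alpha> - \<sigma>\<^sup>2/2) t) G)\<^sup>2 = 0; no Ito formula is needed. Second, (X, Y) has an absolutely
   continuous law, because W\<^sub>T is its image under a linear map and linear maps between spaces of equal
   dimension preserve null sets; the same holds for the tilted pair under the martingale measure, so
   Girsanov's theorem is not needed. Third, W\<^sub>T has exponential moments, which makes all integrals
   converge. Given these, both formulas are Fubini's theorem once the events H > 0 and
   H < (c Z)^(1/(p-1)) are rewritten as Y > d and X < v Y. *)

theory Submission
  imports Defs
begin

section \<open>Square integrable functions\<close>

text \<open>The coordinates X and Y separate the hedging condition. Multiplied by S2_T, the
  condition H < (c Z)^(1/(p-1)) on {H > 0} reads S1_T S2_T - K < C exp (-X): the product of the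
  stocks depends on Y alone, and the coefficient -\<sigma>2 in X absorbs the factor S2_T. Thus d is
  the value of Y at which S1_T S2_T = K, and v is the logarithm of C / (S1_T S2_T - K). The obstacle
  in the stock equation is that an Ito integral is given only as a mean-square limit, separately at
  each time, without path regularity in t. Hence the argument stays with inner products in L2: the
  isometry is kept in bilinear form, the martingale property is the identity E (\<eta> I_t) = E
  (\<eta> I_s) for \<eta> known at time s, and the drift integral is handled by Fubini on the
  product of [0, t] with \<Omega>.\<close>

definition square_integrable :: "'a measure \<Rightarrow> ('a \<Rightarrow> real) \<Rightarrow> bool" where
  "square_integrable M f \<longleftrightarrow> f \<in> borel_measurable M \<and> integrable M (\<lambda>x. (f x)\<^sup>2)"

lemma square_integrable_measurable [measurable_dest]:
  "square_integrable M f \<Longrightarrow> f \<in> borel_measurable M"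
  by (simp add: square_integrable_def)

lemma abs_mult_le_sum_squares: "\<bar>a * b\<bar> \<le> a\<^sup>2 + b\<^sup>2" for a b :: real
  using sum_squares_bound[of "\<bar>a\<bar>" "\<bar>b\<bar>"] mult_nonneg_nonneg[of "\<bar>a\<bar>" "\<bar>b\<bar>"]
  unfolding abs_mult power2_abs by linarith

lemma square_integrable_mult:
  assumes "square_integrable M f" "square_integrable M g"
  shows "integrable M (\<lambda>x. f x * g x)"
proof (rule Bochner_Integration.integrable_bound)
  show "integrable M (\<lambda>x. (f x)\<^sup>2 + (g x)\<^sup>2)"
    using assms by (simp add: square_integrable_def)
  show "(\<lambda>x. f x * g x) \<in> borel_measurable M"
    using assms by (auto simp: square_integrable_def)
  show "AE x in M. norm (f x * g x) \<le> norm ((f x)\<^sup>2 + (g x)\<^sup>2)"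
    by (simp add: abs_mult_le_sum_squares)
qed

lemma square_integrable_cmult:
  "square_integrable M f \<Longrightarrow> square_integrable M (\<lambda>x. c * f x)"
  by (auto simp: square_integrable_def power_mult_distrib)

lemma square_integrable_zero [simp]: "square_integrable M (\<lambda>x. 0)"
  by (simp add: square_integrable_def)

lemma square_integrable_add:
  assumes "square_integrable M f" "square_integrable M g"
  shows "square_integrable M (\<lambda>x. f x + g x)"
proof -
  have "integrable M (\<lambda>x. (f x)\<^sup>2 + (g x)\<^sup>2 + 2 * (f x * g x))"
    using square_integrable_mult[OF assms] assms by (auto simp: square_integrable_def)
  then show ?thesis
    using assms by (auto simp: square_integrable_def power2_sum algebra_simps)
qed

lemma square_integrable_diff:
  assumes "square_integrable M f" "square_integrable M g"
  shows "square_integrable M (\<lambda>x. f x - g x)"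
  using square_integrable_add[OF assms(1) square_integrable_cmult[OF assms(2), of "-1"]] by simp

lemma square_integrable_cong_AE:
  assumes "square_integrable M f" "g \<in> borel_measurable M" "AE x in M. f x = g x"
  shows "square_integrable M g"
proof -
  have "integrable M (\<lambda>x. (f x)\<^sup>2) \<longleftrightarrow> integrable M (\<lambda>x. (g x)\<^sup>2)"
    using assms by (intro integrable_cong_AE) (auto simp: square_integrable_def)
  then show ?thesis
    using assms by (simp add: square_integrable_def)
qed

lemma (in finite_measure) square_integrable_const: "square_integrable M (\<lambda>x. c)"
  by (simp add: square_integrable_def)

lemma (in finite_measure) square_integrable_integrable:
  "square_integrable M f \<Longrightarrow> integrable M f"
  using square_integrable_mult[of M f "\<lambda>x. 1"] square_integrable_const by simp

lemma square_integrable_nn_integral: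
  assumes "f \<in> borel_measurable M"
  shows "square_integrable M f \<longleftrightarrow> (\<integral>\<^sup>+x. ennreal ((f x)\<^sup>2) \<partial>M) < \<infinity>"
  using assms by (simp add: square_integrable_def integrable_iff_bounded)

text \<open>The quadratic \<open>A + 2 * t * B + t\<^sup>2 * C\<close>, the integral of the square
  of \<open>f + t * g\<close>, is nonnegative; evaluating it at its minimum
  \<open>t = - (B / C)\<close> gives the bound. If \<open>C = 0\<close>, then \<open>g\<close>
  vanishes almost everywhere and \<open>B = 0\<close>.\<close>

lemma Cauchy_Schwarz_integral:
  assumes f: "square_integrable M f" and g: "square_integrable M g"
  shows "(\<integral>x. f x * g x \<partial>M)\<^sup>2 \<le> (\<integral>x. (f x)\<^sup>2 \<partial>M) * (\<integral>x. (g x)\<^sup>2 \<partial>M)"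
proof -
  define A B C where "A = (\<integral>x. (f x)\<^sup>2 \<partial>M)" and "B = (\<integral>x. f x * g x \<partial>M)"
    and "C = (\<integral>x. (g x)\<^sup>2 \<partial>M)"
  have "C \<ge> 0" "A \<ge> 0" by (simp_all add: C_def A_def)
  have pos: "0 \<le> A + 2 * t * B + t\<^sup>2 * C" for t
  proof -
    have "0 \<le> (\<integral>x. (f x + t * g x)\<^sup>2 \<partial>M)" by simp
    also have "\<dots> = (\<integral>x. (f x)\<^sup>2 + (2 * t * (f x * g x) + t\<^sup>2 * (g x)\<^sup>2) \<partial>M)"
      by (simp add: power2_sum power_mult_distrib algebra_simps)
    also have "\<dots> = A + (2 * t * B + t\<^sup>2 * C)"
      unfolding A_def B_def C_def using f g square_integrable_mult[OF f g]
      by (simp add: square_integrable_def)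
    finally show ?thesis by simp
  qed
  show ?thesis
  proof (cases "C = 0")
    case True
    have "AE x in M. (g x)\<^sup>2 = 0"
      using g True integral_nonneg_eq_0_iff_AE[of M "\<lambda>x. (g x)\<^sup>2"]
      by (simp add: C_def square_integrable_def)
    then have "B = (\<integral>x. 0 \<partial>M)"
      unfolding B_def using f g by (intro integral_cong_AE) (auto simp: square_integrable_def)
    then show ?thesis using True by (simp add: B_def C_def)
  next
    case False
    then have "C > 0" using \<open>C \<ge> 0\<close> by simp
    have "0 \<le> (A + 2 * (- (B / C)) * B + (- (B / C))\<^sup>2 * C) * C"
      using pos[of "- (B / C)"] \<open>C > 0\<close> by simp
    also have "\<dots> = A * C - B\<^sup>2"
      using \<open>C > 0\<close> by (simp add: field_simps power2_eq_square)
    finally show ?thesis by (simp add: A_def B_def C_def)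
  qed
qed

section \<open>Convergence in mean square and continuity of the inner product\<close>

definition L2_tendsto :: "'a measure \<Rightarrow> (nat \<Rightarrow> 'a \<Rightarrow> real) \<Rightarrow> ('a \<Rightarrow> real) \<Rightarrow> bool" where
  "L2_tendsto M fs f \<longleftrightarrow> (\<forall>n. square_integrable M (fs n)) \<and> square_integrable M f \<and>
     (\<lambda>n. \<integral>x. (fs n x - f x)\<^sup>2 \<partial>M) \<longlonglongrightarrow> 0"

text \<open>Extended nonnegative integrals make sense before \<open>f\<close> is known to be square
  integrable, which is the situation in \<open>has_ito_integral\<close>. A single index at distance
  below 1 makes \<open>f\<close> square integrable, being the sum of \<open>f - fs n\<close> and
  \<open>fs n\<close>.\<close>

lemma L2_tendsto_nn:
  assumes fs: "\<And>n. square_integrable M (fs n)" and f: "f \<in> borel_measurable M"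
    and lim: "(\<lambda>n. \<integral>\<^sup>+x. ennreal ((f x - fs n x)\<^sup>2) \<partial>M) \<longlonglongrightarrow> 0"
  shows "L2_tendsto M fs f"
proof -
  have "eventually (\<lambda>n. (\<integral>\<^sup>+x. ennreal ((f x - fs n x)\<^sup>2) \<partial>M) < 1) sequentially"
    using order_tendstoD(2)[OF lim, of 1] by simp
  then obtain n where n: "(\<integral>\<^sup>+x. ennreal ((f x - fs n x)\<^sup>2) \<partial>M) < 1"
    by (auto simp: eventually_sequentially)
  have "square_integrable M (\<lambda>x. f x - fs n x)"
    using f fs[of n] order.strict_trans[OF n, of \<infinity>]
    by (subst square_integrable_nn_integral) (auto simp: square_integrable_def)
  from square_integrable_add[OF this fs[of n]] have f2: "square_integrable M f"
    by simp
  have "ennreal (\<integral>x. (fs n x - f x)\<^sup>2 \<partial>M) = (\<integral>\<^sup>+x. ennreal ((f x - fs n x)\<^sup>2) \<partial>M)" for n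
    using square_integrable_diff[OF fs[of n] f2]
    by (subst nn_integral_eq_integral[symmetric])
       (auto simp: square_integrable_def power2_commute)
  then have "(\<lambda>n. ennreal (\<integral>x. (fs n x - f x)\<^sup>2 \<partial>M)) \<longlonglongrightarrow> ennreal 0"
    using lim by simp
  then have "(\<lambda>n. \<integral>x. (fs n x - f x)\<^sup>2 \<partial>M) \<longlonglongrightarrow> 0"
    by (rule tendsto_ennrealD) auto
  then show ?thesis using fs f2 by (simp add: L2_tendsto_def)
qed

lemma L2_tendsto_const: "square_integrable M f \<Longrightarrow> L2_tendsto M (\<lambda>n. f) f"
  by (simp add: L2_tendsto_def)

text \<open>With \<open>h = fs - f\<close> and \<open>k = gs - g\<close> the product is
  \<open>h k + h g + f k + f g\<close>, and Cauchy-Schwarz sends the first three integrals to 0.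
  Identities between inner products of simple integrals pass to Ito integrals by this
  continuity.\<close>

lemma L2_tendsto_mult:
  assumes f: "L2_tendsto M fs f" and g: "L2_tendsto M gs g"
  shows "(\<lambda>n. \<integral>x. fs n x * gs n x \<partial>M) \<longlonglongrightarrow> (\<integral>x. f x * g x \<partial>M)"
proof -
  have [simp]: "square_integrable M (fs n)" "square_integrable M (gs n)" "square_integrable M f"
    "square_integrable M g" for n
    using f g by (auto simp: L2_tendsto_def)
  define h where "h = (\<lambda>n x. fs n x - f x)"
  define k where "k = (\<lambda>n x. gs n x - g x)"
  have h[simp]: "square_integrable M (h n)" and k[simp]: "square_integrable M (k n)" for n
    by (auto simp: h_def k_def intro!: square_integrable_diff)
  have lh: "(\<lambda>n. \<integral>x. (h n x)\<^sup>2 \<partial>M) \<longlonglongrightarrow> 0" and lk: "(\<lambda>n. \<integral>x. (k n x)\<^sup>2 \<partial>M) \<longlonglongrightarrow> 0"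
    using f g by (auto simp: L2_tendsto_def h_def k_def)
  have zero: "(\<lambda>n. \<integral>x. u n x * w n x \<partial>M) \<longlonglongrightarrow> 0"
    if "\<And>n. square_integrable M (u n)" "\<And>n. square_integrable M (w n)"
      "(\<lambda>n. (\<integral>x. (u n x)\<^sup>2 \<partial>M) * (\<integral>x. (w n x)\<^sup>2 \<partial>M)) \<longlonglongrightarrow> 0" for u w
  proof -
    have "(\<lambda>n. (\<integral>x. u n x * w n x \<partial>M)\<^sup>2) \<longlonglongrightarrow> 0"
      by (rule tendsto_sandwich[OF _ _ tendsto_const that(3)])
         (auto intro!: always_eventually Cauchy_Schwarz_integral that)
    then show ?thesis by simp
  qed
  have "(\<lambda>n. (\<integral>x. h n x * k n x \<partial>M) + ((\<integral>x. h n x * g x \<partial>M) + ((\<integral>x. f x * k n x \<partial>M)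
       + (\<integral>x. f x * g x \<partial>M)))) \<longlonglongrightarrow> 0 + (0 + (0 + (\<integral>x. f x * g x \<partial>M)))"
    by (intro tendsto_add zero tendsto_const)
       (auto intro!: tendsto_mult_zero lh lk tendsto_mult_left_zero tendsto_mult_right_zero)
  also have "(\<lambda>n. (\<integral>x. h n x * k n x \<partial>M) + ((\<integral>x. h n x * g x \<partial>M) + ((\<integral>x. f x * k n x \<partial>M)
       + (\<integral>x. f x * g x \<partial>M)))) = (\<lambda>n. \<integral>x. fs n x * gs n x \<partial>M)"
  proof
    fix n
    have "(\<integral>x. h n x * k n x \<partial>M) + ((\<integral>x. h n x * g x \<partial>M) + ((\<integral>x. f x * k n x \<partial>M)
       + (\<integral>x. f x * g x \<partial>M))) = (\<integral>x. h n x * k n x + (h n x * g x + (f x * k n x + f x * g x)) \<partial>M)"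
      by (simp add: square_integrable_mult)
    also have "\<dots> = (\<integral>x. fs n x * gs n x \<partial>M)"
      by (intro Bochner_Integration.integral_cong) (auto simp: h_def k_def algebra_simps)
    finally show "(\<integral>x. h n x * k n x \<partial>M) + ((\<integral>x. h n x * g x \<partial>M) + ((\<integral>x. f x * k n x \<partial>M)
       + (\<integral>x. f x * g x \<partial>M))) = (\<integral>x. fs n x * gs n x \<partial>M)" .
  qed
  finally show ?thesis by simp
qed

section \<open>Integral equations on an interval\<close>

text \<open>Integrability is enough to start from: the equation itself makes \<open>h\<close>
  continuous, so its primitive \<open>u\<close> is differentiable, and
  \<open>exp (- l * s) * (a + l * u s)\<close> has derivative 0. Regularity in time of the moments
  of the stock therefore comes for free.\<close>

lemma linear_integral_equation:
  fixes h :: "real \<Rightarrow> real"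
  assumes int: "set_integrable lborel {0..T} h"
    and eq: "\<And>t. t \<in> {0..T} \<Longrightarrow> h t = a + l * (LINT s:{0..t}|lborel. h s)"
    and t: "t \<in> {0..T}"
  shows "h t = a * exp (l * t)"
proof -
  define u where "u t = integral {0..t} h" for t
  have eq': "h t = a + l * u t" if "t \<in> {0..T}" for t
  proof -
    have "set_integrable lborel {0..t} h"
      using int that by (rule_tac set_integrable_subset) auto
    then show ?thesis
      using eq[OF that] by (simp add: u_def set_borel_integral_eq_integral(2))
  qed
  have "h integrable_on {0..T}"
    using int by (rule set_borel_integral_eq_integral(1))
  then have "continuous_on {0..T} u"
    unfolding u_def by (rule indefinite_integral_continuous_1)
  then have "continuous_on {0..T} (\<lambda>t. a + l * u t)"
    by (intro continuous_intros)
  then have cont: "continuous_on {0..T} h"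
    by (rule continuous_on_eq) (use eq' in simp)
  have du: "(u has_real_derivative h s) (at s within {0..T})" if "s \<in> {0..T}" for s
    unfolding u_def using integral_has_real_derivative[OF cont that] .
  define g where "g s = exp (- l * s) * (a + l * u s)" for s
  have "(g has_real_derivative 0) (at s within {0..T})" if "s \<in> {0..T}" for s
    unfolding g_def
    by (rule derivative_eq_intros du[OF that] refl | simp add: eq'[OF that] algebra_simps)+
  then have "g t = g 0"
    using has_field_derivative_zero_constant[of "{0..T}" g] t
    by (metis atLeastAtMost_iff convex_real_interval(5) order_refl order_trans)
  also have "g 0 = a" by (simp add: g_def u_def)
  finally have "exp (- l * t) * h t = a" using eq'[OF t] by (simp add: g_def)
  then show ?thesis by (simp add: exp_minus divide_simps mult.commute)
qed

section \<open>Exponential moments of the normal distribution\<close>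

text \<open>Completing the square: tilting by \<open>exp (l * x)\<close> multiplies by a constant
  and moves the mean from 0 to \<open>l * \<sigma>\<^sup>2\<close>. This is the one-dimensional
  source of the drift produced by tilting a Brownian motion.\<close>

lemma exp_times_normal_density:
  assumes "\<sigma> > 0"
  shows "exp (l * x) * normal_density 0 \<sigma> x = exp (l\<^sup>2 * \<sigma>\<^sup>2 / 2) * normal_density (l * \<sigma>\<^sup>2) \<sigma> x"
proof -
  have "l * x - x\<^sup>2 / (2 * \<sigma>\<^sup>2) = l\<^sup>2 * \<sigma>\<^sup>2 / 2 - (x - l * \<sigma>\<^sup>2)\<^sup>2 / (2 * \<sigma>\<^sup>2)"
    using assms by (simp add: field_simps power2_eq_square)
  then show ?thesis
    unfolding normal_density_def by (simp add: exp_add[symmetric] mult.left_commute mult.assoc)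
qed

lemma normal_exp_moment:
  assumes "\<sigma> > 0"
  shows "has_bochner_integral lborel (\<lambda>x. normal_density 0 \<sigma> x * exp (l * x)) (exp (l\<^sup>2 * \<sigma>\<^sup>2 / 2))"
    and "has_bochner_integral lborel (\<lambda>x. normal_density 0 \<sigma> x * (x * exp (l * x)))
      (l * \<sigma>\<^sup>2 * exp (l\<^sup>2 * \<sigma>\<^sup>2 / 2))"
proof -
  have *: "normal_density 0 \<sigma> x * exp (l * x) = exp (l\<^sup>2 * \<sigma>\<^sup>2 / 2) * normal_density (l * \<sigma>\<^sup>2) \<sigma> x" for x
    using exp_times_normal_density[OF assms] by (simp add: mult.commute)
  show "has_bochner_integral lborel (\<lambda>x. normal_density 0 \<sigma> x * exp (l * x)) (exp (l\<^sup>2 * \<sigma>\<^sup>2 / 2))"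
    unfolding * using assms by (auto simp: has_bochner_integral_iff)
  have **: "normal_density 0 \<sigma> x * (x * exp (l * x))
    = exp (l\<^sup>2 * \<sigma>\<^sup>2 / 2) * (normal_density (l * \<sigma>\<^sup>2) \<sigma> x * x)" for x
    using *[of x] by (simp add: ac_simps)
  show "has_bochner_integral lborel (\<lambda>x. normal_density 0 \<sigma> x * (x * exp (l * x)))
      (l * \<sigma>\<^sup>2 * exp (l\<^sup>2 * \<sigma>\<^sup>2 / 2))"
    unfolding ** using normal_moment_nz_1[OF assms, of "l * \<sigma>\<^sup>2"]
    by (auto simp: has_bochner_integral_iff)
qed

section \<open>Increments of a Brownian motion on a finite horizon\<close>

text \<open>The filtration may be larger than the one generated by \<open>b\<close>. Each coordinate
  of the correlated Wiener process therefore qualifies with the common filtration, to which the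
  stocks are adapted.\<close>

locale brownian_motion = prob_space M
  for M :: "'a measure" and F :: "real \<Rightarrow> 'a measure" and T :: real and b :: "real \<Rightarrow> 'a \<Rightarrow> real" +
  assumes subalgebra_F: "\<And>t. subalgebra M (F t)"
    and F_mono: "\<And>s t. s \<le> t \<Longrightarrow> sets (F s) \<subseteq> sets (F t)"
    and adapted: "\<And>t. t \<in> {0..T} \<Longrightarrow> b t \<in> borel_measurable (F t)"
    and start_zero: "AE \<omega> in M. b 0 \<omega> = 0"
    and increment_normal: "\<And>s t. 0 \<le> s \<Longrightarrow> s < t \<Longrightarrow> t \<le> T \<Longrightarrow>
      distributed M lborel (\<lambda>\<omega>. b t \<omega> - b s \<omega>) (\<lambda>x. ennreal (normal_density 0 (sqrt (t - s)) x))"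
    and increment_indep: "\<And>s t. 0 \<le> s \<Longrightarrow> s < t \<Longrightarrow> t \<le> T \<Longrightarrow>
      indep_set (sets (F s)) {(\<lambda>\<omega>. b t \<omega> - b s \<omega>) -` B \<inter> space M | B. B \<in> sets borel}"
begin

lemma F_measurable_mono:
  "f \<in> measurable (F s) N \<Longrightarrow> s \<le> t \<Longrightarrow> f \<in> measurable (F t) N"
  using measurable_from_subalg[of "F t" "F s" f N] subalgebra_F[of s] subalgebra_F[of t] F_mono[of s t]
  by (simp add: subalgebra_def)

lemma F_measurable_M: "f \<in> measurable (F s) N \<Longrightarrow> f \<in> measurable M N"
  by (rule measurable_from_subalg[OF subalgebra_F])

lemma adapted_le: "0 \<le> s \<Longrightarrow> s \<le> t \<Longrightarrow> t \<le> T \<Longrightarrow> b s \<in> borel_measurable (F t)"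
  by (rule F_measurable_mono[OF adapted]) auto

lemma measurable_b: "0 \<le> s \<Longrightarrow> s \<le> T \<Longrightarrow> b s \<in> borel_measurable M"
  by (rule F_measurable_M[OF adapted]) auto

text \<open>Independence of the increment from the past splits off the factor \<open>\<eta>\<close>;
  what remains is a Gaussian integral. The mean, the variance and the two tilted moments below are
  instances with different \<open>g\<close>.\<close>

lemma increment_expectation:
  assumes st: "0 \<le> s" "s < t" "t \<le> T"
    and \<eta>: "\<eta> \<in> borel_measurable (F s)" "integrable M \<eta>" and g: "g \<in> borel_measurable borel"
    and \<gamma>: "has_bochner_integral lborel (\<lambda>x. normal_density 0 (sqrt (t - s)) x * g x) \<gamma>"
  shows "has_bochner_integral M (\<lambda>\<omega>. \<eta> \<omega> * g (b t \<omega> - b s \<omega>)) ((\<integral>\<omega>. \<eta> \<omega> \<partial>M) * \<gamma>)"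
proof -
  have [measurable]: "b t \<in> borel_measurable M" "b s \<in> borel_measurable M"
    using st by (auto intro: measurable_b)
  have [measurable]: "\<eta> \<in> borel_measurable M" "g \<in> borel_measurable borel"
    using \<eta> g by auto
  let ?D = "\<lambda>\<omega>. b t \<omega> - b s \<omega>"
  have space: "space (F s) = space M"
    using subalgebra_F by (auto simp: subalgebra_def)
  have sub1: "sigma_sets (space M) {\<eta> -` A \<inter> space M | A. A \<in> sets borel} \<subseteq> sets (F s)"
    using \<eta>(1) unfolding space[symmetric] by (intro sets.sigma_sets_subset) (auto dest: measurable_sets)
  \<comment> \<open>The preimages of Borel sets under one map already form a sigma-algebra, and a
    preimage under \<open>g\<close> of the increment is a preimage under the increment. So the
    assumed independence covers the generated sigma-algebras that \<open>indep_var\<close> asks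
    for.\<close>
  have sub2: "sigma_sets (space M) {(\<lambda>\<omega>. g (?D \<omega>)) -` A \<inter> space M | A. A \<in> sets borel}
      \<subseteq> {?D -` B \<inter> space M | B. B \<in> sets borel}"
  proof -
    have "sigma_sets (space M) {(\<lambda>\<omega>. g (?D \<omega>)) -` A \<inter> space M | A. A \<in> sets borel}
       = {(\<lambda>\<omega>. g (?D \<omega>)) -` A \<inter> space M | A. A \<in> sets borel}"
      using sets_vimage_algebra[of "space M" "\<lambda>\<omega>. g (?D \<omega>)" "borel :: real measure"]
        sets_vimage_algebra2[of "\<lambda>\<omega>. g (?D \<omega>)" "space M" "borel :: real measure"]
      by simp
    also have "\<dots> \<subseteq> {?D -` B \<inter> space M | B. B \<in> sets borel}"
    proof safe
      fix A :: "real set" assume "A \<in> sets borel"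
      then have "g -` A \<in> sets borel"
        using measurable_sets[OF g, of A] by simp
      moreover have "(\<lambda>\<omega>. g (?D \<omega>)) -` A \<inter> space M = ?D -` (g -` A) \<inter> space M" by auto
      ultimately show "\<exists>B. (\<lambda>\<omega>. g (?D \<omega>)) -` A \<inter> space M = ?D -` B \<inter> space M \<and> B \<in> sets borel"
        by blast
    qed
    finally show ?thesis .
  qed
  have "indep_set (sigma_sets (space M) {\<eta> -` A \<inter> space M | A. A \<in> sets borel})
     (sigma_sets (space M) {(\<lambda>\<omega>. g (?D \<omega>)) -` A \<inter> space M | A. A \<in> sets borel})"
    using increment_indep[OF st] unfolding indep_set_def
    by (rule indep_sets_mono_sets) (use sub1 sub2 in \<open>auto split: bool.split\<close>)
  then have indep: "indep_var borel \<eta> borel (\<lambda>\<omega>. g (?D \<omega>))"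
    by (simp add: indep_var_eq)
  have int: "integrable M (\<lambda>\<omega>. g (?D \<omega>))" "(\<integral>\<omega>. g (?D \<omega>) \<partial>M) = \<gamma>"
    using \<gamma> distributed_integrable[OF increment_normal[OF st], of g]
      distributed_integral[OF increment_normal[OF st], of g] g
    by (auto simp: has_bochner_integral_iff)
  show ?thesis
    using indep_var_integrable[OF indep \<eta>(2) int(1)] indep_var_lebesgue_integral[OF indep \<eta>(2) int(1)] int(2)
    by (simp add: has_bochner_integral_iff)
qed

lemma increment_mean:
  assumes st: "0 \<le> s" "s \<le> t" "t \<le> T" and \<eta>: "\<eta> \<in> borel_measurable (F s)" "integrable M \<eta>"
  shows "has_bochner_integral M (\<lambda>\<omega>. \<eta> \<omega> * (b t \<omega> - b s \<omega>)) 0"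
proof (cases "s < t")
  case True
  show ?thesis
    using increment_expectation[OF st(1) True st(3) \<eta>, of "\<lambda>x. x" 0] normal_moment_odd[of "sqrt (t - s)" 0 0] True
    by simp
qed (use st in auto)

lemma increment_square:
  assumes st: "0 \<le> s" "s \<le> t" "t \<le> T" and \<eta>: "\<eta> \<in> borel_measurable (F s)" "integrable M \<eta>"
  shows "has_bochner_integral M (\<lambda>\<omega>. \<eta> \<omega> * (b t \<omega> - b s \<omega>)\<^sup>2) ((\<integral>\<omega>. \<eta> \<omega> \<partial>M) * (t - s))"
proof (cases "s < t")
  case True
  show ?thesis
    using increment_expectation[OF st(1) True st(3) \<eta>, of "\<lambda>x. x\<^sup>2" "t - s"]
      normal_moment_even[of "sqrt (t - s)" 0 1] True
    by (simp add: fact_2 diff_divide_distrib)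
qed (use st in auto)

lemma increment_exp:
  assumes st: "0 \<le> s" "s \<le> t" "t \<le> T" and \<eta>: "\<eta> \<in> borel_measurable (F s)" "integrable M \<eta>"
  shows "has_bochner_integral M (\<lambda>\<omega>. \<eta> \<omega> * exp (l * (b t \<omega> - b s \<omega>)))
    ((\<integral>\<omega>. \<eta> \<omega> \<partial>M) * exp (l\<^sup>2 * (t - s) / 2))"
proof (cases "s < t")
  case True
  show ?thesis
    using increment_expectation[OF st(1) True st(3) \<eta>, of "\<lambda>x. exp (l * x)" "exp (l\<^sup>2 * (t - s) / 2)"]
      normal_exp_moment(1)[of "sqrt (t - s)" l] True
    by simp
next
  case False
  then have "s = t" using st by simp
  with \<eta>(2) show ?thesis by (auto simp: has_bochner_integral_iff)
qed

lemma increment_times_exp: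
  assumes st: "0 \<le> s" "s \<le> t" "t \<le> T" and \<eta>: "\<eta> \<in> borel_measurable (F s)" "integrable M \<eta>"
  shows "has_bochner_integral M (\<lambda>\<omega>. \<eta> \<omega> * ((b t \<omega> - b s \<omega>) * exp (l * (b t \<omega> - b s \<omega>))))
    ((\<integral>\<omega>. \<eta> \<omega> \<partial>M) * (l * (t - s) * exp (l\<^sup>2 * (t - s) / 2)))"
proof (cases "s < t")
  case True
  show ?thesis
    using increment_expectation[OF st(1) True st(3) \<eta>, of "\<lambda>x. x * exp (l * x)" "l * (t - s) * exp (l\<^sup>2 * (t - s) / 2)"]
      normal_exp_moment(2)[of "sqrt (t - s)" l] True
    by simp
qed (use st in auto)

lemma exp_moment:
  assumes "t \<in> {0..T}"
  shows "has_bochner_integral M (\<lambda>\<omega>. exp (l * b t \<omega>)) (exp (l\<^sup>2 * t / 2))"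
proof -
  have [measurable]: "b t \<in> borel_measurable M" "b 0 \<in> borel_measurable M"
    using assms by (auto intro: measurable_b)
  have "has_bochner_integral M (\<lambda>\<omega>. 1 * exp (l * (b t \<omega> - b 0 \<omega>)))
      ((\<integral>\<omega>. 1 \<partial>M) * exp (l\<^sup>2 * (t - 0) / 2))"
    by (rule increment_exp) (use assms in auto)
  then have *: "has_bochner_integral M (\<lambda>\<omega>. exp (l * (b t \<omega> - b 0 \<omega>))) (exp (l\<^sup>2 * t / 2))"
    by (simp add: prob_space)
  have "AE \<omega> in M. exp (l * (b t \<omega> - b 0 \<omega>)) = exp (l * b t \<omega>)"
    using start_zero by eventually_elim simp
  then show ?thesis
    by (intro iffD1[OF has_bochner_integral_cong_AE *]) simp_all
qed

lemma square_integrable_exp: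
  assumes "t \<in> {0..T}"
  shows "square_integrable M (\<lambda>\<omega>. exp (l * b t \<omega>))"
proof -
  have "(exp (l * x))\<^sup>2 = exp (2 * l * x)" for x
    by (simp add: power2_eq_square exp_add[symmetric])
  then show ?thesis
    using exp_moment[OF assms, of "2 * l"] measurable_b[of t] assms
    by (simp add: square_integrable_def has_bochner_integral_iff)
qed

lemma square_integrable_increment:
  assumes st: "0 \<le> s" "s \<le> t" "t \<le> T" and \<eta>: "\<eta> \<in> borel_measurable (F s)" "square_integrable M \<eta>"
  shows "square_integrable M (\<lambda>\<omega>. \<eta> \<omega> * (b t \<omega> - b s \<omega>))"
  using increment_square[OF st, of "\<lambda>\<omega>. (\<eta> \<omega>)\<^sup>2"] \<eta> st measurable_b[of t] measurable_b[of s]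
  by (simp add: square_integrable_def power_mult_distrib has_bochner_integral_iff
      borel_measurable_times borel_measurable_diff)

text \<open>Split the longer increment at \<open>t\<close>: the part up to \<open>t\<close> gives
  the variance \<open>t - s\<close>, the part after \<open>t\<close> is centred given
  \<open>F t\<close>.\<close>

lemma increment_overlap:
  assumes st: "0 \<le> s" "s \<le> t" "t \<le> u" "u \<le> T" and \<eta>: "\<eta> \<in> borel_measurable (F s)" "integrable M \<eta>"
  shows "has_bochner_integral M (\<lambda>\<omega>. \<eta> \<omega> * ((b t \<omega> - b s \<omega>) * (b u \<omega> - b s \<omega>)))
    ((\<integral>\<omega>. \<eta> \<omega> \<partial>M) * (t - s))"
proof -
  have "has_bochner_integral M (\<lambda>\<omega>. \<eta> \<omega> * (b t \<omega> - b s \<omega>) * (b u \<omega> - b t \<omega>)) 0"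
  proof (rule increment_mean)
    have "\<eta> \<in> borel_measurable (F t)" "b t \<in> borel_measurable (F t)" "b s \<in> borel_measurable (F t)"
      using st \<eta> by (auto intro: F_measurable_mono adapted_le)
    then show "(\<lambda>\<omega>. \<eta> \<omega> * (b t \<omega> - b s \<omega>)) \<in> borel_measurable (F t)" by measurable
    show "integrable M (\<lambda>\<omega>. \<eta> \<omega> * (b t \<omega> - b s \<omega>))"
      using increment_mean[of s t \<eta>] st \<eta> by (simp add: has_bochner_integral_iff)
  qed (use st in auto)
  moreover have "has_bochner_integral M (\<lambda>\<omega>. \<eta> \<omega> * (b t \<omega> - b s \<omega>)\<^sup>2) ((\<integral>\<omega>. \<eta> \<omega> \<partial>M) * (t - s))"
    using st \<eta> by (intro increment_square) auto
  ultimately have "has_bochner_integral M (\<lambda>\<omega>. \<eta> \<omega> * (b t \<omega> - b s \<omega>)\<^sup>2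
     + \<eta> \<omega> * (b t \<omega> - b s \<omega>) * (b u \<omega> - b t \<omega>)) ((\<integral>\<omega>. \<eta> \<omega> \<partial>M) * (t - s) + 0)"
    by (rule has_bochner_integral_add[rotated])
  also have "(\<lambda>\<omega>. \<eta> \<omega> * (b t \<omega> - b s \<omega>)\<^sup>2 + \<eta> \<omega> * (b t \<omega> - b s \<omega>) * (b u \<omega> - b t \<omega>))
    = (\<lambda>\<omega>. \<eta> \<omega> * ((b t \<omega> - b s \<omega>) * (b u \<omega> - b s \<omega>)))"
    by (auto simp: algebra_simps power2_eq_square)
  finally show ?thesis by simp
qed

text \<open>The factor \<open>max 0 (min t t' - s')\<close> is the length of the overlap of the two
  time intervals, so this is the Ito isometry for two elementary integrands. For disjoint intervals
  everything but the later increment is known at \<open>s'\<close>.\<close>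

lemma increment_covariance_ordered:
  assumes ord: "0 \<le> s" "s \<le> s'" "s \<le> t" "s' \<le> t'" "t \<le> T" "t' \<le> T"
    and \<xi>: "\<xi> \<in> borel_measurable (F s)" "square_integrable M \<xi>"
    and \<xi>': "\<xi>' \<in> borel_measurable (F s')" "square_integrable M \<xi>'"
  shows "(\<integral>\<omega>. (\<xi> \<omega> * (b t \<omega> - b s \<omega>)) * (\<xi>' \<omega> * (b t' \<omega> - b s' \<omega>)) \<partial>M)
    = (\<integral>\<omega>. \<xi> \<omega> * \<xi>' \<omega> \<partial>M) * max 0 (min t t' - s')"
proof -
  have m: "\<xi> \<in> borel_measurable (F s')" "b s \<in> borel_measurable (F s')"
    using ord \<xi> by (auto intro: F_measurable_mono adapted_le)
  show ?thesis
  proof (cases "t \<le> s'")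
    case True
    have "has_bochner_integral M (\<lambda>\<omega>. (\<xi> \<omega> * (b t \<omega> - b s \<omega>)) * \<xi>' \<omega> * (b t' \<omega> - b s' \<omega>)) 0"
    proof (rule increment_mean)
      have "b t \<in> borel_measurable (F s')"
        using ord True by (auto intro: adapted_le)
      then show "(\<lambda>\<omega>. (\<xi> \<omega> * (b t \<omega> - b s \<omega>)) * \<xi>' \<omega>) \<in> borel_measurable (F s')"
        using m \<xi>'(1) by measurable
      show "integrable M (\<lambda>\<omega>. (\<xi> \<omega> * (b t \<omega> - b s \<omega>)) * \<xi>' \<omega>)"
        using ord \<xi> \<xi>' by (intro square_integrable_mult square_integrable_increment) auto
    qed (use ord in auto)
    moreover have "max 0 (min t t' - s') = 0" using True by (auto simp: min_def max_def)
    ultimately show ?thesis by (simp add: has_bochner_integral_iff mult.assoc)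
  next
    case False
    \<comment> \<open>For overlapping intervals the first increment is split at \<open>s'\<close>.
      Its earlier part belongs to the past of the second increment and contributes 0; its later part
      starts at \<open>s'\<close>, like the second increment.\<close>
    have 1: "has_bochner_integral M (\<lambda>\<omega>. (\<xi> \<omega> * (b s' \<omega> - b s \<omega>)) * \<xi>' \<omega> * (b t' \<omega> - b s' \<omega>)) 0"
    proof (rule increment_mean)
      have "b s' \<in> borel_measurable (F s')"
        using ord by (auto intro: adapted_le)
      then show "(\<lambda>\<omega>. (\<xi> \<omega> * (b s' \<omega> - b s \<omega>)) * \<xi>' \<omega>) \<in> borel_measurable (F s')"
        using m \<xi>'(1) by measurable
      show "integrable M (\<lambda>\<omega>. (\<xi> \<omega> * (b s' \<omega> - b s \<omega>)) * \<xi>' \<omega>)"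
        using ord False \<xi> \<xi>' by (intro square_integrable_mult square_integrable_increment) auto
    qed (use ord in auto)
    have 2: "has_bochner_integral M (\<lambda>\<omega>. (\<xi> \<omega> * \<xi>' \<omega>) * ((b (min t t') \<omega> - b s' \<omega>) * (b (max t t') \<omega> - b s' \<omega>)))
      ((\<integral>\<omega>. \<xi> \<omega> * \<xi>' \<omega> \<partial>M) * (min t t' - s'))"
    proof (rule increment_overlap)
      show "(\<lambda>\<omega>. \<xi> \<omega> * \<xi>' \<omega>) \<in> borel_measurable (F s')"
        using m \<xi>'(1) by measurable
    qed (use ord False \<xi> \<xi>' in \<open>auto intro: square_integrable_mult\<close>)
    have 3: "(b (min t t') \<omega> - b s' \<omega>) * (b (max t t') \<omega> - b s' \<omega>) = (b t \<omega> - b s' \<omega>) * (b t' \<omega> - b s' \<omega>)" for \<omega>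
      by (auto simp: min_def max_def)
    have "has_bochner_integral M (\<lambda>\<omega>. (\<xi> \<omega> * (b s' \<omega> - b s \<omega>)) * \<xi>' \<omega> * (b t' \<omega> - b s' \<omega>)
        + (\<xi> \<omega> * \<xi>' \<omega>) * ((b t \<omega> - b s' \<omega>) * (b t' \<omega> - b s' \<omega>)))
      (0 + (\<integral>\<omega>. \<xi> \<omega> * \<xi>' \<omega> \<partial>M) * (min t t' - s'))"
      using has_bochner_integral_add[OF 1 2] unfolding 3 .
    also have "(\<lambda>\<omega>. (\<xi> \<omega> * (b s' \<omega> - b s \<omega>)) * \<xi>' \<omega> * (b t' \<omega> - b s' \<omega>)
        + (\<xi> \<omega> * \<xi>' \<omega>) * ((b t \<omega> - b s' \<omega>) * (b t' \<omega> - b s' \<omega>)))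
      = (\<lambda>\<omega>. (\<xi> \<omega> * (b t \<omega> - b s \<omega>)) * (\<xi>' \<omega> * (b t' \<omega> - b s' \<omega>)))"
      by (auto simp: algebra_simps)
    finally show ?thesis
      using False ord by (simp add: has_bochner_integral_iff max_def)
  qed
qed

lemma increment_covariance:
  assumes ord: "0 \<le> s" "s \<le> t" "t \<le> T" "0 \<le> s'" "s' \<le> t'" "t' \<le> T"
    and \<xi>: "\<xi> \<in> borel_measurable (F s)" "square_integrable M \<xi>"
    and \<xi>': "\<xi>' \<in> borel_measurable (F s')" "square_integrable M \<xi>'"
  shows "(\<integral>\<omega>. (\<xi> \<omega> * (b t \<omega> - b s \<omega>)) * (\<xi>' \<omega> * (b t' \<omega> - b s' \<omega>)) \<partial>M)
    = (\<integral>\<omega>. \<xi> \<omega> * \<xi>' \<omega> \<partial>M) * max 0 (min t t' - max s s')"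
proof (cases "s \<le> s'")
  case True
  then show ?thesis
    using increment_covariance_ordered[of s s' t t' \<xi> \<xi>'] assms by (simp add: max_def)
next
  case False
  then show ?thesis
    using increment_covariance_ordered[of s' s t' t \<xi>' \<xi>] assms
    by (simp add: max_def min.commute mult.commute)
qed

text \<open>Tilting by \<open>exp (l b\<^sub>u)\<close> gives the increments of \<open>b\<close> the drift \<open>l\<close>.\<close>

lemma increment_tilted:
  assumes ord: "0 \<le> s" "s \<le> t" "t \<le> u" "u \<le> T"
    and \<xi>: "\<xi> \<in> borel_measurable (F s)" "square_integrable M \<xi>"
  shows "(\<integral>\<omega>. \<xi> \<omega> * (b t \<omega> - b s \<omega>) * exp (l * b u \<omega>) \<partial>M)
    = l * (t - s) * (\<integral>\<omega>. \<xi> \<omega> * exp (l * b u \<omega>) \<partial>M)"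
proof -
  define \<eta> where "\<eta> \<omega> = \<xi> \<omega> * exp (l * b s \<omega>)" for \<omega>
  have \<eta>: "\<eta> \<in> borel_measurable (F s)" "integrable M \<eta>"
    using ord adapted[of s] \<xi> square_integrable_exp[of s l] unfolding \<eta>_def
    by (auto intro!: square_integrable_mult)
  have mt: "\<eta> \<in> borel_measurable (F t)" "b t \<in> borel_measurable (F t)" "b s \<in> borel_measurable (F t)"
    using ord \<eta> by (auto intro: F_measurable_mono adapted_le)
  \<comment> \<open>The three factors live on \<open>[0, s]\<close>, \<open>(s, t]\<close> and
    \<open>(t, u]\<close>. Removing the last and then the middle one by independence gives two
    values that differ exactly by the factor \<open>l * (t - s)\<close>.\<close>
  have split: "exp (l * b u \<omega>) = exp (l * b s \<omega>) * exp (l * (b t \<omega> - b s \<omega>)) * exp (l * (b u \<omega> - b t \<omega>))" for \<omega>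
    by (simp add: exp_add[symmetric] algebra_simps)
  have st: "0 \<le> s" "s \<le> t" "t \<le> T" and tu: "0 \<le> t" "t \<le> u" "u \<le> T" using ord by auto
  have m1: "(\<lambda>\<omega>. \<eta> \<omega> * exp (l * (b t \<omega> - b s \<omega>))) \<in> borel_measurable (F t)"
    and m2: "(\<lambda>\<omega>. \<eta> \<omega> * ((b t \<omega> - b s \<omega>) * exp (l * (b t \<omega> - b s \<omega>)))) \<in> borel_measurable (F t)"
    using mt by measurable
  have "(\<integral>\<omega>. \<eta> \<omega> * exp (l * (b t \<omega> - b s \<omega>)) * exp (l * (b u \<omega> - b t \<omega>)) \<partial>M)
    = (\<integral>\<omega>. \<eta> \<omega> \<partial>M) * exp (l\<^sup>2 * (t - s) / 2) * exp (l\<^sup>2 * (u - t) / 2)"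
    using increment_exp[OF tu m1, of l] increment_exp[OF st \<eta>, of l]
    by (simp add: has_bochner_integral_iff)
  moreover have "(\<integral>\<omega>. \<eta> \<omega> * ((b t \<omega> - b s \<omega>) * exp (l * (b t \<omega> - b s \<omega>))) * exp (l * (b u \<omega> - b t \<omega>)) \<partial>M)
    = (\<integral>\<omega>. \<eta> \<omega> \<partial>M) * (l * (t - s) * exp (l\<^sup>2 * (t - s) / 2)) * exp (l\<^sup>2 * (u - t) / 2)"
    using increment_exp[OF tu m2, of l] increment_times_exp[OF st \<eta>, of l]
    by (simp add: has_bochner_integral_iff)
  ultimately show ?thesis
    unfolding split \<eta>_def by (simp add: ac_simps)
qed

end

section \<open>Integration over the product of a time interval and the sample space\<close>

lemma (in pair_sigma_finite) has_bochner_integral_pair_times: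
  fixes f g :: "_ \<Rightarrow> real"
  assumes f: "integrable M1 f" and g: "integrable M2 g"
  shows "has_bochner_integral (M1 \<Otimes>\<^sub>M M2) (\<lambda>z. f (fst z) * g (snd z))
    ((\<integral>x. f x \<partial>M1) * (\<integral>y. g y \<partial>M2))"
proof -
  have [measurable]: "f \<in> borel_measurable M1" "g \<in> borel_measurable M2" using f g by auto
  have int: "integrable (M1 \<Otimes>\<^sub>M M2) (\<lambda>z. f (fst z) * g (snd z))"
  proof (rule Fubini_integrable)
    show "integrable M1 (\<lambda>x. \<integral>y. norm (f (fst (x, y)) * g (snd (x, y))) \<partial>M2)"
      using f by (simp add: abs_mult)
    show "AE x in M1. integrable M2 (\<lambda>y. f (fst (x, y)) * g (snd (x, y)))"
      using g by simp
  qed measurable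
  have "(\<integral>z. f (fst z) * g (snd z) \<partial>(M1 \<Otimes>\<^sub>M M2)) = (\<integral>x. f x \<partial>M1) * (\<integral>y. g y \<partial>M2)"
    using integral_fst'[OF int] by simp
  with int show ?thesis by (simp add: has_bochner_integral_iff)
qed

text \<open>With this measure the iterated integrals in the definition of the Ito integral become
  squared norms on a single product space, to which the mean-square calculus above applies.\<close>

abbreviation time_measure :: "real \<Rightarrow> real measure" where
  "time_measure t \<equiv> restrict_space lborel {0..t}"

lemma finite_time_measure: "finite_measure (time_measure t)"
  by (intro finite_measureI) (simp add: emeasure_restrict_space space_restrict_space emeasure_lborel_Icc_eq)

lemma integral_time_measure:
  "(\<integral>s. f s \<partial>time_measure t) = (LINT s:{0..t}|lborel. f s)" for f :: "real \<Rightarrow> real"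
  unfolding set_lebesgue_integral_def by (rule integral_restrict_space) simp

lemma integrable_time_measure:
  "integrable (time_measure t) f \<longleftrightarrow> set_integrable lborel {0..t} f" for f :: "real \<Rightarrow> real"
  unfolding set_integrable_def by (rule integrable_restrict_space) simp

text \<open>Time-side counterpart of \<open>increment_covariance\<close>: the same overlap length
  appears on both sides, with \<open>max 0\<close> covering the empty intersection.\<close>

lemma integral_interval_overlap:
  assumes "0 \<le> a" "b \<le> t" "0 \<le> a'" "b' \<le> t"
  shows "has_bochner_integral (time_measure t)
    (\<lambda>s. indicator {a<..b} s * indicator {a'<..b'} s :: real) (max 0 (min b b' - max a a'))"
proof -
  have *: "indicator {0..t} s *\<^sub>R (indicator {a<..b} s * indicator {a'<..b'} s :: real)
    = indicator {max a a'<..min b b'} s" for s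
    using assms by (auto simp: indicator_def)
  have "has_bochner_integral lborel (indicator {m<..n} :: real \<Rightarrow> real) (max 0 (n - m))" for m n :: real
  proof (cases "m \<le> n")
    case True
    then show ?thesis
      using has_bochner_integral_real_indicator[of "{m<..n}" lborel] by simp
  next
    case False
    then show ?thesis
      using has_bochner_integral_real_indicator[of "{}" lborel] by simp
  qed
  from this[of "max a a'" "min b b'"] show ?thesis
    unfolding has_bochner_integral_iff
    by (subst integrable_restrict_space, simp, subst integral_restrict_space, simp) (simp only: *)
qed

section \<open>Isometry, tilting and stopping for simple integrands\<close>

section \<open>Ito integrals of simple processes\<close>

lemma simple_val_Nil [simp]: "simple_val [] s \<omega> = 0"
  and simple_val_Cons: "simple_val ((a, c, \<xi>) # \<phi>) s \<omega> = \<xi> \<omega> * indicator {a<..c} s + simple_val \<phi> s \<omega>"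
  by (simp_all add: simple_val_def)

lemma simple_ito_Nil [simp]: "simple_ito W [] = (\<lambda>\<omega>. 0)"
  and simple_ito_Cons: "simple_ito W ((a, c, \<xi>) # \<phi>) \<omega> = \<xi> \<omega> * (W c \<omega> - W a \<omega>) + simple_ito W \<phi> \<omega>"
  by (simp_all add: simple_ito_def fun_eq_iff)

lemma simple_process_Nil [simp]: "simple_process M F t []"
  and simple_process_Cons: "simple_process M F t ((a, c, \<xi>) # \<phi>) \<longleftrightarrow>
    0 \<le> a \<and> a \<le> c \<and> c \<le> t \<and> \<xi> \<in> borel_measurable (F a) \<and> integrable M (\<lambda>\<omega>. (\<xi> \<omega>)\<^sup>2) \<and>
    simple_process M F t \<phi>"
  by (simp_all add: simple_process_def)

text \<open>The restriction of a simple process to times up to \<open>s\<close>. An entry that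
  starts after \<open>s\<close> degenerates to the empty interval \<open>(s, s]\<close>; its
  coefficient is replaced by 0 because it is known only at \<open>a\<close>, whereas the new entry
  must be known at \<open>s\<close>.\<close>

definition stop_simple :: "real \<Rightarrow> 'a simple_proc \<Rightarrow> 'a simple_proc" where
  "stop_simple s \<phi> = map (\<lambda>(a, c, \<xi>). (min a s, min c s, \<lambda>\<omega>. if a \<le> s then \<xi> \<omega> else 0)) \<phi>"

lemma stop_simple_Nil [simp]: "stop_simple s [] = []"
  and stop_simple_Cons: "stop_simple s ((a, c, \<xi>) # \<phi>)
    = (min a s, min c s, \<lambda>\<omega>. if a \<le> s then \<xi> \<omega> else 0) # stop_simple s \<phi>"
  by (simp_all add: stop_simple_def)

lemma simple_val_stop: "u \<le> s \<Longrightarrow> simple_val (stop_simple s \<phi>) u \<omega> = simple_val \<phi> u \<omega>"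
  by (induction \<phi>) (auto simp: stop_simple_Cons simple_val_Cons indicator_def min_def)

lemma simple_process_stop:
  "simple_process M F t \<phi> \<Longrightarrow> 0 \<le> s \<Longrightarrow> simple_process M F s (stop_simple s \<phi>)"
  by (induction \<phi>) (auto simp: stop_simple_Cons simple_process_Cons min_def)

context brownian_motion
begin

lemma pair_sigma_finite_time: "pair_sigma_finite (time_measure t) M"
proof -
  interpret finite_measure "time_measure t" by (rule finite_time_measure)
  show ?thesis ..
qed

lemma square_integrable_entry:
  assumes "0 \<le> a" "a \<le> c" "c \<le> t" and \<xi>: "\<xi> \<in> borel_measurable (F a)" "integrable M (\<lambda>\<omega>. (\<xi> \<omega>)\<^sup>2)"
  shows "square_integrable (time_measure t \<Otimes>\<^sub>M M) (\<lambda>z. \<xi> (snd z) * indicator {a<..c} (fst z))"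
proof -
  interpret pair_sigma_finite "time_measure t" M by (rule pair_sigma_finite_time)
  have [measurable]: "\<xi> \<in> borel_measurable M" by (rule F_measurable_M[OF \<xi>(1)])
  have m: "(\<lambda>s. indicator {a<..c} s :: real) \<in> borel_measurable (time_measure t)"
    by (intro measurable_restrict_space1) simp
  have "integrable (time_measure t \<Otimes>\<^sub>M M) (\<lambda>z. indicator {a<..c} (fst z) * (\<xi> (snd z))\<^sup>2)"
    using has_bochner_integral_pair_times[of "indicator {a<..c}" "\<lambda>\<omega>. (\<xi> \<omega>)\<^sup>2"]
      integral_interval_overlap[of a c t a c] assms
    by (simp add: has_bochner_integral_iff flip: indicator_inter_arith)
  moreover have "(\<lambda>z. \<xi> (snd z) * indicator {a<..c} (fst z)) \<in> borel_measurable (time_measure t \<Otimes>\<^sub>M M)"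
    using measurable_compose[OF measurable_fst m] measurable_compose[OF measurable_snd, of \<xi> M borel]
    by (intro borel_measurable_times) auto
  moreover have "(\<lambda>z. indicator {a<..c} (fst z) * (\<xi> (snd z))\<^sup>2) = (\<lambda>z. (\<xi> (snd z) * indicator {a<..c} (fst z))\<^sup>2)"
    by (auto simp: indicator_def)
  ultimately show ?thesis by (simp add: square_integrable_def)
qed

lemma square_integrable_simple_val:
  "simple_process M F t \<phi> \<Longrightarrow> square_integrable (time_measure t \<Otimes>\<^sub>M M) (\<lambda>z. simple_val \<phi> (fst z) (snd z))"
proof (induction \<phi>)
  case (Cons e \<phi>)
  obtain a c \<xi> where e: "e = (a, c, \<xi>)" by (cases e)
  show ?case
    using Cons unfolding e simple_val_Cons
    by (intro square_integrable_add square_integrable_entry) (auto simp: simple_process_Cons)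
qed simp

lemma square_integrable_F:
  "\<xi> \<in> borel_measurable (F a) \<Longrightarrow> integrable M (\<lambda>\<omega>. (\<xi> \<omega>)\<^sup>2) \<Longrightarrow> square_integrable M \<xi>"
  by (simp add: square_integrable_def F_measurable_M)

lemma square_integrable_simple_ito:
  "simple_process M F t \<phi> \<Longrightarrow> t \<le> T \<Longrightarrow> square_integrable M (simple_ito b \<phi>)"
proof (induction \<phi>)
  case (Cons e \<phi>)
  obtain a c \<xi> where e: "e = (a, c, \<xi>)" by (cases e)
  have "square_integrable M (\<lambda>\<omega>. \<xi> \<omega> * (b c \<omega> - b a \<omega>) + simple_ito b \<phi> \<omega>)"
    using Cons unfolding e
    by (intro square_integrable_add square_integrable_increment)
       (auto simp: simple_process_Cons intro: square_integrable_F)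
  then show ?case by (simp add: e simple_ito_Cons[abs_def])
qed simp

text \<open>Both sides are the expectation of \<open>\<xi> \<xi>'\<close> times the length of the
  overlap of \<open>(a, c]\<close> and \<open>(a', c']\<close>.\<close>

lemma entry_isometry:
  assumes "simple_process M F t [(a, c, \<xi>)]" "simple_process M F t [(a', c', \<xi>')]" "t \<le> T"
  shows "(\<integral>\<omega>. (\<xi> \<omega> * (b c \<omega> - b a \<omega>)) * (\<xi>' \<omega> * (b c' \<omega> - b a' \<omega>)) \<partial>M)
    = (\<integral>z. (\<xi> (snd z) * indicator {a<..c} (fst z)) * (\<xi>' (snd z) * indicator {a'<..c'} (fst z))
        \<partial>(time_measure t \<Otimes>\<^sub>M M))"
proof -
  interpret pair_sigma_finite "time_measure t" M by (rule pair_sigma_finite_time)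
  have e: "0 \<le> a" "a \<le> c" "c \<le> t" "0 \<le> a'" "a' \<le> c'" "c' \<le> t"
    "\<xi> \<in> borel_measurable (F a)" "square_integrable M \<xi>"
    "\<xi>' \<in> borel_measurable (F a')" "square_integrable M \<xi>'"
    using assms(1,2) square_integrable_F[of \<xi> a] square_integrable_F[of \<xi>' a'] by (auto simp: simple_process_Cons)
  have "(\<integral>z. (indicator {a<..c} (fst z) * indicator {a'<..c'} (fst z)) * (\<xi> (snd z) * \<xi>' (snd z))
        \<partial>(time_measure t \<Otimes>\<^sub>M M)) = max 0 (min c c' - max a a') * (\<integral>\<omega>. \<xi> \<omega> * \<xi>' \<omega> \<partial>M)"
    using has_bochner_integral_pair_times[of "\<lambda>s. indicator {a<..c} s * indicator {a'<..c'} s" "\<lambda>\<omega>. \<xi> \<omega> * \<xi>' \<omega>"]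
      integral_interval_overlap[of a c t a' c'] square_integrable_mult[of M \<xi> \<xi>'] e
    by (simp add: has_bochner_integral_iff)
  then show ?thesis
    using increment_covariance[of a c a' c' \<xi> \<xi>'] e assms(3) by (simp add: ac_simps)
qed

lemma entry_list_isometry:
  assumes "simple_process M F t [(a, c, \<xi>)]" "simple_process M F t \<psi>" "t \<le> T"
  shows "(\<integral>\<omega>. (\<xi> \<omega> * (b c \<omega> - b a \<omega>)) * simple_ito b \<psi> \<omega> \<partial>M)
    = (\<integral>z. (\<xi> (snd z) * indicator {a<..c} (fst z)) * simple_val \<psi> (fst z) (snd z) \<partial>(time_measure t \<Otimes>\<^sub>M M))"
  using assms(2)
proof (induction \<psi>)
  case (Cons e \<psi>)
  obtain a' c' \<xi>' where e: "e = (a', c', \<xi>')" by (cases e)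
  have s: "simple_process M F t [(a', c', \<xi>')]" "simple_process M F t \<psi>"
    using Cons.prems by (auto simp: e simple_process_Cons)
  have i: "square_integrable M (\<lambda>\<omega>. \<xi> \<omega> * (b c \<omega> - b a \<omega>))" "square_integrable M (\<lambda>\<omega>. \<xi>' \<omega> * (b c' \<omega> - b a' \<omega>))"
     "square_integrable M (simple_ito b \<psi>)"
    using square_integrable_simple_ito[OF assms(1,3)] square_integrable_simple_ito[OF s(1) assms(3)]
      square_integrable_simple_ito[OF s(2) assms(3)]
    by (simp_all add: simple_ito_Cons[abs_def])
  have j: "square_integrable (time_measure t \<Otimes>\<^sub>M M) (\<lambda>z. \<xi> (snd z) * indicator {a<..c} (fst z))"
    "square_integrable (time_measure t \<Otimes>\<^sub>M M) (\<lambda>z. \<xi>' (snd z) * indicator {a'<..c'} (fst z))"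
    "square_integrable (time_measure t \<Otimes>\<^sub>M M) (\<lambda>z. simple_val \<psi> (fst z) (snd z))"
    using square_integrable_simple_val[OF assms(1)] square_integrable_simple_val[OF s(1)]
      square_integrable_simple_val[OF s(2)]
    by (simp_all add: simple_val_Cons)
  show ?case
    unfolding e simple_val_Cons simple_ito_Cons distrib_left
    using square_integrable_mult[OF i(1,2)] square_integrable_mult[OF i(1,3)]
      square_integrable_mult[OF j(1,2)] square_integrable_mult[OF j(1,3)]
      entry_isometry[OF assms(1) s(1) assms(3)] Cons.IH[OF s(2)]
    by (subst (1 2) Bochner_Integration.integral_add) (simp_all add: mult.assoc)
qed simp

lemma simple_isometry:
  assumes "simple_process M F t \<phi>" "simple_process M F t \<psi>" "t \<le> T"
  shows "(\<integral>\<omega>. simple_ito b \<phi> \<omega> * simple_ito b \<psi> \<omega> \<partial>M)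
    = (\<integral>z. simple_val \<phi> (fst z) (snd z) * simple_val \<psi> (fst z) (snd z) \<partial>(time_measure t \<Otimes>\<^sub>M M))"
  using assms(1)
proof (induction \<phi>)
  case (Cons e \<phi>)
  obtain a c \<xi> where e: "e = (a, c, \<xi>)" by (cases e)
  have s: "simple_process M F t [(a, c, \<xi>)]" "simple_process M F t \<phi>"
    using Cons.prems by (auto simp: e simple_process_Cons)
  have i: "square_integrable M (\<lambda>\<omega>. \<xi> \<omega> * (b c \<omega> - b a \<omega>))" "square_integrable M (simple_ito b \<phi>)"
     "square_integrable M (simple_ito b \<psi>)"
    using square_integrable_simple_ito[OF s(1) assms(3)] square_integrable_simple_ito[OF s(2) assms(3)]
      square_integrable_simple_ito[OF assms(2,3)]
    by (simp_all add: simple_ito_Cons[abs_def])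
  have j: "square_integrable (time_measure t \<Otimes>\<^sub>M M) (\<lambda>z. \<xi> (snd z) * indicator {a<..c} (fst z))"
    "square_integrable (time_measure t \<Otimes>\<^sub>M M) (\<lambda>z. simple_val \<phi> (fst z) (snd z))"
    "square_integrable (time_measure t \<Otimes>\<^sub>M M) (\<lambda>z. simple_val \<psi> (fst z) (snd z))"
    using square_integrable_simple_val[OF s(1)] square_integrable_simple_val[OF s(2)]
      square_integrable_simple_val[OF assms(2)]
    by (simp_all add: simple_val_Cons)
  show ?case
    unfolding e simple_val_Cons simple_ito_Cons distrib_right
    using square_integrable_mult[OF i(1,3)] square_integrable_mult[OF i(2,3)]
      square_integrable_mult[OF j(1,3)] square_integrable_mult[OF j(2,3)]
      entry_list_isometry[OF s(1) assms(2,3)] Cons.IH[OF s(2)]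
    by (subst (1 2) Bochner_Integration.integral_add) (simp_all add: mult.assoc)
qed simp

lemma square_integrable_time_const:
  assumes G: "square_integrable M g"
  shows "square_integrable (time_measure t \<Otimes>\<^sub>M M) (\<lambda>z. g (snd z))"
proof -
  interpret pair_sigma_finite "time_measure t" M by (rule pair_sigma_finite_time)
  show ?thesis
    using has_bochner_integral_pair_times[of "\<lambda>_. 1" "\<lambda>\<omega>. (g \<omega>)\<^sup>2"] G finite_time_measure[of t]
      measurable_compose[OF measurable_snd square_integrable_measurable[OF G], of "time_measure t"]
    by (auto simp: square_integrable_def has_bochner_integral_iff finite_measure.integrable_const)
qed

text \<open>Girsanov's theorem at the level of expectations: under the weight
  \<open>exp (l * b t)\<close> the Brownian motion has drift \<open>l\<close>, so the integral of
  \<open>\<phi>\<close> acquires \<open>l\<close> times the time integral of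
  \<open>\<phi>\<close>.\<close>

lemma simple_ito_tilted:
  assumes "simple_process M F t \<phi>" "t \<le> T" "0 \<le> t"
  shows "(\<integral>\<omega>. simple_ito b \<phi> \<omega> * exp (l * b t \<omega>) \<partial>M)
    = l * (\<integral>z. simple_val \<phi> (fst z) (snd z) * exp (l * b t (snd z)) \<partial>(time_measure t \<Otimes>\<^sub>M M))"
  using assms(1)
proof (induction \<phi>)
  case (Cons e \<phi>)
  interpret pair_sigma_finite "time_measure t" M by (rule pair_sigma_finite_time)
  obtain a c \<xi> where e: "e = (a, c, \<xi>)" by (cases e)
  have s: "simple_process M F t [(a, c, \<xi>)]" "simple_process M F t \<phi>"
    using Cons.prems by (auto simp: e simple_process_Cons)
  have p: "0 \<le> a" "a \<le> c" "c \<le> t" "\<xi> \<in> borel_measurable (F a)" "square_integrable M \<xi>"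
    using s(1) square_integrable_F[of \<xi> a] by (auto simp: simple_process_Cons)
  have G: "square_integrable M (\<lambda>\<omega>. exp (l * b t \<omega>))"
    using assms by (intro square_integrable_exp) auto
  have i: "square_integrable M (\<lambda>\<omega>. \<xi> \<omega> * (b c \<omega> - b a \<omega>))" "square_integrable M (simple_ito b \<phi>)"
    using square_integrable_simple_ito[OF s(1) assms(2)] square_integrable_simple_ito[OF s(2) assms(2)]
    by (simp_all add: simple_ito_Cons[abs_def])
  have GP: "square_integrable (time_measure t \<Otimes>\<^sub>M M) (\<lambda>z. exp (l * b t (snd z)))"
    by (rule square_integrable_time_const[OF G])
  have j: "square_integrable (time_measure t \<Otimes>\<^sub>M M) (\<lambda>z. \<xi> (snd z) * indicator {a<..c} (fst z))"
    "square_integrable (time_measure t \<Otimes>\<^sub>M M) (\<lambda>z. simple_val \<phi> (fst z) (snd z))"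
    using square_integrable_simple_val[OF s(1)] square_integrable_simple_val[OF s(2)]
    by (simp_all add: simple_val_Cons)
  have ind: "has_bochner_integral (time_measure t) (indicator {a<..c}) (c - a)"
    using integral_interval_overlap[of a c t a c] p by (simp flip: indicator_inter_arith)
  have "(\<integral>z. indicator {a<..c} (fst z) * (\<xi> (snd z) * exp (l * b t (snd z))) \<partial>(time_measure t \<Otimes>\<^sub>M M))
    = (c - a) * (\<integral>\<omega>. \<xi> \<omega> * exp (l * b t \<omega>) \<partial>M)"
    using has_bochner_integral_pair_times[of "indicator {a<..c}" "\<lambda>\<omega>. \<xi> \<omega> * exp (l * b t \<omega>)"]
      ind square_integrable_mult[OF p(5) G]
    by (simp add: has_bochner_integral_iff)
  then have "(\<integral>\<omega>. \<xi> \<omega> * (b c \<omega> - b a \<omega>) * exp (l * b t \<omega>) \<partial>M)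
    = l * (\<integral>z. \<xi> (snd z) * indicator {a<..c} (fst z) * exp (l * b t (snd z)) \<partial>(time_measure t \<Otimes>\<^sub>M M))"
    using increment_tilted[of a c t \<xi> l] p assms(2) by (simp add: ac_simps)
  then show ?case
    unfolding e simple_val_Cons simple_ito_Cons distrib_right
    using square_integrable_mult[OF i(1) G] square_integrable_mult[OF i(2) G]
      square_integrable_mult[OF j(1) GP] square_integrable_mult[OF j(2) GP] Cons.IH[OF s(2)]
    by (subst (1 2) Bochner_Integration.integral_add) (simp_all add: distrib_left)
qed simp

text \<open>Martingale property of simple integrals, tested against \<open>\<eta>\<close> known at
  \<open>s\<close>: whatever an entry earns after \<open>s\<close> is a centred increment times a
  factor from its past.\<close>

lemma simple_ito_stop:
  assumes "simple_process M F t \<phi>" "0 \<le> s" "s \<le> t" "t \<le> T"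
    and \<eta>: "\<eta> \<in> borel_measurable (F s)" "square_integrable M \<eta>"
  shows "(\<integral>\<omega>. \<eta> \<omega> * simple_ito b \<phi> \<omega> \<partial>M) = (\<integral>\<omega>. \<eta> \<omega> * simple_ito b (stop_simple s \<phi>) \<omega> \<partial>M)"
  using assms(1)
proof (induction \<phi>)
  case (Cons e \<phi>)
  obtain a c \<xi> where e: "e = (a, c, \<xi>)" by (cases e)
  define \<xi>' where "\<xi>' \<omega> = (if a \<le> s then \<xi> \<omega> else 0)" for \<omega>
  have p: "simple_process M F t [(a, c, \<xi>)]" "simple_process M F t \<phi>"
    using Cons.prems by (auto simp: e simple_process_Cons)
  have q: "0 \<le> a" "a \<le> c" "c \<le> t" "\<xi> \<in> borel_measurable (F a)" "square_integrable M \<xi>"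
    using p(1) square_integrable_F[of \<xi> a] by (auto simp: simple_process_Cons)
  have p': "simple_process M F s [(min a s, min c s, \<xi>')]" "simple_process M F s (stop_simple s \<phi>)"
    using simple_process_stop[OF p(1) assms(2)] simple_process_stop[OF p(2) assms(2)]
    by (simp_all add: stop_simple_Cons \<xi>'_def[abs_def])
  have sT: "s \<le> T" using assms by simp
  have i: "square_integrable M (\<lambda>\<omega>. \<xi> \<omega> * (b c \<omega> - b a \<omega>))" "square_integrable M (simple_ito b \<phi>)"
    "square_integrable M (\<lambda>\<omega>. \<xi>' \<omega> * (b (min c s) \<omega> - b (min a s) \<omega>))" "square_integrable M (simple_ito b (stop_simple s \<phi>))"
    using square_integrable_simple_ito[OF p(1) assms(4)] square_integrable_simple_ito[OF p(2) assms(4)]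
     square_integrable_simple_ito[OF p'(1) sT] square_integrable_simple_ito[OF p'(2) sT]
    by (simp_all add: simple_ito_Cons[abs_def])
  \<comment> \<open>Since \<open>u \<le> c\<close>, the time \<open>max c u\<close> is just
    \<open>c\<close>, so the increment considered next is the part of the entry after time
    \<open>s\<close>.\<close>
  define u where "u = max a (min c s)"
  have "has_bochner_integral M (\<lambda>\<omega>. \<eta> \<omega> * \<xi> \<omega> * (b (max c u) \<omega> - b (max a s) \<omega>)) 0"
    if "s < c"
  proof (rule increment_mean)
    have "\<eta> \<in> borel_measurable (F (max a s))" "\<xi> \<in> borel_measurable (F (max a s))"
      using \<eta> q by (auto intro: F_measurable_mono)
    then show "(\<lambda>\<omega>. \<eta> \<omega> * \<xi> \<omega>) \<in> borel_measurable (F (max a s))" by measurable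
  qed (use that assms q \<eta> in \<open>auto simp: u_def intro: square_integrable_mult\<close>)
  then have key0: "has_bochner_integral M (\<lambda>\<omega>. \<eta> \<omega> * \<xi> \<omega> * (b c \<omega> - b (max a s) \<omega>)) 0" if "s < c"
    using that q by (auto simp: u_def max_def split: if_splits)
  have key: "(\<integral>\<omega>. \<eta> \<omega> * (\<xi> \<omega> * (b c \<omega> - b a \<omega>)) \<partial>M) = (\<integral>\<omega>. \<eta> \<omega> * (\<xi>' \<omega> * (b (min c s) \<omega> - b (min a s) \<omega>)) \<partial>M)"
  proof (cases "s < c")
    case False
    then show ?thesis using q by (simp add: \<xi>'_def min_def)
  next
    case True
    have "(\<lambda>\<omega>. \<eta> \<omega> * (\<xi> \<omega> * (b c \<omega> - b a \<omega>)) - \<eta> \<omega> * (\<xi>' \<omega> * (b (min c s) \<omega> - b (min a s) \<omega>)))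
      = (\<lambda>\<omega>. \<eta> \<omega> * \<xi> \<omega> * (b c \<omega> - b (max a s) \<omega>))"
      using True by (auto simp: \<xi>'_def min_def max_def algebra_simps)
    then show ?thesis
      using key0[OF True] Bochner_Integration.integral_diff[OF square_integrable_mult[OF \<eta>(2) i(1)]
          square_integrable_mult[OF \<eta>(2) i(3)]]
      by (simp add: has_bochner_integral_iff)
  qed
  show ?case
    unfolding e simple_ito_Cons stop_simple_Cons \<xi>'_def[symmetric] distrib_left
    using square_integrable_mult[OF \<eta>(2) i(1)] square_integrable_mult[OF \<eta>(2) i(2)]
      square_integrable_mult[OF \<eta>(2) i(3)] square_integrable_mult[OF \<eta>(2) i(4)] Cons.IH[OF p(2)] key
    by (subst (1 2) Bochner_Integration.integral_add) simp_all
qed simp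

section \<open>Passage from simple integrands to mean-square limits\<close>

section \<open>Ito integrals\<close>

text \<open>Tonelli turns the nested integrals of \<open>has_ito_integral\<close> into one norm;
  this is where joint measurability of the integrand in time and chance enters.\<close>

lemma has_ito_integral_L2:
  assumes I: "has_ito_integral M F b H t I" and "t \<le> T"
    and H: "(\<lambda>z. H (fst z) (snd z)) \<in> borel_measurable (time_measure t \<Otimes>\<^sub>M M)"
  obtains \<phi> where "\<And>n. simple_process M F t (\<phi> n)"
    "L2_tendsto (time_measure t \<Otimes>\<^sub>M M) (\<lambda>n z. simple_val (\<phi> n) (fst z) (snd z)) (\<lambda>z. H (fst z) (snd z))"
    "L2_tendsto M (\<lambda>n. simple_ito b (\<phi> n)) I"
proof -
  obtain \<phi> where \<phi>: "\<And>n. simple_process M F t (\<phi> n)"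
    and H_lim: "(\<lambda>n. \<integral>\<^sup>+ s \<in> {0..t}. (\<integral>\<^sup>+ \<omega>. ennreal ((H s \<omega> - simple_val (\<phi> n) s \<omega>)\<^sup>2) \<partial>M) \<partial>lborel) \<longlonglongrightarrow> 0"
    and I_lim: "(\<lambda>n. \<integral>\<^sup>+ \<omega>. ennreal ((I \<omega> - simple_ito b (\<phi> n) \<omega>)\<^sup>2) \<partial>M) \<longlonglongrightarrow> 0"
    using I unfolding has_ito_integral_def by blast
  interpret pair_sigma_finite "time_measure t" M by (rule pair_sigma_finite_time)
  have "(\<integral>\<^sup>+ z. ennreal ((H (fst z) (snd z) - simple_val (\<phi> n) (fst z) (snd z))\<^sup>2) \<partial>(time_measure t \<Otimes>\<^sub>M M))
    = (\<integral>\<^sup>+ s \<in> {0..t}. (\<integral>\<^sup>+ \<omega>. ennreal ((H s \<omega> - simple_val (\<phi> n) s \<omega>)\<^sup>2) \<partial>M) \<partial>lborel)" for n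
  proof -
    have [measurable]: "(\<lambda>z. simple_val (\<phi> n) (fst z) (snd z)) \<in> borel_measurable (time_measure t \<Otimes>\<^sub>M M)"
      using square_integrable_simple_val[OF \<phi>] by (rule square_integrable_measurable)
    have sf: "sigma_finite_measure M" ..
    show ?thesis
      using H sigma_finite_measure.nn_integral_fst[OF sf, of "\<lambda>z. ennreal ((H (fst z) (snd z) - simple_val (\<phi> n) (fst z) (snd z))\<^sup>2)" "time_measure t"]
      by (simp add: nn_integral_restrict_space)
  qed
  then have "L2_tendsto (time_measure t \<Otimes>\<^sub>M M) (\<lambda>n z. simple_val (\<phi> n) (fst z) (snd z)) (\<lambda>z. H (fst z) (snd z))"
    using H_lim by (intro L2_tendsto_nn square_integrable_simple_val \<phi> H) simp
  moreover have "L2_tendsto M (\<lambda>n. simple_ito b (\<phi> n)) I"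
    using I I_lim \<phi> assms(2) by (intro L2_tendsto_nn square_integrable_simple_ito) (auto simp: has_ito_integral_def)
  ultimately show ?thesis using \<phi> that by blast
qed

lemma ito_isometry:
  assumes I: "has_ito_integral M F b H t I" and t: "t \<le> T"
    and H: "(\<lambda>z. H (fst z) (snd z)) \<in> borel_measurable (time_measure t \<Otimes>\<^sub>M M)"
  shows "(\<integral>\<omega>. (I \<omega>)\<^sup>2 \<partial>M) = (\<integral>z. (H (fst z) (snd z))\<^sup>2 \<partial>(time_measure t \<Otimes>\<^sub>M M))"
    and "square_integrable M I"
proof -
  obtain \<phi> where \<phi>: "\<And>n. simple_process M F t (\<phi> n)"
    "L2_tendsto (time_measure t \<Otimes>\<^sub>M M) (\<lambda>n z. simple_val (\<phi> n) (fst z) (snd z)) (\<lambda>z. H (fst z) (snd z))"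
    "L2_tendsto M (\<lambda>n. simple_ito b (\<phi> n)) I"
    using has_ito_integral_L2[OF I t H] by blast
  show "square_integrable M I" using \<phi>(3) by (simp add: L2_tendsto_def)
  show "(\<integral>\<omega>. (I \<omega>)\<^sup>2 \<partial>M) = (\<integral>z. (H (fst z) (snd z))\<^sup>2 \<partial>(time_measure t \<Otimes>\<^sub>M M))"
    using LIMSEQ_unique[OF L2_tendsto_mult[OF \<phi>(3,3)]] L2_tendsto_mult[OF \<phi>(2,2)]
    by (simp add: simple_isometry[OF \<phi>(1) \<phi>(1) t] power2_eq_square)
qed

text \<open>Both sides are inner products with the fixed function \<open>exp (l * b t)\<close>,
  hence limits of the simple case. For \<open>l = 0\<close> it says that Ito integrals have mean
  0.\<close>

lemma ito_tilted:
  assumes I: "has_ito_integral M F b H t I" and t: "t \<in> {0..T}"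
    and H: "(\<lambda>z. H (fst z) (snd z)) \<in> borel_measurable (time_measure t \<Otimes>\<^sub>M M)"
  shows "(\<integral>\<omega>. I \<omega> * exp (l * b t \<omega>) \<partial>M)
    = l * (\<integral>z. H (fst z) (snd z) * exp (l * b t (snd z)) \<partial>(time_measure t \<Otimes>\<^sub>M M))"
proof -
  have t': "t \<le> T" "0 \<le> t" using t by auto
  obtain \<phi> where \<phi>: "\<And>n. simple_process M F t (\<phi> n)"
    "L2_tendsto (time_measure t \<Otimes>\<^sub>M M) (\<lambda>n z. simple_val (\<phi> n) (fst z) (snd z)) (\<lambda>z. H (fst z) (snd z))"
    "L2_tendsto M (\<lambda>n. simple_ito b (\<phi> n)) I"
    using has_ito_integral_L2[OF I t'(1) H] by blast
  note G = square_integrable_exp[OF t, of l]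
  have "(\<lambda>n. \<integral>\<omega>. simple_ito b (\<phi> n) \<omega> * exp (l * b t \<omega>) \<partial>M) \<longlonglongrightarrow> (\<integral>\<omega>. I \<omega> * exp (l * b t \<omega>) \<partial>M)"
    by (rule L2_tendsto_mult[OF \<phi>(3) L2_tendsto_const[OF G]])
  moreover have "(\<lambda>n. l * (\<integral>z. simple_val (\<phi> n) (fst z) (snd z) * exp (l * b t (snd z)) \<partial>(time_measure t \<Otimes>\<^sub>M M)))
    \<longlonglongrightarrow> l * (\<integral>z. H (fst z) (snd z) * exp (l * b t (snd z)) \<partial>(time_measure t \<Otimes>\<^sub>M M))"
    by (intro tendsto_mult_left L2_tendsto_mult[OF \<phi>(2) L2_tendsto_const] square_integrable_time_const G)
  ultimately show ?thesis
    unfolding simple_ito_tilted[OF \<phi>(1) t'] by (rule LIMSEQ_unique)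
qed

text \<open>Written as iterated integrals over \<open>lborel\<close>, the two norms differ only in
  the indicator of the time interval.\<close>

lemma square_integrable_time_mono:
  assumes f: "square_integrable (time_measure t \<Otimes>\<^sub>M M) f" and st: "s \<le> t"
  shows "square_integrable (time_measure s \<Otimes>\<^sub>M M) f"
    and "(\<integral>z. (f z)\<^sup>2 \<partial>(time_measure s \<Otimes>\<^sub>M M)) \<le> (\<integral>z. (f z)\<^sup>2 \<partial>(time_measure t \<Otimes>\<^sub>M M))"
proof -
  have sf: "sigma_finite_measure M" ..
  have "(\<lambda>x. x) \<in> time_measure s \<rightarrow>\<^sub>M time_measure t"
    using st by (intro measurable_restrict_space3) auto
  then have "(\<lambda>z. (fst z, snd z)) \<in> time_measure s \<Otimes>\<^sub>M M \<rightarrow>\<^sub>M time_measure t \<Otimes>\<^sub>M M"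
    by (intro measurable_Pair measurable_compose[OF measurable_fst]) auto
  from measurable_compose[OF this square_integrable_measurable[OF f]]
  have fs: "f \<in> borel_measurable (time_measure s \<Otimes>\<^sub>M M)" by simp
  have nn: "(\<integral>\<^sup>+z. ennreal ((f z)\<^sup>2) \<partial>(time_measure u \<Otimes>\<^sub>M M))
      = (\<integral>\<^sup>+x\<in>{0..u}. (\<integral>\<^sup>+y. ennreal ((f (x, y))\<^sup>2) \<partial>M) \<partial>lborel)"
    if "f \<in> borel_measurable (time_measure u \<Otimes>\<^sub>M M)" for u
    using that sigma_finite_measure.nn_integral_fst[OF sf, of "\<lambda>z. ennreal ((f z)\<^sup>2)" "time_measure u"]
    by (simp add: nn_integral_restrict_space)
  have le: "(\<integral>\<^sup>+z. ennreal ((f z)\<^sup>2) \<partial>(time_measure s \<Otimes>\<^sub>M M)) \<le> (\<integral>\<^sup>+z. ennreal ((f z)\<^sup>2) \<partial>(time_measure t \<Otimes>\<^sub>M M))"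
    unfolding nn[OF fs] nn[OF square_integrable_measurable[OF f]] using st
    by (intro nn_integral_mono) (auto simp: indicator_def)
  also have fin: "(\<integral>\<^sup>+z. ennreal ((f z)\<^sup>2) \<partial>(time_measure t \<Otimes>\<^sub>M M)) < \<infinity>"
    using f square_integrable_nn_integral[OF square_integrable_measurable[OF f]] by simp
  finally show "square_integrable (time_measure s \<Otimes>\<^sub>M M) f"
    using square_integrable_nn_integral[OF fs] by simp
  show "(\<integral>z. (f z)\<^sup>2 \<partial>(time_measure s \<Otimes>\<^sub>M M)) \<le> (\<integral>z. (f z)\<^sup>2 \<partial>(time_measure t \<Otimes>\<^sub>M M))"
    using f fs fin le
    by (subst (1 2) integral_eq_nn_integral) (auto simp: square_integrable_def intro!: enn2real_mono)
qed

text \<open>\<open>I\<close> and \<open>I'\<close> come with unrelated approximating sequences, on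
  \<open>[0, t]\<close> and on \<open>[0, s]\<close>. Stopping the first sequence at
  \<open>s\<close> yields a second approximation of \<open>H\<close> on \<open>[0, s]\<close>; the
  isometry makes the two simple integrals asymptotically equal, and stopping does not change inner
  products with \<open>\<eta>\<close>.\<close>

lemma ito_martingale:
  assumes I: "has_ito_integral M F b H t I" and I': "has_ito_integral M F b H s I'"
    and st: "0 \<le> s" "s \<le> t" "t \<le> T"
    and H: "(\<lambda>z. H (fst z) (snd z)) \<in> borel_measurable (time_measure t \<Otimes>\<^sub>M M)"
    and \<eta>: "\<eta> \<in> borel_measurable (F s)" "square_integrable M \<eta>"
  shows "(\<integral>\<omega>. \<eta> \<omega> * I \<omega> \<partial>M) = (\<integral>\<omega>. \<eta> \<omega> * I' \<omega> \<partial>M)"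
proof -
  let ?P = "time_measure s \<Otimes>\<^sub>M M" and ?H = "\<lambda>z. H (fst z) (snd z)"
  let ?v = "\<lambda>\<phi> z. simple_val \<phi> (fst z) (snd z)"
  obtain \<phi> where \<phi>: "\<And>n. simple_process M F t (\<phi> n)"
    "L2_tendsto (time_measure t \<Otimes>\<^sub>M M) (\<lambda>n. ?v (\<phi> n)) ?H"
    "L2_tendsto M (\<lambda>n. simple_ito b (\<phi> n)) I"
    using has_ito_integral_L2[OF I st(3) H] by blast
  have H2: "square_integrable (time_measure t \<Otimes>\<^sub>M M) ?H" using \<phi>(2) by (simp add: L2_tendsto_def)
  have sT: "s \<le> T" using st by simp
  note Hs = square_integrable_time_mono[OF H2 st(2)]
  obtain \<psi> where \<psi>: "\<And>n. simple_process M F s (\<psi> n)" "L2_tendsto ?P (\<lambda>n. ?v (\<psi> n)) ?H"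
    "L2_tendsto M (\<lambda>n. simple_ito b (\<psi> n)) I'"
    using has_ito_integral_L2[OF I' sT square_integrable_measurable[OF Hs(1)]] by blast
  \<comment> \<open>Stopping leaves the values up to time \<open>s\<close> unchanged, so the error
    of \<open>\<tau> n\<close> on \<open>[0, s]\<close> is at most that of \<open>\<phi> n\<close>
    on \<open>[0, t]\<close>.\<close>
  define \<tau> where "\<tau> n = stop_simple s (\<phi> n)" for n
  have \<tau>: "simple_process M F s (\<tau> n)" for n
    unfolding \<tau>_def by (rule simple_process_stop[OF \<phi>(1) st(1)])
  have "(\<lambda>n. \<integral>z. (?v (\<tau> n) z - ?H z)\<^sup>2 \<partial>?P) \<longlonglongrightarrow> 0"
  proof (rule tendsto_sandwich[OF _ _ tendsto_const])
    show "(\<lambda>n. \<integral>z. (?v (\<phi> n) z - ?H z)\<^sup>2 \<partial>(time_measure t \<Otimes>\<^sub>M M)) \<longlonglongrightarrow> 0"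
      using \<phi>(2) by (simp add: L2_tendsto_def)
    have "(\<integral>z. (?v (\<tau> n) z - ?H z)\<^sup>2 \<partial>?P) = (\<integral>z. (?v (\<phi> n) z - ?H z)\<^sup>2 \<partial>?P)" for n
      by (rule Bochner_Integration.integral_cong)
         (auto simp: \<tau>_def simple_val_stop space_pair_measure space_restrict_space)
    moreover have "(\<integral>z. (?v (\<phi> n) z - ?H z)\<^sup>2 \<partial>?P) \<le> (\<integral>z. (?v (\<phi> n) z - ?H z)\<^sup>2 \<partial>(time_measure t \<Otimes>\<^sub>M M))" for n
      using \<phi>(2) st(2) by (intro square_integrable_time_mono(2) square_integrable_diff) (auto simp: L2_tendsto_def)
    ultimately show "\<forall>\<^sub>F n in sequentially. (\<integral>z. (?v (\<tau> n) z - ?H z)\<^sup>2 \<partial>?P)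
        \<le> (\<integral>z. (?v (\<phi> n) z - ?H z)\<^sup>2 \<partial>(time_measure t \<Otimes>\<^sub>M M))" by simp
  qed simp
  then have \<tau>H: "L2_tendsto ?P (\<lambda>n. ?v (\<tau> n)) ?H"
    using Hs(1) square_integrable_simple_val[OF \<tau>] by (simp add: L2_tendsto_def)
  have [simp]: "square_integrable M (simple_ito b (\<tau> n))" "square_integrable M (simple_ito b (\<psi> n))"
    "square_integrable M (simple_ito b (\<phi> n))" for n
    using \<tau> \<psi>(1) \<phi>(1) sT st(3) by (auto intro: square_integrable_simple_ito)
  \<comment> \<open>By the isometry the squared distance of the two simple integrals is this
    combination of inner products. All three inner products tend to the squared norm of
    \<open>H\<close>, so the weights 1, -2, 1 give the limit 0.\<close>
  have "(\<lambda>n. (\<integral>z. ?v (\<tau> n) z * ?v (\<tau> n) z \<partial>?P) - 2 * (\<integral>z. ?v (\<tau> n) z * ?v (\<psi> n) z \<partial>?P)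
      + (\<integral>z. ?v (\<psi> n) z * ?v (\<psi> n) z \<partial>?P)) \<longlonglongrightarrow>
      (\<integral>z. ?H z * ?H z \<partial>?P) - 2 * (\<integral>z. ?H z * ?H z \<partial>?P) + (\<integral>z. ?H z * ?H z \<partial>?P)"
    by (intro tendsto_intros L2_tendsto_mult \<tau>H \<psi>(2))
  also have "(\<lambda>n. (\<integral>z. ?v (\<tau> n) z * ?v (\<tau> n) z \<partial>?P) - 2 * (\<integral>z. ?v (\<tau> n) z * ?v (\<psi> n) z \<partial>?P)
      + (\<integral>z. ?v (\<psi> n) z * ?v (\<psi> n) z \<partial>?P))
    = (\<lambda>n. \<integral>\<omega>. (simple_ito b (\<tau> n) \<omega> - simple_ito b (\<psi> n) \<omega>)\<^sup>2 \<partial>M)"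
  proof
    fix n
    have "(\<integral>\<omega>. (simple_ito b (\<tau> n) \<omega> - simple_ito b (\<psi> n) \<omega>)\<^sup>2 \<partial>M)
      = (\<integral>\<omega>. simple_ito b (\<tau> n) \<omega> * simple_ito b (\<tau> n) \<omega> - 2 * (simple_ito b (\<tau> n) \<omega> * simple_ito b (\<psi> n) \<omega>)
         + simple_ito b (\<psi> n) \<omega> * simple_ito b (\<psi> n) \<omega> \<partial>M)"
      by (intro Bochner_Integration.integral_cong) (auto simp: power2_eq_square algebra_simps)
    also have "\<dots> = (\<integral>z. ?v (\<tau> n) z * ?v (\<tau> n) z \<partial>?P) - 2 * (\<integral>z. ?v (\<tau> n) z * ?v (\<psi> n) z \<partial>?P)
      + (\<integral>z. ?v (\<psi> n) z * ?v (\<psi> n) z \<partial>?P)"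
      using simple_isometry[OF \<tau> \<tau> sT, of n n] simple_isometry[OF \<tau> \<psi>(1) sT, of n n]
        simple_isometry[OF \<psi>(1) \<psi>(1) sT, of n n]
      by (simp add: square_integrable_mult)
    finally show "(\<integral>z. ?v (\<tau> n) z * ?v (\<tau> n) z \<partial>?P) - 2 * (\<integral>z. ?v (\<tau> n) z * ?v (\<psi> n) z \<partial>?P)
      + (\<integral>z. ?v (\<psi> n) z * ?v (\<psi> n) z \<partial>?P) = (\<integral>\<omega>. (simple_ito b (\<tau> n) \<omega> - simple_ito b (\<psi> n) \<omega>)\<^sup>2 \<partial>M)"
      by simp
  qed
  finally have "L2_tendsto M (\<lambda>n \<omega>. simple_ito b (\<tau> n) \<omega> - simple_ito b (\<psi> n) \<omega>) (\<lambda>\<omega>. 0)"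
    by (simp add: L2_tendsto_def square_integrable_diff)
  from L2_tendsto_mult[OF L2_tendsto_const[OF \<eta>(2)] this]
  have "(\<lambda>n. \<integral>\<omega>. \<eta> \<omega> * (simple_ito b (\<tau> n) \<omega> - simple_ito b (\<psi> n) \<omega>) \<partial>M) \<longlonglongrightarrow> 0"
    by simp
  moreover have "(\<integral>\<omega>. \<eta> \<omega> * (simple_ito b (\<tau> n) \<omega> - simple_ito b (\<psi> n) \<omega>) \<partial>M)
     = (\<integral>\<omega>. \<eta> \<omega> * simple_ito b (\<phi> n) \<omega> \<partial>M) - (\<integral>\<omega>. \<eta> \<omega> * simple_ito b (\<psi> n) \<omega> \<partial>M)" for n
    unfolding simple_ito_stop[OF \<phi>(1) st \<eta>] \<tau>_def[symmetric] right_diff_distrib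
    using square_integrable_mult[OF \<eta>(2)] by simp
  moreover have "(\<lambda>n. (\<integral>\<omega>. \<eta> \<omega> * simple_ito b (\<phi> n) \<omega> \<partial>M) - (\<integral>\<omega>. \<eta> \<omega> * simple_ito b (\<psi> n) \<omega> \<partial>M))
     \<longlonglongrightarrow> (\<integral>\<omega>. \<eta> \<omega> * I \<omega> \<partial>M) - (\<integral>\<omega>. \<eta> \<omega> * I' \<omega> \<partial>M)"
    by (intro tendsto_diff L2_tendsto_mult L2_tendsto_const \<eta>(2) \<phi>(3) \<psi>(3))
  ultimately have "0 = (\<integral>\<omega>. \<eta> \<omega> * I \<omega> \<partial>M) - (\<integral>\<omega>. \<eta> \<omega> * I' \<omega> \<partial>M)"
    by (simp add: LIMSEQ_unique)
  then show ?thesis by simp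
qed

end

text \<open>Reflection in the diagonal exchanges the two triangles of the square; the diagonal
  itself is negligible because \<open>N\<close> has no atoms. The integral over a triangle has a
  variable upper limit, which turns a double time integral into an integral of values at earlier
  times.\<close>

lemma symmetric_kernel_integral:
  fixes k :: "real \<Rightarrow> real \<Rightarrow> real"
  assumes N: "sigma_finite_measure N" "(\<lambda>x. x) \<in> borel_measurable N" "\<And>s. AE u in N. u \<noteq> s"
    and int: "integrable (N \<Otimes>\<^sub>M N) (\<lambda>z. k (fst z) (snd z))"
    and sym: "\<And>u s. k u s = k s u"
  shows "(\<integral>s. (\<integral>u. k s u \<partial>N) \<partial>N) = 2 * (\<integral>s. (\<integral>u. indicator {..s} u * k s u \<partial>N) \<partial>N)"
    and "integrable N (\<lambda>s. \<integral>u. indicator {..s} u * k s u \<partial>N)"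
proof -
  interpret N: sigma_finite_measure N by fact
  interpret pair_sigma_finite N N ..
  have k: "(\<lambda>z. k (fst z) (snd z)) \<in> borel_measurable (N \<Otimes>\<^sub>M N)" using int by simp
  have m: "(fst :: real \<times> real \<Rightarrow> real) \<in> borel_measurable (N \<Otimes>\<^sub>M N)"
    "(snd :: real \<times> real \<Rightarrow> real) \<in> borel_measurable (N \<Otimes>\<^sub>M N)"
    using measurable_compose[OF measurable_fst N(2)] measurable_compose[OF measurable_snd N(2)] by auto
  have p: "{z \<in> space (N \<Otimes>\<^sub>M N). snd z \<le> fst z} \<in> sets (N \<Otimes>\<^sub>M N)"
    "{z \<in> space (N \<Otimes>\<^sub>M N). fst z < snd z} \<in> sets (N \<Otimes>\<^sub>M N)"
    using m by measurable
  have i1: "integrable (N \<Otimes>\<^sub>M N) (\<lambda>z. indicator {..fst z} (snd z) * k (fst z) (snd z))"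
    using integrable_mult_indicator[OF p(1) int]
    by (rule Bochner_Integration.integrable_cong[THEN iffD1, rotated -1]) (auto simp: indicator_def)
  have i2: "integrable (N \<Otimes>\<^sub>M N) (\<lambda>z. indicator {..<snd z} (fst z) * k (fst z) (snd z))"
    using integrable_mult_indicator[OF p(2) int]
    by (rule Bochner_Integration.integrable_cong[THEN iffD1, rotated -1]) (auto simp: indicator_def)
  show "integrable N (\<lambda>s. \<integral>u. indicator {..s} u * k s u \<partial>N)"
    using integrable_fst'[OF i1] by simp
  have "(\<integral>s. (\<integral>u. k s u \<partial>N) \<partial>N) = (\<integral>z. k (fst z) (snd z) \<partial>(N \<Otimes>\<^sub>M N))"
    using integral_fst'[OF int] by simp
  also have "\<dots> = (\<integral>z. indicator {..fst z} (snd z) * k (fst z) (snd z)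
       + indicator {..<snd z} (fst z) * k (fst z) (snd z) \<partial>(N \<Otimes>\<^sub>M N))"
    by (intro Bochner_Integration.integral_cong) (auto simp: indicator_def)
  also have "\<dots> = (\<integral>z. indicator {..fst z} (snd z) * k (fst z) (snd z) \<partial>(N \<Otimes>\<^sub>M N))
       + (\<integral>z. indicator {..<snd z} (fst z) * k (fst z) (snd z) \<partial>(N \<Otimes>\<^sub>M N))"
    by (rule Bochner_Integration.integral_add[OF i1 i2])
  also have "(\<integral>z. indicator {..<snd z} (fst z) * k (fst z) (snd z) \<partial>(N \<Otimes>\<^sub>M N))
    = (\<integral>s. (\<integral>u. indicator {..<s} u * k u s \<partial>N) \<partial>N)"
    using integral_snd[of "\<lambda>u s. indicator {..<s} u * k u s"] i2 by (simp add: case_prod_beta')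
  also have "\<dots> = (\<integral>s. (\<integral>u. indicator {..s} u * k s u \<partial>N) \<partial>N)"
  proof (rule Bochner_Integration.integral_cong[OF refl], rule integral_cong_AE)
    fix s assume s: "s \<in> space N"
    have ks: "(\<lambda>u. k s u) \<in> borel_measurable N"
      using measurable_compose[OF measurable_Pair1'[OF s] k] by simp
    have i: "(\<lambda>u. indicator A u :: real) \<in> borel_measurable N" if "A \<in> sets borel" for A
      using measurable_compose[OF N(2), of "indicator A" borel] that by simp
    show "(\<lambda>u. indicator {..<s} u * k u s) \<in> borel_measurable N"
      "(\<lambda>u. indicator {..s} u * k s u) \<in> borel_measurable N"
      unfolding sym[of _ s] by (intro borel_measurable_times ks i; simp)+
    show "AE u in N. indicator {..<s} u * k u s = indicator {..s} u * k s u"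
      using N(3)[of s] by eventually_elim (auto simp: indicator_def sym)
  qed
  also have "(\<integral>z. indicator {..fst z} (snd z) * k (fst z) (snd z) \<partial>(N \<Otimes>\<^sub>M N))
    = (\<integral>s. (\<integral>u. indicator {..s} u * k s u \<partial>N) \<partial>N)"
    using integral_fst'[OF i1] by simp
  finally show "(\<integral>s. (\<integral>u. k s u \<partial>N) \<partial>N) = 2 * (\<integral>s. (\<integral>u. indicator {..s} u * k s u \<partial>N) \<partial>N)"
    by simp
qed

section \<open>Moments of a solution and its identification with the exponential\<close>

section \<open>The Black--Scholes equation\<close>

locale black_scholes = brownian_motion +
  fixes \<alpha> \<sigma> s\<^sub>0 :: real and S :: "real \<Rightarrow> 'a \<Rightarrow> real"
  assumes stock: "black_scholes_stock M F T b \<alpha> \<sigma> s\<^sub>0 S"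
begin

abbreviation P :: "real \<Rightarrow> (real \<times> 'a) measure" where
  "P t \<equiv> time_measure t \<Otimes>\<^sub>M M"

abbreviation S' :: "real \<times> 'a \<Rightarrow> real" where
  "S' z \<equiv> S (fst z) (snd z)"

definition J :: "real \<Rightarrow> 'a \<Rightarrow> real" where
  "J t \<omega> = (\<integral>s. S s \<omega> \<partial>time_measure t)"

text \<open>The equation asserts the existence of an Ito integral separately for each
  \<open>t\<close>. One version is fixed per time, and nothing relates the versions at different
  times except \<open>ito_martingale\<close>.\<close>

definition I :: "real \<Rightarrow> 'a \<Rightarrow> real" where
  "I t = (SOME I. has_ito_integral M F b (\<lambda>s \<omega>. S s \<omega> * \<sigma>) t I \<and>
        (AE \<omega> in M. S t \<omega> = s\<^sub>0 + (LINT s:{0..t}|lborel. S s \<omega> * \<alpha>) + I \<omega>))"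

lemma I:
  assumes "t \<in> {0..T}"
  shows "has_ito_integral M F b (\<lambda>s \<omega>. S s \<omega> * \<sigma>) t (I t)"
    and "AE \<omega> in M. S t \<omega> = s\<^sub>0 + \<alpha> * J t \<omega> + I t \<omega>"
proof -
  have "\<exists>I. has_ito_integral M F b (\<lambda>s \<omega>. S s \<omega> * \<sigma>) t I \<and>
        (AE \<omega> in M. S t \<omega> = s\<^sub>0 + (LINT s:{0..t}|lborel. S s \<omega> * \<alpha>) + I \<omega>)"
    using stock assms by (simp add: black_scholes_stock_def)
  from someI_ex[OF this, folded I_def] have *: "has_ito_integral M F b (\<lambda>s \<omega>. S s \<omega> * \<sigma>) t (I t)"
    "AE \<omega> in M. S t \<omega> = s\<^sub>0 + (LINT s:{0..t}|lborel. S s \<omega> * \<alpha>) + I t \<omega>" by auto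
  have J: "(LINT s:{0..t}|lborel. S s \<omega> * \<alpha>) = \<alpha> * J t \<omega>" for \<omega>
    unfolding J_def integral_time_measure[symmetric] by simp
  show "has_ito_integral M F b (\<lambda>s \<omega>. S s \<omega> * \<sigma>) t (I t)"
    "AE \<omega> in M. S t \<omega> = s\<^sub>0 + \<alpha> * J t \<omega> + I t \<omega>"
    using * unfolding J by simp_all
qed

lemma sf: "sigma_finite_measure M" ..

lemma adapted_S: "t \<in> {0..T} \<Longrightarrow> S t \<in> borel_measurable (F t)"
  using stock by (simp add: black_scholes_stock_def ito_integrand_def)

lemma square_integrable_S': 
  assumes "t \<le> T" shows "square_integrable (P t) S'"
proof -
  have "(\<lambda>(t, \<omega>). S t \<omega>) \<in> borel_measurable (restrict_space borel {0..T} \<Otimes>\<^sub>M M)"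
    using stock by (simp add: black_scholes_stock_def ito_integrand_def)
  moreover have "sets (restrict_space borel {0..T} \<Otimes>\<^sub>M M) = sets (P T)"
    by (intro sets_pair_measure_cong) (auto simp: sets_restrict_space)
  ultimately have m: "S' \<in> borel_measurable (P T)"
    by (simp add: case_prod_beta' cong: measurable_cong_sets)
  have "(\<integral>\<^sup>+z. ennreal ((S' z)\<^sup>2) \<partial>P T) = (\<integral>\<^sup>+ t \<in> {0..T}. (\<integral>\<^sup>+ \<omega>. ennreal ((S t \<omega>)\<^sup>2) \<partial>M) \<partial>lborel)"
    using m sigma_finite_measure.nn_integral_fst[OF sf, of "\<lambda>z. ennreal ((S' z)\<^sup>2)" "time_measure T"]
    by (simp add: nn_integral_restrict_space)
  also have "\<dots> < \<infinity>"
    using stock by (simp add: black_scholes_stock_def ito_integrand_def)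
  finally have "square_integrable (P T) S'"
    using square_integrable_nn_integral[OF m] by simp
  then show ?thesis using assms by (rule square_integrable_time_mono)
qed

lemma measurable_H: "t \<le> T \<Longrightarrow> (\<lambda>z. S (fst z) (snd z) * \<sigma>) \<in> borel_measurable (P t)"
  using square_integrable_measurable[OF square_integrable_S'] by simp

text \<open>Fubini, in the form in which moments involving the drift integral become time integrals
  of moments of the stock.\<close>

lemma integral_J:
  assumes t: "t \<le> T" and g: "square_integrable M g"
  shows "integrable (time_measure t) (\<lambda>s. \<integral>\<omega>. S s \<omega> * g \<omega> \<partial>M)"
    and "(\<integral>\<omega>. J t \<omega> * g \<omega> \<partial>M) = (\<integral>s. (\<integral>\<omega>. S s \<omega> * g \<omega> \<partial>M) \<partial>time_measure t)"
    and "(\<integral>s. (\<integral>\<omega>. S s \<omega> * g \<omega> \<partial>M) \<partial>time_measure t) = (\<integral>z. S' z * g (snd z) \<partial>P t)"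
proof -
  interpret pair_sigma_finite "time_measure t" M by (rule pair_sigma_finite_time)
  have int: "integrable (P t) (\<lambda>z. S' z * g (snd z))"
    by (intro square_integrable_mult square_integrable_S' t square_integrable_time_const g)
  show "integrable (time_measure t) (\<lambda>s. \<integral>\<omega>. S s \<omega> * g \<omega> \<partial>M)"
    using integrable_fst'[OF int] by simp
  show *: "(\<integral>s. (\<integral>\<omega>. S s \<omega> * g \<omega> \<partial>M) \<partial>time_measure t) = (\<integral>z. S' z * g (snd z) \<partial>P t)"
    using integral_fst'[OF int] by simp
  have "(\<integral>\<omega>. (\<integral>s. S s \<omega> * g \<omega> \<partial>time_measure t) \<partial>M) = (\<integral>z. S' z * g (snd z) \<partial>P t)"
    using integral_snd[of "\<lambda>s \<omega>. S s \<omega> * g \<omega>"] int by (simp add: case_prod_beta')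
  then show "(\<integral>\<omega>. J t \<omega> * g \<omega> \<partial>M) = (\<integral>s. (\<integral>\<omega>. S s \<omega> * g \<omega> \<partial>M) \<partial>time_measure t)"
    unfolding * J_def by simp
qed

text \<open>Cauchy-Schwarz along a path bounds the square of \<open>J t\<close> by \<open>t\<close>
  times the time integral of the squared stock. It applies to almost every path, namely to those
  that are square integrable in time.\<close>

lemma square_integrable_J:
  assumes t: "t \<in> {0..T}"
  shows "square_integrable M (J t)"
proof -
  interpret pair_sigma_finite "time_measure t" M by (rule pair_sigma_finite_time)
  have T: "t \<le> T" using t by simp
  note S2 = square_integrable_S'[OF T]
  have int: "integrable (P t) (\<lambda>z. (S' z)\<^sup>2)"
    using S2 by (simp add: square_integrable_def)
  have sw: "(\<lambda>z. S (snd z) (fst z)) \<in> borel_measurable (M \<Otimes>\<^sub>M time_measure t)"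
    using measurable_compose[OF measurable_pair_swap'[of M "time_measure t"] square_integrable_measurable[OF S2]]
    by (simp add: case_prod_beta')
  have sft: "sigma_finite_measure (time_measure t)" ..
  have meas: "J t \<in> borel_measurable M"
    unfolding J_def using sigma_finite_measure.borel_measurable_lebesgue_integral[OF sft, of "\<lambda>\<omega> s. S s \<omega>" M] sw
    by (simp add: case_prod_beta')
  have int2: "integrable M (\<lambda>\<omega>. t * (\<integral>s. (S s \<omega>)\<^sup>2 \<partial>time_measure t))"
    using integrable_snd[of "\<lambda>s \<omega>. (S s \<omega>)\<^sup>2"] int by (simp add: case_prod_beta')
  have ae: "AE \<omega> in M. integrable (time_measure t) (\<lambda>s. (S s \<omega>)\<^sup>2)"
    using AE_integrable_snd[of "\<lambda>s \<omega>. (S s \<omega>)\<^sup>2"] int by (simp add: case_prod_beta')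
  have "AE \<omega> in M. norm ((J t \<omega>)\<^sup>2) \<le> norm (t * (\<integral>s. (S s \<omega>)\<^sup>2 \<partial>time_measure t))"
    using ae AE_space
  proof eventually_elim
    case (elim \<omega>)
    have "(\<lambda>s. S s \<omega>) \<in> borel_measurable (time_measure t)"
      using measurable_compose[OF measurable_Pair2'[OF elim(2)] square_integrable_measurable[OF S2]] by simp
    with elim have sq: "square_integrable (time_measure t) (\<lambda>s. S s \<omega>)"
      by (simp add: square_integrable_def)
    have "(\<integral>s. 1 * S s \<omega> \<partial>time_measure t)\<^sup>2 \<le> (\<integral>s. 1\<^sup>2 \<partial>time_measure t) * (\<integral>s. (S s \<omega>)\<^sup>2 \<partial>time_measure t)"
      by (intro Cauchy_Schwarz_integral sq finite_measure.square_integrable_const finite_time_measure)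
    also have "(\<integral>s. 1\<^sup>2 \<partial>time_measure t) = t"
      using t by (simp add: measure_restrict_space space_restrict_space)
    finally show ?case using t by (simp add: J_def)
  qed
  then have "integrable M (\<lambda>\<omega>. (J t \<omega>)\<^sup>2)"
    by (intro Bochner_Integration.integrable_bound[OF int2]) (use meas in auto)
  with meas show ?thesis by (simp add: square_integrable_def)
qed

lemma square_integrable_I: "t \<in> {0..T} \<Longrightarrow> square_integrable M (I t)"
  using ito_isometry(2)[OF I(1)] measurable_H by simp

lemma square_integrable_S:
  assumes t: "t \<in> {0..T}"
  shows "square_integrable M (S t)"
proof (rule square_integrable_cong_AE)
  show "square_integrable M (\<lambda>\<omega>. s\<^sub>0 + \<alpha> * J t \<omega> + I t \<omega>)"
    by (intro square_integrable_add square_integrable_cmult square_integrable_const square_integrable_I square_integrable_J t)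
  show "S t \<in> borel_measurable M"
    by (rule F_measurable_M[OF adapted_S[OF t]])
  show "AE \<omega> in M. s\<^sub>0 + \<alpha> * J t \<omega> + I t \<omega> = S t \<omega>"
    using I(2)[OF t] by eventually_elim simp
qed

lemma expectation_S_mult:
  assumes t: "t \<in> {0..T}" and g: "square_integrable M g"
  shows "(\<integral>\<omega>. S t \<omega> * g \<omega> \<partial>M) = s\<^sub>0 * (\<integral>\<omega>. g \<omega> \<partial>M) + \<alpha> * (\<integral>\<omega>. J t \<omega> * g \<omega> \<partial>M) + (\<integral>\<omega>. I t \<omega> * g \<omega> \<partial>M)"
proof -
  have "(\<integral>\<omega>. S t \<omega> * g \<omega> \<partial>M) = (\<integral>\<omega>. s\<^sub>0 * g \<omega> + \<alpha> * (J t \<omega> * g \<omega>) + I t \<omega> * g \<omega> \<partial>M)"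
  proof (rule integral_cong_AE)
    show "AE \<omega> in M. S t \<omega> * g \<omega> = s\<^sub>0 * g \<omega> + \<alpha> * (J t \<omega> * g \<omega>) + I t \<omega> * g \<omega>"
      using I(2)[OF t] by eventually_elim (simp add: algebra_simps)
  qed (use square_integrable_S[OF t] square_integrable_I[OF t] square_integrable_J[OF t] g in \<open>auto simp: square_integrable_def\<close>)
  also have "\<dots> = s\<^sub>0 * (\<integral>\<omega>. g \<omega> \<partial>M) + \<alpha> * (\<integral>\<omega>. J t \<omega> * g \<omega> \<partial>M) + (\<integral>\<omega>. I t \<omega> * g \<omega> \<partial>M)"
    using square_integrable_mult[OF square_integrable_I[OF t] g] square_integrable_mult[OF square_integrable_J[OF t] g]
      square_integrable_integrable[OF g] by simp
  finally show ?thesis .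
qed

text \<open>The growth rate has three sources: \<open>\<alpha>\<close> is the drift of the stock,
  \<open>\<sigma>\<^sup>2\<close> comes from integrating \<open>\<sigma> S\<close> against a
  Brownian motion tilted to have drift \<open>\<sigma>\<close>, and
  \<open>\<sigma>\<^sup>2 / 2\<close> is the growth of the weight itself.\<close>

lemma expectation_S_exp:
  assumes t: "t \<in> {0..T}"
  shows "(\<integral>\<omega>. S t \<omega> * exp (\<sigma> * b t \<omega>) \<partial>M) = s\<^sub>0 * exp ((\<alpha> + 3 / 2 * \<sigma>\<^sup>2) * t)"
proof -
  define c where "c t = (\<integral>\<omega>. S t \<omega> * exp (\<sigma> * b t \<omega>) \<partial>M)" for t
  \<comment> \<open>Division by the expectation of \<open>exp (\<sigma> * b t)\<close> makes
    \<open>h t\<close> the mean of the stock under the normalised weight. By \<open>c_shift\<close>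
    this mean does not depend on the horizon at which the weight is taken, so \<open>h\<close>
    satisfies a closed equation.\<close>
  define h where "h t = exp (- \<sigma>\<^sup>2 * t / 2) * c t" for t
  have c_shift: "(\<integral>\<omega>. S s \<omega> * exp (\<sigma> * b t \<omega>) \<partial>M) = exp (\<sigma>\<^sup>2 * t / 2) * h s" if "s \<in> {0..t}" "t \<le> T" for s t
  proof -
    have s: "s \<in> {0..T}" using that by simp
    have \<eta>: "(\<lambda>\<omega>. S s \<omega> * exp (\<sigma> * b s \<omega>)) \<in> borel_measurable (F s)"
      using adapted_S[OF s] adapted[OF s] by simp
    have i: "integrable M (\<lambda>\<omega>. S s \<omega> * exp (\<sigma> * b s \<omega>))"
      by (intro square_integrable_mult square_integrable_S square_integrable_exp s)
    have "(\<integral>\<omega>. (S s \<omega> * exp (\<sigma> * b s \<omega>)) * exp (\<sigma> * (b t \<omega> - b s \<omega>)) \<partial>M) = c s * exp (\<sigma>\<^sup>2 * (t - s) / 2)"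
      using increment_exp[OF _ _ _ \<eta> i, of t \<sigma>] that by (simp add: has_bochner_integral_iff c_def)
    also have "\<dots> = exp (\<sigma>\<^sup>2 * t / 2) * h s"
      by (simp add: h_def exp_add[symmetric] field_simps)
    finally show ?thesis
      by (simp add: mult.assoc exp_add[symmetric] right_diff_distrib)
  qed
  have h_eq: "h t = s\<^sub>0 + (\<alpha> + \<sigma>\<^sup>2) * (LINT s:{0..t}|lborel. h s)" if t: "t \<in> {0..T}" for t
  proof -
    have T: "t \<le> T" using t by simp
    note G = square_integrable_exp[OF t, of \<sigma>]
    have A: "(\<integral>s. (\<integral>\<omega>. S s \<omega> * exp (\<sigma> * b t \<omega>) \<partial>M) \<partial>time_measure t) = exp (\<sigma>\<^sup>2 * t / 2) * (\<integral>s. h s \<partial>time_measure t)"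
    proof -
      have "(\<integral>s. (\<integral>\<omega>. S s \<omega> * exp (\<sigma> * b t \<omega>) \<partial>M) \<partial>time_measure t) = (\<integral>s. exp (\<sigma>\<^sup>2 * t / 2) * h s \<partial>time_measure t)"
        by (rule Bochner_Integration.integral_cong) (use c_shift T in \<open>auto simp: space_restrict_space\<close>)
      then show ?thesis by simp
    qed
    have "(\<integral>z. S' z * \<sigma> * exp (\<sigma> * b t (snd z)) \<partial>P t) = \<sigma> * (\<integral>z. S' z * exp (\<sigma> * b t (snd z)) \<partial>P t)"
      by (subst integral_mult_right_zero[symmetric]) (simp add: ac_simps)
    then have "(\<integral>\<omega>. I t \<omega> * exp (\<sigma> * b t \<omega>) \<partial>M) = \<sigma>\<^sup>2 * (exp (\<sigma>\<^sup>2 * t / 2) * (\<integral>s. h s \<partial>time_measure t))"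
      using ito_tilted[OF I(1)[OF t] t measurable_H[OF T], of \<sigma>] integral_J(3)[OF T G] A
      by (simp add: power2_eq_square)
    then have "c t = s\<^sub>0 * exp (\<sigma>\<^sup>2 * t / 2) + (\<alpha> + \<sigma>\<^sup>2) * (exp (\<sigma>\<^sup>2 * t / 2) * (\<integral>s. h s \<partial>time_measure t))"
      using expectation_S_mult[OF t G] exp_moment[OF t, of \<sigma>] integral_J(2)[OF T G] A
      by (simp add: c_def has_bochner_integral_iff algebra_simps)
    then have "h t = exp (- \<sigma>\<^sup>2 * t / 2) * exp (\<sigma>\<^sup>2 * t / 2) * (s\<^sub>0 + (\<alpha> + \<sigma>\<^sup>2) * (\<integral>s. h s \<partial>time_measure t))"
      by (simp add: h_def algebra_simps)
    then show ?thesis by (simp add: exp_add[symmetric] integral_time_measure)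
  qed
  have "set_integrable lborel {0..T} h"
  proof -
    have T: "T \<in> {0..T}" using t by simp
    \<comment> \<open>Integrability of \<open>h\<close> follows from Fubini once all times use the
      same weight, the one at the final horizon \<open>T\<close>.\<close>
    have "integrable (time_measure T) (\<lambda>s. exp (- \<sigma>\<^sup>2 * T / 2) * (\<integral>\<omega>. S s \<omega> * exp (\<sigma> * b T \<omega>) \<partial>M))"
      using integral_J(1)[OF order_refl square_integrable_exp[OF T, of \<sigma>]] by simp
    also have "?this \<longleftrightarrow> integrable (time_measure T) h"
      by (rule Bochner_Integration.integrable_cong)
         (auto simp: c_shift space_restrict_space exp_add[symmetric] mult.assoc[symmetric])
    finally show ?thesis by (simp add: integrable_time_measure)
  qed
  from linear_integral_equation[OF this h_eq t]
  have "exp (\<sigma>\<^sup>2 * t / 2) * h t = exp (\<sigma>\<^sup>2 * t / 2) * (s\<^sub>0 * exp ((\<alpha> + \<sigma>\<^sup>2) * t))" by simp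
  then show ?thesis
    by (simp add: h_def c_def exp_add[symmetric] mult.assoc[symmetric])
       (simp add: mult.commute[of _ s\<^sub>0] mult.assoc exp_add[symmetric] algebra_simps add_divide_distrib)
qed

text \<open>Integrated form of the chain rule d(J^2) = 2 J S dt. The second moment of
  \<open>J t\<close> is the integral of the symmetric kernel E (S_u S_s) over a square; over the
  triangle \<open>u \<le> s\<close> the inner integral is the expectation of \<open>S s\<close>
  times \<open>J s\<close>.\<close>

lemma expectation_J_square:
  assumes t: "t \<in> {0..T}"
  shows "(\<integral>\<omega>. (J t \<omega>)\<^sup>2 \<partial>M) = 2 * (\<integral>s. (\<integral>\<omega>. S s \<omega> * J s \<omega> \<partial>M) \<partial>time_measure t)"
    and "integrable (time_measure t) (\<lambda>s. \<integral>\<omega>. S s \<omega> * J s \<omega> \<partial>M)"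
proof -
  interpret pair_sigma_finite "time_measure t" M by (rule pair_sigma_finite_time)
  have T: "t \<le> T" using t by simp
  have sft: "sigma_finite_measure (time_measure t)" ..
  define k where "k u s = (\<integral>\<omega>. S u \<omega> * S s \<omega> \<partial>M)" for u s
  have S2: "square_integrable M (S s)" if "s \<in> {0..t}" for s
    using that T by (intro square_integrable_S) auto
  note mS = square_integrable_measurable[OF square_integrable_S'[OF T]]
  have "(\<lambda>z. S' (fst (fst z), snd z) * S' (snd (fst z), snd z)) \<in> borel_measurable ((time_measure t \<Otimes>\<^sub>M time_measure t) \<Otimes>\<^sub>M M)"
    by (intro borel_measurable_times measurable_compose[OF _ mS]) measurable
  then have k_meas: "(\<lambda>z. k (fst z) (snd z)) \<in> borel_measurable (time_measure t \<Otimes>\<^sub>M time_measure t)"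
    unfolding k_def
    using sigma_finite_measure.borel_measurable_lebesgue_integral[OF sf, of "\<lambda>z \<omega>. S (fst z) \<omega> * S (snd z) \<omega>"]
    by (simp add: case_prod_beta')
  have m_int: "integrable (time_measure t) (\<lambda>s. \<integral>\<omega>. (S s \<omega>)\<^sup>2 \<partial>M)"
    using integrable_fst'[of "\<lambda>z. (S' z)\<^sup>2"] square_integrable_S'[OF T] by (simp add: square_integrable_def)
  \<comment> \<open>The kernel is dominated by a sum of functions of one time variable each, and
    these are integrable over the square because the time interval has finite length.\<close>
  have k_bound: "norm (k u s) \<le> norm ((\<integral>\<omega>. (S u \<omega>)\<^sup>2 \<partial>M) + (\<integral>\<omega>. (S s \<omega>)\<^sup>2 \<partial>M))" if "u \<in> {0..t}" "s \<in> {0..t}" for u s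
  proof -
    have "\<bar>k u s\<bar> \<le> (\<integral>\<omega>. \<bar>S u \<omega> * S s \<omega>\<bar> \<partial>M)"
      unfolding k_def by (rule integral_abs_bound)
    also have "\<dots> \<le> (\<integral>\<omega>. (S u \<omega>)\<^sup>2 + (S s \<omega>)\<^sup>2 \<partial>M)"
      using S2 that square_integrable_mult[OF S2 S2, of u s] abs_mult_le_sum_squares
      by (intro integral_mono) (auto simp: square_integrable_def)
    also have "\<dots> = (\<integral>\<omega>. (S u \<omega>)\<^sup>2 \<partial>M) + (\<integral>\<omega>. (S s \<omega>)\<^sup>2 \<partial>M)"
      using S2 that by (simp add: square_integrable_def)
    finally show ?thesis by simp
  qed
  interpret Q: pair_sigma_finite "time_measure t" "time_measure t" ..
  have "integrable (time_measure t \<Otimes>\<^sub>M time_measure t)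
     (\<lambda>z. (\<integral>\<omega>. (S (fst z) \<omega>)\<^sup>2 \<partial>M) * 1 + 1 * (\<integral>\<omega>. (S (snd z) \<omega>)\<^sup>2 \<partial>M))"
    using Q.has_bochner_integral_pair_times[OF m_int finite_measure.integrable_const[OF finite_time_measure, of t 1]]
      Q.has_bochner_integral_pair_times[OF finite_measure.integrable_const[OF finite_time_measure, of t 1] m_int]
    by (intro Bochner_Integration.integrable_add) (auto simp: has_bochner_integral_iff)
  then have k_int: "integrable (time_measure t \<Otimes>\<^sub>M time_measure t) (\<lambda>z. k (fst z) (snd z))"
    by (rule Bochner_Integration.integrable_bound[OF _ k_meas])
       (auto intro!: AE_I2 k_bound simp: space_pair_measure space_restrict_space simp del: real_norm_def)
  have ne: "AE u in time_measure t. u \<noteq> s" for s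
    using AE_lborel_singleton[of s] by (simp add: AE_restrict_space_iff) (auto elim: eventually_mono)
  have id: "(\<lambda>x. x) \<in> borel_measurable (time_measure t)"
    by (intro measurable_restrict_space1) simp
  note sym = symmetric_kernel_integral[OF sft id ne k_int]
  have k_sym: "k u s = k s u" for u s by (simp add: k_def mult.commute)
  have inner: "(\<integral>u. indicator {..s} u * k s u \<partial>time_measure t) = (\<integral>\<omega>. S s \<omega> * J s \<omega> \<partial>M)" if "s \<in> {0..t}" for s
  proof -
    have sT: "s \<le> T" using that T by simp
    have "(\<integral>u. indicator {..s} u * k s u \<partial>time_measure t) = (\<integral>u. k s u \<partial>time_measure s)"
      using that unfolding integral_time_measure set_lebesgue_integral_def
      by (intro Bochner_Integration.integral_cong) (auto simp: indicator_def)
    also have "\<dots> = (\<integral>\<omega>. J s \<omega> * S s \<omega> \<partial>M)"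
      using integral_J(2)[OF sT S2[OF that]] by (simp add: k_def mult.commute)
    finally show ?thesis by (simp add: mult.commute)
  qed
  have "(\<integral>\<omega>. J t \<omega> * J t \<omega> \<partial>M) = (\<integral>s. (\<integral>\<omega>. J t \<omega> * S s \<omega> \<partial>M) \<partial>time_measure t)"
    using integral_J(2)[OF T square_integrable_J[OF t]] by (simp add: mult.commute)
  also have "\<dots> = (\<integral>s. (\<integral>u. k s u \<partial>time_measure t) \<partial>time_measure t)"
    by (rule Bochner_Integration.integral_cong)
       (use integral_J(2)[OF T S2] k_sym in \<open>auto simp: space_restrict_space k_def\<close>)
  also have "\<dots> = 2 * (\<integral>s. (\<integral>u. indicator {..s} u * k s u \<partial>time_measure t) \<partial>time_measure t)"
    by (rule sym(1)[OF k_sym])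
  also have "(\<integral>s. (\<integral>u. indicator {..s} u * k s u \<partial>time_measure t) \<partial>time_measure t)
    = (\<integral>s. (\<integral>\<omega>. S s \<omega> * J s \<omega> \<partial>M) \<partial>time_measure t)"
    by (rule Bochner_Integration.integral_cong) (use inner in \<open>auto simp: space_restrict_space\<close>)
  finally show "(\<integral>\<omega>. (J t \<omega>)\<^sup>2 \<partial>M) = 2 * (\<integral>s. (\<integral>\<omega>. S s \<omega> * J s \<omega> \<partial>M) \<partial>time_measure t)"
    by (simp add: power2_eq_square)
  show "integrable (time_measure t) (\<lambda>s. \<integral>\<omega>. S s \<omega> * J s \<omega> \<partial>M)"
    using sym(2)[OF k_sym]
    by (rule Bochner_Integration.integrable_cong[THEN iffD1, rotated -1]) (use inner in \<open>auto simp: space_restrict_space\<close>)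
qed

text \<open>Square \<open>S = s\<^sub>0 + \<alpha> J + I\<close>. The isometry turns the square of
  \<open>I\<close> into \<open>\<sigma>\<^sup>2\<close> times the time integral of the second
  moment, the term linear in \<open>I\<close> has mean 0, and the terms containing \<open>J\<close>
  combine to \<open>2 * \<alpha>\<close> times the same time integral.\<close>

lemma expectation_S_square:
  assumes t: "t \<in> {0..T}"
  shows "(\<integral>\<omega>. (S t \<omega>)\<^sup>2 \<partial>M) = s\<^sub>0\<^sup>2 * exp ((2 * \<alpha> + \<sigma>\<^sup>2) * t)"
proof (rule linear_integral_equation[OF _ _ t])
  have m_int: "integrable (time_measure t) (\<lambda>s. \<integral>\<omega>. (S s \<omega>)\<^sup>2 \<partial>M)"
    and m_eq: "(\<integral>s. (\<integral>\<omega>. (S s \<omega>)\<^sup>2 \<partial>M) \<partial>time_measure t) = (\<integral>z. (S' z)\<^sup>2 \<partial>P t)" if "t \<le> T" for t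
  proof -
    interpret pair_sigma_finite "time_measure t" M by (rule pair_sigma_finite_time)
    have "integrable (P t) (\<lambda>z. (S' z)\<^sup>2)" using square_integrable_S'[OF that] by (simp add: square_integrable_def)
    from integrable_fst'[OF this] integral_fst'[OF this]
    show "integrable (time_measure t) (\<lambda>s. \<integral>\<omega>. (S s \<omega>)\<^sup>2 \<partial>M)"
      "(\<integral>s. (\<integral>\<omega>. (S s \<omega>)\<^sup>2 \<partial>M) \<partial>time_measure t) = (\<integral>z. (S' z)\<^sup>2 \<partial>P t)" by simp_all
  qed
  show "set_integrable lborel {0..T} (\<lambda>s. \<integral>\<omega>. (S s \<omega>)\<^sup>2 \<partial>M)"
    using m_int[of T] by (simp add: integrable_time_measure)
  fix t assume t: "t \<in> {0..T}"
  then have T: "t \<le> T" by simp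
  let ?tm = "time_measure t"
  note sqI = square_integrable_I[OF t] and sqJ = square_integrable_J[OF t]
  have I0: "(\<integral>\<omega>. I t \<omega> \<partial>M) = 0"
    using ito_tilted[OF I(1)[OF t] t measurable_H[OF T], of 0] by simp
  have I2: "(\<integral>\<omega>. (I t \<omega>)\<^sup>2 \<partial>M) = \<sigma>\<^sup>2 * (\<integral>s. (\<integral>\<omega>. (S s \<omega>)\<^sup>2 \<partial>M) \<partial>?tm)"
    using ito_isometry(1)[OF I(1)[OF t] T measurable_H[OF T]] m_eq[OF T]
    by (simp add: power_mult_distrib mult.commute)
  have J1: "(\<integral>\<omega>. J t \<omega> \<partial>M) = (\<integral>s. (\<integral>\<omega>. S s \<omega> \<partial>M) \<partial>?tm)" "integrable ?tm (\<lambda>s. \<integral>\<omega>. S s \<omega> \<partial>M)"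
    using integral_J[OF T square_integrable_const[of 1]] by simp_all
  \<comment> \<open>The stock at time \<open>s\<close> is known at \<open>s\<close>, so the
    martingale property replaces \<open>I t\<close> by \<open>I s\<close>. The mixed term thereby
    involves only moments at a single time.\<close>
  have SI: "(\<integral>\<omega>. S s \<omega> * I t \<omega> \<partial>M) = (\<integral>\<omega>. S s \<omega> * I s \<omega> \<partial>M)" if "s \<in> {0..t}" for s
  proof -
    have s: "s \<in> {0..T}" using that T by simp
    show ?thesis
      using ito_martingale[OF I(1)[OF t] I(1)[OF s] _ _ T measurable_H[OF T] adapted_S[OF s] square_integrable_S[OF s]]
        that by simp
  qed
  have IJ: "(\<integral>\<omega>. J t \<omega> * I t \<omega> \<partial>M) = (\<integral>s. (\<integral>\<omega>. S s \<omega> * I s \<omega> \<partial>M) \<partial>?tm)"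
    unfolding integral_J(2)[OF T sqI]
    by (rule Bochner_Integration.integral_cong) (use SI in \<open>auto simp: space_restrict_space\<close>)
  have SI_int: "integrable ?tm (\<lambda>s. \<integral>\<omega>. S s \<omega> * I s \<omega> \<partial>M)"
    using integral_J(1)[OF T sqI]
    by (rule Bochner_Integration.integrable_cong[THEN iffD1, rotated -1]) (use SI in \<open>auto simp: space_restrict_space\<close>)
  note JJ = expectation_J_square[OF t]
  have "(\<integral>\<omega>. (S t \<omega>)\<^sup>2 \<partial>M) = (\<integral>\<omega>. s\<^sub>0\<^sup>2 + \<alpha>\<^sup>2 * (J t \<omega>)\<^sup>2 + (I t \<omega>)\<^sup>2 + 2 * s\<^sub>0 * \<alpha> * J t \<omega> + 2 * s\<^sub>0 * I t \<omega>
      + 2 * \<alpha> * (J t \<omega> * I t \<omega>) \<partial>M)"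
  proof (rule integral_cong_AE)
    show "AE \<omega> in M. (S t \<omega>)\<^sup>2 = s\<^sub>0\<^sup>2 + \<alpha>\<^sup>2 * (J t \<omega>)\<^sup>2 + (I t \<omega>)\<^sup>2 + 2 * s\<^sub>0 * \<alpha> * J t \<omega> + 2 * s\<^sub>0 * I t \<omega>
      + 2 * \<alpha> * (J t \<omega> * I t \<omega>)"
      using I(2)[OF t] by eventually_elim (simp add: power2_eq_square algebra_simps)
  qed (use square_integrable_S[OF t] sqI sqJ in \<open>auto simp: square_integrable_def\<close>)
  also have "\<dots> = s\<^sub>0\<^sup>2 + \<alpha>\<^sup>2 * (\<integral>\<omega>. (J t \<omega>)\<^sup>2 \<partial>M) + (\<integral>\<omega>. (I t \<omega>)\<^sup>2 \<partial>M) + 2 * s\<^sub>0 * \<alpha> * (\<integral>\<omega>. J t \<omega> \<partial>M)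
      + 2 * s\<^sub>0 * (\<integral>\<omega>. I t \<omega> \<partial>M) + 2 * \<alpha> * (\<integral>\<omega>. J t \<omega> * I t \<omega> \<partial>M)"
    using sqI sqJ square_integrable_mult[OF sqJ sqI] square_integrable_integrable[OF sqI] square_integrable_integrable[OF sqJ]
    by (simp add: square_integrable_def prob_space)
  also have "\<dots> = s\<^sub>0\<^sup>2 + \<sigma>\<^sup>2 * (\<integral>s. (\<integral>\<omega>. (S s \<omega>)\<^sup>2 \<partial>M) \<partial>?tm)
      + 2 * \<alpha> * (s\<^sub>0 * (\<integral>s. (\<integral>\<omega>. S s \<omega> \<partial>M) \<partial>?tm) + \<alpha> * (\<integral>s. (\<integral>\<omega>. S s \<omega> * J s \<omega> \<partial>M) \<partial>?tm)
        + (\<integral>s. (\<integral>\<omega>. S s \<omega> * I s \<omega> \<partial>M) \<partial>?tm))"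
    unfolding I0 I2 J1(1) IJ JJ(1) by (simp add: algebra_simps power2_eq_square)
  also have "s\<^sub>0 * (\<integral>s. (\<integral>\<omega>. S s \<omega> \<partial>M) \<partial>?tm) + \<alpha> * (\<integral>s. (\<integral>\<omega>. S s \<omega> * J s \<omega> \<partial>M) \<partial>?tm)
        + (\<integral>s. (\<integral>\<omega>. S s \<omega> * I s \<omega> \<partial>M) \<partial>?tm)
      = (\<integral>s. s\<^sub>0 * (\<integral>\<omega>. S s \<omega> \<partial>M) + \<alpha> * (\<integral>\<omega>. S s \<omega> * J s \<omega> \<partial>M) + (\<integral>\<omega>. S s \<omega> * I s \<omega> \<partial>M) \<partial>?tm)"
    using J1(2) JJ(2) SI_int by simp
  \<comment> \<open>At each time \<open>s\<close> the integrand is the right-hand side of the stock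
    equation multiplied by \<open>S s\<close>, in expectation, so it is the second moment of
    \<open>S s\<close>.\<close>
  also have "\<dots> = (\<integral>s. (\<integral>\<omega>. (S s \<omega>)\<^sup>2 \<partial>M) \<partial>?tm)"
  proof (rule Bochner_Integration.integral_cong[OF refl])
    fix s assume "s \<in> space ?tm"
    then have s: "s \<in> {0..T}" using T by (simp add: space_restrict_space)
    show "s\<^sub>0 * (\<integral>\<omega>. S s \<omega> \<partial>M) + \<alpha> * (\<integral>\<omega>. S s \<omega> * J s \<omega> \<partial>M) + (\<integral>\<omega>. S s \<omega> * I s \<omega> \<partial>M) = (\<integral>\<omega>. (S s \<omega>)\<^sup>2 \<partial>M)"
      using expectation_S_mult[OF s square_integrable_S[OF s]] by (simp add: power2_eq_square mult.commute)
  qed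
  finally show "(\<integral>\<omega>. (S t \<omega>)\<^sup>2 \<partial>M) = s\<^sub>0\<^sup>2 + (2 * \<alpha> + \<sigma>\<^sup>2) * (LINT s:{0..t}|lborel. (\<integral>\<omega>. (S s \<omega>)\<^sup>2 \<partial>M))"
    by (simp add: integral_time_measure algebra_simps)
qed

lemma solution:
  assumes t: "t \<in> {0..T}"
  shows "AE \<omega> in M. S t \<omega> = s\<^sub>0 * exp ((\<alpha> - 1 / 2 * \<sigma>\<^sup>2) * t + \<sigma> * b t \<omega>)"
proof -
  define e where "e = s\<^sub>0 * exp ((\<alpha> - 1 / 2 * \<sigma>\<^sup>2) * t)"
  define G where "G \<omega> = exp (\<sigma> * b t \<omega>)" for \<omega>
  have G: "square_integrable M G"
    unfolding G_def by (rule square_integrable_exp[OF t])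
  have D: "square_integrable M (\<lambda>\<omega>. S t \<omega> - e * G \<omega>)"
    by (intro square_integrable_diff square_integrable_cmult square_integrable_S t G)
  have G2: "(\<integral>\<omega>. (G \<omega>)\<^sup>2 \<partial>M) = exp (2 * \<sigma>\<^sup>2 * t)"
  proof -
    have "(exp (\<sigma> * x))\<^sup>2 = exp (2 * \<sigma> * x)" for x
      by (simp add: power2_eq_square exp_add[symmetric])
    then show ?thesis
      using exp_moment[OF t, of "2 * \<sigma>"] by (simp add: G_def has_bochner_integral_iff power_mult_distrib)
  qed
  have "(\<integral>\<omega>. (S t \<omega> - e * G \<omega>)\<^sup>2 \<partial>M) = (\<integral>\<omega>. (S t \<omega>)\<^sup>2 - 2 * e * (S t \<omega> * G \<omega>) + e\<^sup>2 * (G \<omega>)\<^sup>2 \<partial>M)"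
    by (intro Bochner_Integration.integral_cong) (auto simp: power2_eq_square algebra_simps)
  also have "\<dots> = (\<integral>\<omega>. (S t \<omega>)\<^sup>2 \<partial>M) - 2 * e * (\<integral>\<omega>. S t \<omega> * G \<omega> \<partial>M) + e\<^sup>2 * (\<integral>\<omega>. (G \<omega>)\<^sup>2 \<partial>M)"
    using square_integrable_mult[OF square_integrable_S[OF t] G] square_integrable_S[OF t] G
    by (simp add: square_integrable_def)
  also have "\<dots> = s\<^sub>0\<^sup>2 * exp ((2 * \<alpha> + \<sigma>\<^sup>2) * t) - 2 * e * (s\<^sub>0 * exp ((\<alpha> + 3 / 2 * \<sigma>\<^sup>2) * t)) + e\<^sup>2 * exp (2 * \<sigma>\<^sup>2 * t)"
    unfolding G2 expectation_S_square[OF t] using expectation_S_exp[OF t] by (simp add: G_def)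
  \<comment> \<open>Each of the three moments, with its power of \<open>e\<close>, equals
    \<open>s\<^sub>0\<^sup>2 * exp ((2 * \<alpha> + \<sigma>\<^sup>2) * t)\<close>; the weights 1,
    -2, 1 cancel.\<close>
  also have "\<dots> = 0"
  proof -
    have 1: "exp ((\<alpha> - 1 / 2 * \<sigma>\<^sup>2) * t) * exp ((\<alpha> + 3 / 2 * \<sigma>\<^sup>2) * t) = exp ((2 * \<alpha> + \<sigma>\<^sup>2) * t)"
      by (simp add: exp_add[symmetric] algebra_simps)
    have 2: "exp ((\<alpha> - 1 / 2 * \<sigma>\<^sup>2) * t) * exp ((\<alpha> - 1 / 2 * \<sigma>\<^sup>2) * t) * exp (2 * \<sigma>\<^sup>2 * t) = exp ((2 * \<alpha> + \<sigma>\<^sup>2) * t)"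
      by (simp add: exp_add[symmetric] algebra_simps)
    have a: "e * (s\<^sub>0 * exp ((\<alpha> + 3 / 2 * \<sigma>\<^sup>2) * t)) = s\<^sub>0\<^sup>2 * exp ((2 * \<alpha> + \<sigma>\<^sup>2) * t)"
      unfolding 1[symmetric] e_def by (simp add: power2_eq_square[of s\<^sub>0])
    have c: "e\<^sup>2 * exp (2 * \<sigma>\<^sup>2 * t) = s\<^sub>0\<^sup>2 * exp ((2 * \<alpha> + \<sigma>\<^sup>2) * t)"
      unfolding 2[symmetric] e_def by (simp add: power2_eq_square[of s\<^sub>0] power2_eq_square[of "exp x" for x] power_mult_distrib)
    show ?thesis using a c by simp
  qed
  finally have "AE \<omega> in M. (S t \<omega> - e * G \<omega>)\<^sup>2 = 0"
    using D integral_nonneg_eq_0_iff_AE[of M "\<lambda>\<omega>. (S t \<omega> - e * G \<omega>)\<^sup>2"] by (simp add: square_integrable_def)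
  then show ?thesis
    by eventually_elim (simp add: e_def G_def exp_add mult.assoc)
qed

end

section \<open>Marginals and null sets of the bivariate normal law\<close>

section \<open>The components of a correlated Wiener process\<close>

lemma borel_measurable_vec_component: "(\<lambda>x :: real ^ 'n. x $ i) \<in> borel_measurable borel"
  by (intro borel_measurable_continuous_onI continuous_intros)

lemma borel_measurable_vector2: "(\<lambda>z. vector [fst z, snd z] :: real ^ 2) \<in> borel_measurable borel"
proof -
  have "(\<lambda>z. vector [fst z, snd z] :: real ^ 2) = (\<lambda>z. fst z *\<^sub>R axis 1 1 + snd z *\<^sub>R axis 2 1)"
    by (auto simp: fun_eq_iff vec_eq_iff forall_2 axis_def)
  then show ?thesis
    by (simp only:) (intro borel_measurable_continuous_onI continuous_intros)
qed

text \<open>Gives access to Tonelli's theorem for densities on \<open>real ^ 2\<close>. Lebesgue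
  measure is determined by its values on boxes, and boxes correspond to products of
  intervals.\<close>

lemma lborel_vec2: "(lborel :: (real ^ 2) measure) = distr (lborel \<Otimes>\<^sub>M lborel) borel (\<lambda>z. vector [fst z, snd z])"
proof (rule lborel_eqI)
  have m: "(\<lambda>z. vector [fst z, snd z] :: real ^ 2) \<in> borel_measurable (borel :: (real \<times> real) measure)"
    by (rule borel_measurable_vector2)
  have B: "(Basis :: (real ^ 2) set) = {axis 1 1, axis 2 1}"
    by (auto simp: Basis_vec_def UNIV_2)
  fix l u :: "real ^ 2" assume le: "\<And>b. b \<in> Basis \<Longrightarrow> l \<bullet> b \<le> u \<bullet> b"
  have le': "l $ 1 \<le> u $ 1" "l $ 2 \<le> u $ 2"
    using le[of "axis 1 1"] le[of "axis 2 1"] by (auto simp: B inner_axis)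
  have "(\<lambda>z. vector [fst z, snd z]) -` box l u = {l $ 1<..<u $ 1} \<times> {l $ 2<..<u $ 2}"
    by (auto simp: box_def B inner_axis)
  then have "emeasure (distr (lborel \<Otimes>\<^sub>M lborel) borel (\<lambda>z. vector [fst z, snd z])) (box l u)
      = emeasure (lborel \<Otimes>\<^sub>M lborel) ({l $ 1<..<u $ 1} \<times> {l $ 2<..<u $ 2})"
    using m by (subst emeasure_distr) (auto simp: lborel_prod space_pair_measure)
  also have "\<dots> = ennreal (u $ 1 - l $ 1) * ennreal (u $ 2 - l $ 2)"
    using le' by (simp add: lborel.emeasure_pair_measure_Times)
  also have "\<dots> = (\<Prod>b\<in>Basis. (u - l) \<bullet> b)"
    using le' by (simp add: B inner_axis axis_eq_axis ennreal_mult)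
  finally show "emeasure (distr (lborel \<Otimes>\<^sub>M lborel) borel (\<lambda>z. vector [fst z, snd z])) (box l u)
    = (\<Prod>b\<in>Basis. (u - l) \<bullet> b)" .
qed simp

lemma nn_integral_lborel_vec2:
  assumes "f \<in> borel_measurable (lborel \<Otimes>\<^sub>M lborel)"
  shows "(\<integral>\<^sup>+x. f (x $ 1, x $ 2) \<partial>(lborel :: (real ^ 2) measure)) = (\<integral>\<^sup>+z. f z \<partial>(lborel \<Otimes>\<^sub>M lborel))"
proof -
  have m: "(\<lambda>z. vector [fst z, snd z] :: real ^ 2) \<in> borel_measurable (lborel \<Otimes>\<^sub>M lborel)"
    using borel_measurable_vector2 by (simp add: lborel_prod)
  have f: "f \<in> borel_measurable borel"
    using assms by (simp add: lborel_prod)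
  have "(\<lambda>x :: real ^ 2. (x $ 1, x $ 2)) \<in> borel_measurable borel"
    by (intro borel_measurable_Pair borel_measurable_vec_component)
  from measurable_compose[OF this f]
  show ?thesis
    unfolding lborel_vec2 using m by (subst nn_integral_distr) auto
qed

lemma corr_matrix_pos_definite: "pos_definite (corr_matrix \<rho>) \<Longrightarrow> \<bar>\<rho>\<bar> < 1"
proof -
  assume "pos_definite (corr_matrix \<rho>)"
  then have *: "x \<noteq> 0 \<Longrightarrow> x \<bullet> (corr_matrix \<rho> *v x) > 0" for x by (simp add: pos_definite_def)
  have "x \<bullet> (corr_matrix \<rho> *v x) = (x $ 1)\<^sup>2 + 2 * \<rho> * x $ 1 * x $ 2 + (x $ 2)\<^sup>2" for x
    by (simp add: corr_matrix_def inner_vec_def matrix_vector_mult_def sum_2 power2_eq_square algebra_simps)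
  then show "\<bar>\<rho>\<bar> < 1"
    \<comment> \<open>The quadratic form takes the values \<open>2 + 2 * \<rho>\<close> and
      \<open>2 - 2 * \<rho>\<close> at these two vectors.\<close>
    using *[of "vector [1, 1]"] *[of "vector [1, -1]"] by (auto simp: vec_eq_iff forall_2)
qed

text \<open>The density factors into the marginal of one coordinate and the conditional normal
  density of the other, with mean \<open>\<rho>\<close> times the first and variance
  \<open>\<tau> * (1 - \<rho>\<^sup>2)\<close>. Both orders are recorded so that either coordinate
  can be integrated out.\<close>

lemma mvnormal_density_corr:
  assumes \<rho>: "\<bar>\<rho>\<bar> < 1" and \<tau>: "\<tau> > 0"
  shows "mvnormal_density (\<tau> *\<^sub>R corr_matrix \<rho>) x
    = normal_density 0 (sqrt \<tau>) (x $ 1) * normal_density (\<rho> * x $ 1) (sqrt (\<tau> * (1 - \<rho>\<^sup>2))) (x $ 2)"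
    and "mvnormal_density (\<tau> *\<^sub>R corr_matrix \<rho>) x
    = normal_density 0 (sqrt \<tau>) (x $ 2) * normal_density (\<rho> * x $ 2) (sqrt (\<tau> * (1 - \<rho>\<^sup>2))) (x $ 1)"
proof -
  have r: "1 - \<rho>\<^sup>2 > 0" using \<rho> by (simp add: abs_square_less_1)
  define D where "D = \<tau> * (1 - \<rho>\<^sup>2)"
  have D: "D \<noteq> 0" "\<tau> - \<rho> * (\<rho> * \<tau>) = D"
    using \<tau> r by (auto simp: D_def power2_eq_square algebra_simps)
  \<comment> \<open>\<open>R\<close> is the explicit inverse, with \<open>\<tau> * D\<close> the
    determinant. As \<open>matrix_inv\<close> is a choice among two-sided inverses, uniqueness has
    to be shown as well.\<close>
  define R :: "real ^ 2 ^ 2" where "R = vector [vector [1 / D, - \<rho> / D], vector [- \<rho> / D, 1 / D]]"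
  have R: "(\<tau> *\<^sub>R corr_matrix \<rho>) ** R = mat 1" "R ** (\<tau> *\<^sub>R corr_matrix \<rho>) = mat 1"
    using D by (simp_all add: vec_eq_iff forall_2 matrix_matrix_mult_def sum_2 R_def corr_matrix_def mat_def
        divide_simps) (simp_all add: algebra_simps)
  have "A' = R" if "(\<tau> *\<^sub>R corr_matrix \<rho>) ** A' = mat 1" for A'
  proof -
    have "R = R ** ((\<tau> *\<^sub>R corr_matrix \<rho>) ** A')" using that by simp
    also have "\<dots> = A'" by (simp add: matrix_mul_assoc R(2))
    finally show ?thesis by simp
  qed
  then have uniq: "(\<tau> *\<^sub>R corr_matrix \<rho>) ** A' = mat 1 \<and> A' ** (\<tau> *\<^sub>R corr_matrix \<rho>) = mat 1 \<Longrightarrow> A' = R" for A'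
    by blast
  have inv: "matrix_inv (\<tau> *\<^sub>R corr_matrix \<rho>) = R"
    unfolding matrix_inv_def by (rule some_equality, rule conjI[OF R], rule uniq)
  have det: "det (\<tau> *\<^sub>R corr_matrix \<rho>) = \<tau> * (\<tau> * (1 - \<rho>\<^sup>2))"
    by (simp add: det_2 corr_matrix_def power2_eq_square algebra_simps)
  have quad: "x \<bullet> (R *v x) = ((x $ 1)\<^sup>2 - 2 * \<rho> * x $ 1 * x $ 2 + (x $ 2)\<^sup>2) / (\<tau> * (1 - \<rho>\<^sup>2))"
    unfolding D_def[symmetric] by (simp add: R_def inner_vec_def matrix_vector_mult_def sum_2 power2_eq_square algebra_simps add_divide_distrib diff_divide_distrib)
  have *: "mvnormal_density (\<tau> *\<^sub>R corr_matrix \<rho>) x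
    = exp (- (((x $ 1)\<^sup>2 - 2 * \<rho> * x $ 1 * x $ 2 + (x $ 2)\<^sup>2) / (\<tau> * (1 - \<rho>\<^sup>2))) / 2)
      / sqrt ((2 * pi * \<tau>) * (2 * pi * (\<tau> * (1 - \<rho>\<^sup>2))))"
    unfolding mvnormal_density_def inv det quad by (simp add: power2_eq_square ac_simps)
  have g: "exp (- ((a\<^sup>2 - 2 * \<rho> * a * c + c\<^sup>2) / (\<tau> * (1 - \<rho>\<^sup>2))) / 2) / sqrt ((2 * pi * \<tau>) * (2 * pi * (\<tau> * (1 - \<rho>\<^sup>2))))
      = normal_density 0 (sqrt \<tau>) a * normal_density (\<rho> * a) (sqrt (\<tau> * (1 - \<rho>\<^sup>2))) c" for a c
  proof -
    have s: "(sqrt \<tau>)\<^sup>2 = \<tau>" "(sqrt (\<tau> * (1 - \<rho>\<^sup>2)))\<^sup>2 = \<tau> * (1 - \<rho>\<^sup>2)" using \<tau> r by simp_all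
    have "a\<^sup>2 - 2 * \<rho> * a * c + c\<^sup>2 = a\<^sup>2 * (1 - \<rho>\<^sup>2) + (c - \<rho> * a)\<^sup>2"
      by (simp add: power2_eq_square algebra_simps)
    then have "- ((a\<^sup>2 - 2 * \<rho> * a * c + c\<^sup>2) / (\<tau> * (1 - \<rho>\<^sup>2))) / 2
      = - (a - 0)\<^sup>2 / (2 * \<tau>) + - (c - \<rho> * a)\<^sup>2 / (2 * (\<tau> * (1 - \<rho>\<^sup>2)))"
      using \<tau> r by (simp add: add_divide_distrib)
    moreover have "exp (u + w) / sqrt (q * q') = (1 / sqrt q * exp u) * (1 / sqrt q' * exp w)" for u w q q' :: real
      by (simp add: exp_add real_sqrt_mult)
    ultimately show ?thesis
      unfolding normal_density_def s by (simp only:)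
  qed
  show "mvnormal_density (\<tau> *\<^sub>R corr_matrix \<rho>) x
    = normal_density 0 (sqrt \<tau>) (x $ 1) * normal_density (\<rho> * x $ 1) (sqrt (\<tau> * (1 - \<rho>\<^sup>2))) (x $ 2)"
    unfolding * by (rule g)
  have swap: "(x $ 1)\<^sup>2 - 2 * \<rho> * x $ 1 * x $ 2 + (x $ 2)\<^sup>2 = (x $ 2)\<^sup>2 - 2 * \<rho> * x $ 2 * x $ 1 + (x $ 1)\<^sup>2"
    by simp
  show "mvnormal_density (\<tau> *\<^sub>R corr_matrix \<rho>) x
    = normal_density 0 (sqrt \<tau>) (x $ 2) * normal_density (\<rho> * x $ 2) (sqrt (\<tau> * (1 - \<rho>\<^sup>2))) (x $ 1)"
    unfolding * swap by (rule g)
qed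

lemma nn_integral_normal_density: "\<sigma> > 0 \<Longrightarrow> (\<integral>\<^sup>+x. ennreal (normal_density \<mu> \<sigma> x) \<partial>lborel) = 1"
  by (subst nn_integral_eq_integral) auto

text \<open>In the factorisation that starts with coordinate \<open>i\<close>, the conditional
  density of the other coordinate integrates to 1.\<close>

lemma distributed_mvnormal_component:
  assumes D: "distributed M lborel U (\<lambda>x. ennreal (mvnormal_density (\<tau> *\<^sub>R corr_matrix \<rho>) x))"
    and \<rho>: "\<bar>\<rho>\<bar> < 1" and \<tau>: "\<tau> > 0"
  shows "distributed M lborel (\<lambda>\<omega>. U \<omega> $ i) (\<lambda>x. ennreal (normal_density 0 (sqrt \<tau>) x))"
proof -
  have r: "sqrt (\<tau> * (1 - \<rho>\<^sup>2)) > 0" using \<rho> \<tau> by (simp add: abs_square_less_1)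
  have U[measurable]: "U \<in> borel_measurable M" using distributed_measurable[OF D] by simp
  have c[measurable]: "(\<lambda>x :: real ^ 2. x $ j) \<in> borel_measurable borel" for j by (rule borel_measurable_vec_component)
  have Ui: "(\<lambda>\<omega>. U \<omega> $ i) \<in> borel_measurable M" by measurable
  define n1 where "n1 x = ennreal (normal_density 0 (sqrt \<tau>) x)" for x
  define n2 where "n2 x y = ennreal (normal_density (\<rho> * x) (sqrt (\<tau> * (1 - \<rho>\<^sup>2))) y)" for x y
  have n2: "(\<integral>\<^sup>+y. n2 x y \<partial>lborel) = 1" for x
    unfolding n2_def using r by (rule nn_integral_normal_density)
  have [measurable]: "n1 \<in> borel_measurable borel" unfolding n1_def by measurable
  have n2p: "(\<lambda>z. n2 (fst z) (snd z)) \<in> borel_measurable (lborel \<Otimes>\<^sub>M lborel)"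
    "(\<lambda>z. n2 (snd z) (fst z)) \<in> borel_measurable (lborel \<Otimes>\<^sub>M lborel)"
    unfolding n2_def normal_density_def by measurable
  have n2m [measurable]: "n2 x \<in> borel_measurable borel" for x unfolding n2_def by measurable
  have n1p: "(\<lambda>z. n1 (fst z) * indicator A (fst z)) \<in> borel_measurable (lborel \<Otimes>\<^sub>M lborel)"
    "(\<lambda>z. n1 (snd z) * indicator A (snd z)) \<in> borel_measurable (lborel \<Otimes>\<^sub>M lborel)" if "A \<in> sets borel" for A
    using that measurable_compose[OF measurable_fst, of "\<lambda>x. n1 x * indicator A x" lborel borel lborel]
      measurable_compose[OF measurable_snd, of "\<lambda>x. n1 x * indicator A x" lborel borel lborel] by auto
  have np: "(\<lambda>z. (n1 (fst z) * indicator A (fst z)) * n2 (fst z) (snd z)) \<in> borel_measurable (lborel \<Otimes>\<^sub>M lborel)"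
    "(\<lambda>z. (n1 (snd z) * indicator A (snd z)) * n2 (snd z) (fst z)) \<in> borel_measurable (lborel \<Otimes>\<^sub>M lborel)"
    if "A \<in> sets borel" for A
    by (intro borel_measurable_times_ennreal n1p n2p that)+
  have "emeasure (distr M lborel (\<lambda>\<omega>. U \<omega> $ i)) A = emeasure (density lborel n1) A" if A: "A \<in> sets borel" for A
  proof -
    have "emeasure (distr M lborel (\<lambda>\<omega>. U \<omega> $ i)) A = emeasure (distr M lborel U) ((\<lambda>x. x $ i) -` A)"
      using A Ui measurable_sets[OF c[of i] A] by (simp add: emeasure_distr vimage_def)
    also have "\<dots> = (\<integral>\<^sup>+x. ennreal (mvnormal_density (\<tau> *\<^sub>R corr_matrix \<rho>) x) * indicator ((\<lambda>x. x $ i) -` A) x \<partial>lborel)"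
      using measurable_sets[OF c[of i] A]
      by (subst distributed_distr_eq_density[OF D], subst emeasure_density)
         (use distributed_borel_measurable[OF D] in auto)
    also have "\<dots> = (\<integral>\<^sup>+x. n1 x * indicator A x \<partial>lborel)"
    proof (cases "i = 1")
      case True
      have "(\<integral>\<^sup>+x. ennreal (mvnormal_density (\<tau> *\<^sub>R corr_matrix \<rho>) x) * indicator ((\<lambda>x. x $ i) -` A) x \<partial>lborel)
        = (\<integral>\<^sup>+x. (\<lambda>z. (n1 (fst z) * indicator A (fst z)) * n2 (fst z) (snd z)) (x $ 1, x $ 2) \<partial>(lborel :: (real ^ 2) measure))"
        unfolding mvnormal_density_corr(1)[OF \<rho> \<tau>] n1_def n2_def True
        by (intro nn_integral_cong) (auto simp: indicator_def ennreal_mult)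
      also have "\<dots> = (\<integral>\<^sup>+z. (n1 (fst z) * indicator A (fst z)) * n2 (fst z) (snd z) \<partial>(lborel \<Otimes>\<^sub>M lborel))"
        by (rule nn_integral_lborel_vec2[OF np(1)[OF A]])
      also have "\<dots> = (\<integral>\<^sup>+x. (\<integral>\<^sup>+y. (n1 x * indicator A x) * n2 x y \<partial>lborel) \<partial>lborel)"
        by (subst lborel.nn_integral_fst[symmetric]) (rule np(1)[OF A], simp)
      finally show ?thesis by (simp add: nn_integral_cmult n2)
    next
      case False
      then have i: "i = 2" using exhaust_2 by blast
      have "(\<integral>\<^sup>+x. ennreal (mvnormal_density (\<tau> *\<^sub>R corr_matrix \<rho>) x) * indicator ((\<lambda>x. x $ i) -` A) x \<partial>lborel)
        = (\<integral>\<^sup>+x. (\<lambda>z. (n1 (snd z) * indicator A (snd z)) * n2 (snd z) (fst z)) (x $ 1, x $ 2) \<partial>(lborel :: (real ^ 2) measure))"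
        unfolding mvnormal_density_corr(2)[OF \<rho> \<tau>] n1_def n2_def i
        by (intro nn_integral_cong) (auto simp: indicator_def ennreal_mult)
      also have "\<dots> = (\<integral>\<^sup>+z. (n1 (snd z) * indicator A (snd z)) * n2 (snd z) (fst z) \<partial>(lborel \<Otimes>\<^sub>M lborel))"
        by (rule nn_integral_lborel_vec2[OF np(2)[OF A]])
      also have "\<dots> = (\<integral>\<^sup>+y. (\<integral>\<^sup>+x. (n1 y * indicator A y) * n2 y x \<partial>lborel) \<partial>lborel)"
        by (subst lborel_pair.nn_integral_snd[symmetric]) (rule np(2)[OF A], simp)
      finally show ?thesis by (simp add: nn_integral_cmult n2)
    qed
    also have "\<dots> = emeasure (density lborel n1) A"
      using A by (simp add: emeasure_density)
    finally show ?thesis .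
  qed
  then have "distr M lborel (\<lambda>\<omega>. U \<omega> $ i) = density lborel n1"
    by (intro measure_eqI) auto
  then show ?thesis
    using Ui by (simp add: distributed_def n1_def[abs_def])
qed

text \<open>A preimage under one coordinate of the increment is a preimage under the whole
  increment, so independence from the common past is inherited.\<close>

lemma wiener_process_component:
  assumes W: "wiener_process M F T (corr_matrix \<rho>) W" and \<rho>: "\<bar>\<rho>\<bar> < 1"
  shows "brownian_motion M F T (\<lambda>t \<omega>. W t \<omega> $ i)"
proof -
  note w = W[unfolded wiener_process_def filtered_space_def]
  have F: "filtration (space M) F" using w by simp
  interpret prob_space M using w by simp
  note c = borel_measurable_vec_component[of i]
  show ?thesis
  proof (intro brownian_motion.intro brownian_motion_axioms.intro)
    show "prob_space M" by (rule prob_space_axioms)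
    show "subalgebra M (F t)" for t using w by simp
    show "sets (F s) \<subseteq> sets (F t)" if "s \<le> t" for s t
      using F that by (auto simp: filtration_def)
    show "(\<lambda>\<omega>. W t \<omega> $ i) \<in> borel_measurable (F t)" if "t \<in> {0..T}" for t
      using measurable_compose[OF _ c, of "W t" "F t"] w that by simp
    show "AE \<omega> in M. W 0 \<omega> $ i = 0"
    proof -
      have "AE \<omega> in M. W 0 \<omega> = 0" using w by simp
      then show ?thesis by eventually_elim simp
    qed
    fix s t assume st: "0 \<le> s" "s < t" "t \<le> T"
    have "distributed M lborel (\<lambda>\<omega>. W t \<omega> - W s \<omega>) (\<lambda>x. ennreal (mvnormal_density ((t - s) *\<^sub>R corr_matrix \<rho>) x))"
      using w st by simp
    from distributed_mvnormal_component[OF this \<rho>, of i] st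
    show "distributed M lborel (\<lambda>\<omega>. W t \<omega> $ i - W s \<omega> $ i) (\<lambda>x. ennreal (normal_density 0 (sqrt (t - s)) x))"
      by simp
    have "indep_set (sets (F s)) {(\<lambda>\<omega>. W t \<omega> - W s \<omega>) -` B \<inter> space M | B. B \<in> sets borel}"
      using w st by simp
    moreover have "{(\<lambda>\<omega>. W t \<omega> $ i - W s \<omega> $ i) -` B \<inter> space M | B. B \<in> sets borel}
      \<subseteq> {(\<lambda>\<omega>. W t \<omega> - W s \<omega>) -` B \<inter> space M | B. B \<in> sets borel}"
    proof safe
      fix B :: "real set" assume B: "B \<in> sets borel"
      have "(\<lambda>x :: real ^ 2. x $ i) -` B \<in> sets borel"
        using measurable_sets[OF c B] by simp
      moreover have "(\<lambda>\<omega>. W t \<omega> $ i - W s \<omega> $ i) -` B \<inter> space M = (\<lambda>\<omega>. W t \<omega> - W s \<omega>) -` ((\<lambda>x. x $ i) -` B) \<inter> space M"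
        by auto
      ultimately show "\<exists>B'. (\<lambda>\<omega>. W t \<omega> $ i - W s \<omega> $ i) -` B \<inter> space M
          = (\<lambda>\<omega>. W t \<omega> - W s \<omega>) -` B' \<inter> space M \<and> B' \<in> sets borel" by blast
    qed
    ultimately show "indep_set (sets (F s)) {(\<lambda>\<omega>. W t \<omega> $ i - W s \<omega> $ i) -` B \<inter> space M | B. B \<in> sets borel}"
      unfolding indep_set_def
      by (elim indep_sets_mono_sets) (auto split: bool.split)
  qed
qed

text \<open>A law with a density charges no Lebesgue null set; the increment from 0 to
  \<open>T\<close> has one, and it equals \<open>W T\<close> almost surely.\<close>

lemma wiener_process_absolutely_continuous:
  assumes W: "wiener_process M F T Q W" and T: "T > 0" and N: "N \<in> null_sets lborel"
  shows "AE \<omega> in M. W T \<omega> \<notin> N"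
proof -
  note w = W[unfolded wiener_process_def]
  have D: "distributed M lborel (\<lambda>\<omega>. W T \<omega> - W 0 \<omega>) (\<lambda>x. ennreal (mvnormal_density ((T - 0) *\<^sub>R Q) x))"
    using w T by (metis order_refl)
  have "AE x in distr M lborel (\<lambda>\<omega>. W T \<omega> - W 0 \<omega>). x \<notin> N"
    unfolding distributed_distr_eq_density[OF D]
    using AE_not_in[OF N] by (subst AE_density[OF distributed_borel_measurable[OF D]]) auto
  then have "AE \<omega> in M. W T \<omega> - W 0 \<omega> \<notin> N"
    using distributed_measurable[OF D] by (rule AE_distrD[rotated])
  moreover have "AE \<omega> in M. W 0 \<omega> = 0" using w by simp
  ultimately show ?thesis by eventually_elim simp
qed

section \<open>Disintegration of an absolutely continuous pair and integrals over regions\<close>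

section \<open>Expectations as iterated integrals of conditional densities\<close>

lemma borel_measurable_pdf [measurable]: "pdf N X \<in> borel_measurable borel"
  unfolding pdf_def using borel_measurable_RN_deriv[of lborel] by simp

lemma sigma_finite_lborel: "sigma_finite_measure lborel" ..

lemma borel_measurable_cond_pdf: "cond_pdf N X Y y \<in> borel_measurable borel"
  unfolding cond_pdf_def
  by (intro borel_measurable_divide measurable_compose[OF _ borel_measurable_pdf]) auto

text \<open>Absolute continuity is phrased through null sets because this form passes directly along
  linear maps and to a measure with the same null sets; densities are then produced by
  Radon-Nikodym.\<close>

locale absolutely_continuous_pair = finite_measure N for N :: "'a measure" +
  fixes X Y :: "'a \<Rightarrow> real"
  assumes X [measurable]: "X \<in> borel_measurable N" and Y [measurable]: "Y \<in> borel_measurable N"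
    and null: "\<And>B. B \<in> null_sets lborel \<Longrightarrow> AE \<omega> in N. (X \<omega>, Y \<omega>) \<notin> B"
begin

abbreviation joint_law :: "(real \<times> real) measure" where
  "joint_law \<equiv> distr N lborel (\<lambda>\<omega>. (X \<omega>, Y \<omega>))"

abbreviation joint_pdf :: "real \<times> real \<Rightarrow> real" where
  "joint_pdf \<equiv> pdf N (\<lambda>\<omega>. (X \<omega>, Y \<omega>))"

lemma XY: "(\<lambda>\<omega>. (X \<omega>, Y \<omega>)) \<in> measurable N lborel"
  by (simp add: borel_prod[symmetric])

lemma absolutely_continuous_distr:
  assumes Z: "Z \<in> measurable N lborel" and "\<And>B. B \<in> null_sets lborel \<Longrightarrow> AE \<omega> in N. Z \<omega> \<notin> B"
  shows "absolutely_continuous lborel (distr N lborel Z)"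
  unfolding absolutely_continuous_def
proof
  fix B assume B: "B \<in> null_sets (lborel :: 'b::euclidean_space measure)"
  then have Bs: "B \<in> sets lborel" by (rule null_setsD2)
  have "emeasure N (Z -` B \<inter> space N) = 0"
    using assms(2)[OF B] measurable_sets[OF Z Bs] by (auto simp: AE_iff_measurable[OF _ refl] vimage_def Int_def conj_commute)
  then show "B \<in> null_sets (distr N lborel Z)"
    using Z Bs by (simp add: null_sets_def emeasure_distr)
qed

text \<open>\<open>pdf\<close> converts the Radon-Nikodym derivative to a real number, sending
  \<infinity> to 0. The law is a finite measure, so the derivative is finite almost everywhere and
  nothing is lost.\<close>

lemma density_pdf:
  assumes Z: "Z \<in> measurable N lborel" and ac: "absolutely_continuous lborel (distr N lborel Z)"
  shows "distr N lborel Z = density lborel (\<lambda>x. ennreal (pdf N Z x))"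
proof -
  have "finite_measure (distr N lborel Z)" using Z by (rule finite_measure_distr)
  then have "sigma_finite_measure (distr N lborel Z)" by (simp add: finite_measure_def)
  then have "AE x in lborel. RN_deriv lborel (distr N lborel Z) x \<noteq> \<infinity>"
    using ac by (intro sigma_finite_measure.RN_deriv_finite[OF sigma_finite_lborel]) auto
  then have "AE x in lborel. RN_deriv lborel (distr N lborel Z) x = ennreal (pdf N Z x)"
    by eventually_elim (simp add: pdf_def less_top)
  then have "density lborel (RN_deriv lborel (distr N lborel Z)) = density lborel (\<lambda>x. ennreal (pdf N Z x))"
    by (rule density_cong[rotated 2]) (use borel_measurable_pdf[of N Z] in auto)
  moreover have "distr N lborel Z = density lborel (RN_deriv lborel (distr N lborel Z))"
    using ac by (intro sigma_finite_measure.density_RN_deriv[OF sigma_finite_lborel, symmetric]) auto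
  ultimately show ?thesis by simp
qed

lemma joint_density: "joint_law = density lborel (\<lambda>z. ennreal (joint_pdf z))"
  by (intro density_pdf absolutely_continuous_distr XY null)

lemma null_Y:
  assumes B: "B \<in> null_sets (lborel :: real measure)"
  shows "AE \<omega> in N. Y \<omega> \<notin> B"
proof -
  have "UNIV \<times> B \<in> null_sets (lborel \<Otimes>\<^sub>M (lborel :: real measure))"
    using B by (intro null_setsI) (auto simp: lborel.emeasure_pair_measure_Times null_sets_def)
  then have "UNIV \<times> B \<in> null_sets (lborel :: (real \<times> real) measure)"
    by (simp add: lborel_prod)
  from null[OF this] show ?thesis by simp
qed

lemma pdf_nonneg [simp]: "0 \<le> pdf N Z x"
  by (simp add: pdf_def)

lemma measurable_joint: "joint_pdf \<in> borel_measurable (lborel \<Otimes>\<^sub>M lborel)"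
  by (simp add: lborel_prod)

text \<open>The integral of the joint density over \<open>x\<close> is a density of
  \<open>Y\<close>, hence agrees almost everywhere with \<open>pdf N Y\<close>. Where the latter is
  positive the quotient cancels; the remaining values of \<open>y\<close> need the argument
  below.\<close>

lemma cond_pdf_mult:
  "AE y in lborel. AE x in lborel. cond_pdf N X Y y x * pdf N Y y = joint_pdf (x, y)"
proof -
  let ?m = "\<lambda>y. \<integral>\<^sup>+x. ennreal (joint_pdf (x, y)) \<partial>lborel"
  have mj: "(\<lambda>z. ennreal (joint_pdf z)) \<in> borel_measurable (lborel \<Otimes>\<^sub>M lborel)"
    using measurable_joint by simp
  have m: "?m \<in> borel_measurable lborel"
    using lborel_pair.borel_measurable_nn_integral_fst lborel.borel_measurable_nn_integral[of "\<lambda>y x. ennreal (joint_pdf (x, y))" lborel]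
      measurable_compose[OF measurable_pair_swap' mj] by (simp add: case_prod_beta')
  have Yl: "Y \<in> measurable N lborel" by simp
  have "distr N lborel Y = density lborel ?m"
  proof (rule measure_eqI)
    fix A assume "A \<in> sets (distr N lborel Y)"
    then have A: "A \<in> sets borel" by simp
    have ind: "(\<lambda>z :: real \<times> real. indicator A (snd z) :: ennreal) \<in> borel_measurable (lborel \<Otimes>\<^sub>M lborel)"
      using A by (intro measurable_compose[OF measurable_snd]) auto
    have UA: "UNIV \<times> A \<in> sets (lborel :: (real \<times> real) measure)"
      using A pair_measureI[of UNIV "lborel :: real measure" A lborel] unfolding lborel_prod by simp
    have "emeasure (distr N lborel Y) A = emeasure joint_law (UNIV \<times> A)"
      using A UA XY by (simp add: emeasure_distr vimage_def)
    also have "\<dots> = (\<integral>\<^sup>+z. ennreal (joint_pdf z) * indicator (UNIV \<times> A) z \<partial>lborel)"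
      unfolding joint_density using UA by (subst emeasure_density) auto
    also have "\<dots> = (\<integral>\<^sup>+z. ennreal (joint_pdf z) * indicator A (snd z) \<partial>(lborel \<Otimes>\<^sub>M lborel))"
      by (intro arg_cong2[where f=nn_integral]) (auto simp: lborel_prod fun_eq_iff indicator_def)
    also have "\<dots> = (\<integral>\<^sup>+y. (\<integral>\<^sup>+x. ennreal (joint_pdf (x, y)) * indicator A y \<partial>lborel) \<partial>lborel)"
      by (subst lborel_pair.nn_integral_snd[symmetric]) (rule borel_measurable_times_ennreal[OF mj ind], simp)
    also have "\<dots> = (\<integral>\<^sup>+y. ?m y * indicator A y \<partial>lborel)"
      by (intro nn_integral_cong nn_integral_multc measurable_compose[OF measurable_Pair2' mj]) auto
    finally show "emeasure (distr N lborel Y) A = emeasure (density lborel ?m) A"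
      using A m by (simp add: emeasure_density)
  qed simp
  then have "AE y in lborel. ?m y = RN_deriv lborel (distr N lborel Y) y"
    using m by (intro sigma_finite_measure.RN_deriv_unique[OF sigma_finite_lborel]) auto
  moreover have "AE y in lborel. RN_deriv lborel (distr N lborel Y) y \<noteq> \<infinity>"
  proof (intro sigma_finite_measure.RN_deriv_finite[OF sigma_finite_lborel])
    have "finite_measure (distr N lborel Y)" using Yl by (rule finite_measure_distr)
    then show "sigma_finite_measure (distr N lborel Y)" by (simp add: finite_measure_def)
  qed (auto intro!: absolutely_continuous_distr null_Y)
  ultimately show ?thesis
  proof eventually_elim
    case (elim y)
    show ?case
    proof (cases "pdf N Y y = 0")
      \<comment> \<open>Division by zero makes the conditional density 0 here. This is consistent
        because a vanishing marginal forces the joint density to vanish for almost every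
        \<open>x\<close>.\<close>
      case True
      then have "?m y = 0"
        using elim by (simp add: pdf_def enn2real_eq_0_iff)
      then have "AE x in lborel. ennreal (joint_pdf (x, y)) = 0"
        using measurable_compose[OF measurable_Pair2' mj, of y] by (subst (asm) nn_integral_0_iff_AE) auto
      then show ?thesis
        by eventually_elim (use True in \<open>auto simp: cond_pdf_def ennreal_eq_0_iff intro: antisym\<close>)
    next
      case False
      then show ?thesis by (simp add: cond_pdf_def)
    qed
  qed
qed

lemma expectation_iterated:
  assumes g: "g \<in> borel_measurable borel" and int: "integrable N (\<lambda>\<omega>. g (X \<omega>, Y \<omega>))"
  shows "(\<integral>\<omega>. g (X \<omega>, Y \<omega>) \<partial>N)
    = (\<integral>y. (\<integral>x. g (x, y) * (cond_pdf N X Y y x * pdf N Y y) \<partial>lborel) \<partial>lborel)"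
proof -
  have gl: "g \<in> borel_measurable lborel" using g by simp
  have gp: "g \<in> borel_measurable (lborel \<Otimes>\<^sub>M lborel)" using g by (simp add: lborel_prod)
  have "integrable joint_law g"
    using int by (subst integrable_distr_eq[OF XY gl])
  then have int2: "integrable (lborel \<Otimes>\<^sub>M lborel) (\<lambda>z. joint_pdf z * g z)"
    unfolding joint_density using gl by (subst (asm) integrable_density) (auto simp: lborel_prod)
  have "(\<integral>\<omega>. g (X \<omega>, Y \<omega>) \<partial>N) = (\<integral>z. g z \<partial>joint_law)"
    using integral_distr[OF XY gl] by simp
  also have "\<dots> = (\<integral>z. joint_pdf z * g z \<partial>(lborel \<Otimes>\<^sub>M lborel))"
    unfolding joint_density using gl by (subst integral_density) (auto simp: lborel_prod)
  also have "\<dots> = (\<integral>y. (\<integral>x. joint_pdf (x, y) * g (x, y) \<partial>lborel) \<partial>lborel)"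
    using lborel_pair.integral_snd[of "\<lambda>x y. joint_pdf (x, y) * g (x, y)"] int2
    by (simp add: case_prod_beta')
  also have "\<dots> = (\<integral>y. (\<integral>x. g (x, y) * (cond_pdf N X Y y x * pdf N Y y) \<partial>lborel) \<partial>lborel)"
  proof (rule integral_cong_AE)
    have inner: "(\<lambda>x. joint_pdf (x, y)) \<in> borel_measurable lborel" "(\<lambda>x. g (x, y)) \<in> borel_measurable lborel" for y
      using measurable_compose[OF measurable_Pair2' measurable_joint, of y]
        measurable_compose[OF measurable_Pair2' gp, of y] by auto
    have sw: "(\<lambda>z. joint_pdf (snd z, fst z)) \<in> borel_measurable (lborel \<Otimes>\<^sub>M lborel)"
        "(\<lambda>z. g (snd z, fst z)) \<in> borel_measurable (lborel \<Otimes>\<^sub>M lborel)"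
      using measurable_compose[OF measurable_pair_swap' measurable_joint] measurable_compose[OF measurable_pair_swap' gp]
      by (simp_all add: case_prod_beta')
    have pY: "(\<lambda>z :: real \<times> real. pdf N Y (fst z)) \<in> borel_measurable (lborel \<Otimes>\<^sub>M lborel)"
      by (intro measurable_compose[OF measurable_fst]) simp
    show "(\<lambda>y. \<integral>x. joint_pdf (x, y) * g (x, y) \<partial>lborel) \<in> borel_measurable lborel"
      using sw by (intro lborel.borel_measurable_lebesgue_integral) (simp add: case_prod_beta')
    show "(\<lambda>y. \<integral>x. g (x, y) * (cond_pdf N X Y y x * pdf N Y y) \<partial>lborel) \<in> borel_measurable lborel"
      using sw pY unfolding cond_pdf_def
      by (intro lborel.borel_measurable_lebesgue_integral) (simp add: case_prod_beta')
    show "AE y in lborel. (\<integral>x. joint_pdf (x, y) * g (x, y) \<partial>lborel)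
        = (\<integral>x. g (x, y) * (cond_pdf N X Y y x * pdf N Y y) \<partial>lborel)"
      using cond_pdf_mult
    proof eventually_elim
      case (elim y)
      show ?case
      proof (rule integral_cong_AE)
        show "(\<lambda>x. joint_pdf (x, y) * g (x, y)) \<in> borel_measurable lborel"
          using inner[of y] by simp
        show "(\<lambda>x. g (x, y) * (cond_pdf N X Y y x * pdf N Y y)) \<in> borel_measurable lborel"
          using inner(2)[of y] borel_measurable_cond_pdf[of N X Y y] by simp
        show "AE x in lborel. joint_pdf (x, y) * g (x, y) = g (x, y) * (cond_pdf N X Y y x * pdf N Y y)"
          using elim by eventually_elim simp
      qed
    qed
  qed
  finally show ?thesis .
qed

text \<open>\<open>LBINT\<close> is an oriented integral, so \<open>a y \<le> c y\<close> fixes the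
  sign. Its domain is an open interval with possibly infinite ends, hence the strict inequalities on
  the right. Integrability is asked only of the truncated function, since \<open>E\<close> alone may
  grow too fast.\<close>

lemma region_integral:
  fixes d :: real and a c :: "real \<Rightarrow> ereal" and E :: "real \<Rightarrow> real \<Rightarrow> real"
  assumes le: "\<And>y. d < y \<Longrightarrow> a y \<le> c y"
    and a: "a \<in> borel_measurable borel" and c: "c \<in> borel_measurable borel"
    and E: "(\<lambda>z. E (fst z) (snd z)) \<in> borel_measurable borel"
    and int: "integrable N (\<lambda>\<omega>. if d < Y \<omega> \<and> a (Y \<omega>) < ereal (X \<omega>) \<and> ereal (X \<omega>) < c (Y \<omega>) then E (X \<omega>) (Y \<omega>) else 0)"
  shows "(LBINT y=ereal d..\<infinity>. (LBINT x=a y..c y. E x y * cond_pdf N X Y y x * pdf N Y y))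
    = (\<integral>\<omega>. (if d < Y \<omega> \<and> a (Y \<omega>) < ereal (X \<omega>) \<and> ereal (X \<omega>) < c (Y \<omega>) then E (X \<omega>) (Y \<omega>) else 0) \<partial>N)"
proof -
  define g where "g z = (if d < snd z \<and> a (snd z) < ereal (fst z) \<and> ereal (fst z) < c (snd z) then E (fst z) (snd z) else 0)" for z
  have [measurable]: "(fst :: real \<times> real \<Rightarrow> real) \<in> borel_measurable borel" "(snd :: real \<times> real \<Rightarrow> real) \<in> borel_measurable borel"
    by (auto simp: borel_prod[symmetric])
  have [measurable]: "(\<lambda>z. a (snd z)) \<in> borel_measurable (borel :: (real \<times> real) measure)"
     "(\<lambda>z. c (snd z)) \<in> borel_measurable (borel :: (real \<times> real) measure)"
    using a c by measurable
  note [measurable] = E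
  have g: "g \<in> borel_measurable borel"
    unfolding g_def by measurable
  have "(LBINT y=ereal d..\<infinity>. (LBINT x=a y..c y. E x y * cond_pdf N X Y y x * pdf N Y y))
    = (\<integral>y. indicator {d<..} y *\<^sub>R (LBINT x=a y..c y. E x y * cond_pdf N X Y y x * pdf N Y y) \<partial>lborel)"
    by (simp add: interval_lebesgue_integral_def set_lebesgue_integral_def)
  also have "\<dots> = (\<integral>y. (\<integral>x. g (x, y) * (cond_pdf N X Y y x * pdf N Y y) \<partial>lborel) \<partial>lborel)"
  proof (rule Bochner_Integration.integral_cong[OF refl])
    fix y
    show "indicator {d<..} y *\<^sub>R (LBINT x=a y..c y. E x y * cond_pdf N X Y y x * pdf N Y y)
      = (\<integral>x. g (x, y) * (cond_pdf N X Y y x * pdf N Y y) \<partial>lborel)"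
    proof (cases "d < y")
      case True
      have "indicator {d<..} y *\<^sub>R (LBINT x=a y..c y. E x y * cond_pdf N X Y y x * pdf N Y y)
        = (\<integral>x. indicator (einterval (a y) (c y)) x *\<^sub>R (E x y * cond_pdf N X Y y x * pdf N Y y) \<partial>lborel)"
        unfolding interval_lebesgue_integral_def set_lebesgue_integral_def using True le[OF True] by simp
      also have "\<dots> = (\<integral>x. g (x, y) * (cond_pdf N X Y y x * pdf N Y y) \<partial>lborel)"
        by (rule Bochner_Integration.integral_cong) (use True in \<open>auto simp: g_def einterval_def indicator_def\<close>)
      finally show ?thesis .
    next
      case False
      then show ?thesis by (simp add: g_def)
    qed
  qed
  also have "\<dots> = (\<integral>\<omega>. g (X \<omega>, Y \<omega>) \<partial>N)"
    using int by (intro expectation_iterated[symmetric] g) (simp add: g_def cong: if_cong)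
  finally show ?thesis by (simp add: g_def cong: if_cong)
qed

text \<open>For fixed \<open>y\<close> the section of the graph has at most one point, so Fubini
  makes the graph a null set. The open regions below and above \<open>X = v Y\<close> thus lose no
  mass.\<close>

lemma AE_neq_graph:
  assumes v: "v \<in> borel_measurable (borel :: real measure)"
  shows "AE \<omega> in N. ereal (X \<omega>) \<noteq> v (Y \<omega>)"
proof -
  define B where "B = {z :: real \<times> real. ereal (fst z) = v (snd z)}"
  have [measurable]: "(fst :: real \<times> real \<Rightarrow> real) \<in> borel_measurable borel" "(snd :: real \<times> real \<Rightarrow> real) \<in> borel_measurable borel"
    by (auto simp: borel_prod[symmetric])
  have [measurable]: "(\<lambda>z. v (snd z)) \<in> borel_measurable (borel :: (real \<times> real) measure)"
    using v by measurable
  have "{z \<in> space (borel :: (real \<times> real) measure). ereal (fst z) = v (snd z)} \<in> sets borel"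
    by measurable
  then have B': "B \<in> sets (lborel :: (real \<times> real) measure)" by (simp add: B_def)
  then have B: "B \<in> sets (lborel \<Otimes>\<^sub>M lborel)" by (simp only: lborel_prod)
  have "emeasure lborel ((\<lambda>x. (x, y)) -` B) = 0" for y
  proof -
    have "(\<lambda>x. (x, y)) -` B \<subseteq> {real_of_ereal (v y)}" by (auto simp: B_def) (metis real_of_ereal.simps(1))
    then have "emeasure lborel ((\<lambda>x. (x, y)) -` B) \<le> emeasure lborel {real_of_ereal (v y)}"
      by (rule emeasure_mono) simp
    then show ?thesis by simp
  qed
  then have "emeasure (lborel \<Otimes>\<^sub>M lborel) B = 0"
    by (subst lborel_pair.emeasure_pair_measure_alt2[OF B]) simp
  then have "B \<in> null_sets lborel" using B' by (intro null_setsI) (simp_all add: lborel_prod)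
  from null[OF this] show ?thesis by (simp add: B_def)
qed

end

section \<open>From conditions on the payoff to regions in the (X, Y) plane\<close>

section \<open>The risk auxiliary functions of the quanto option\<close>

lemma borel_measurable_ln_ext: "ln_ext \<in> borel_measurable borel"
  unfolding ln_ext_def[abs_def] by measurable

text \<open>The two formulas are instances of one computation: \<open>(N, U, a, \<beta>)\<close> is \<open>(M, W T, \<alpha>, B)\<close> in the
  first and \<open>(Mt, Wt T, (r, r), Bt)\<close> in the second; \<open>N\<close> need not be a probability measure.\<close>

locale quanto = absolutely_continuous_pair N X Y for N :: "'a measure" and X Y +
  fixes U1 U2 S1 S2 Z H :: "'a \<Rightarrow> real"
    and T a1 a2 \<mu> \<sigma>1 \<sigma>2 S10 S20 K p c A1 A2 \<beta> k1 k2 k3 k4 d :: real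
    and v :: "real \<Rightarrow> ereal"
  assumes U: "U1 \<in> borel_measurable N" "U2 \<in> borel_measurable N"
    and exp_integrable: "\<And>u w. integrable N (\<lambda>\<omega>. exp (u * U1 \<omega> + w * U2 \<omega>))"
    and params: "S10 > 0" "S20 > 0" "K > 0" "p > 1" "c \<ge> 0"
    and \<mu>: "\<mu> = a1 + a2"
    and S1: "AE \<omega> in N. S1 \<omega> = S10 * exp ((a1 - 1 / 2 * \<sigma>1\<^sup>2) * T + \<sigma>1 * U1 \<omega>)"
    and S2: "AE \<omega> in N. S2 \<omega> = S20 * exp ((a2 - 1 / 2 * \<sigma>2\<^sup>2) * T + \<sigma>2 * U2 \<omega>)"
    and Z: "\<And>\<omega>. Z \<omega> = exp (- A1 * U1 \<omega> - A2 * U2 \<omega> - \<beta> * T)"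
    and X_def: "\<And>\<omega>. X \<omega> = A1 / (p - 1) * U1 \<omega> + (A2 / (p - 1) - \<sigma>2) * U2 \<omega>"
    and Y_def: "\<And>\<omega>. Y \<omega> = \<sigma>1 * U1 \<omega> + \<sigma>2 * U2 \<omega>"
    and k: "AE \<omega> in N. U1 \<omega> = k1 * X \<omega> + k2 * Y \<omega>" "AE \<omega> in N. U2 \<omega> = k3 * X \<omega> + k4 * Y \<omega>"
    and H: "H = (\<lambda>\<omega>. max 0 (S1 \<omega> - K / S2 \<omega>))"
    and H_measurable: "H \<in> borel_measurable N"
    and d: "d = ln (K / (S10 * S20)) - (\<mu> - 1 / 2 * (\<sigma>1\<^sup>2 + \<sigma>2\<^sup>2)) * T"
    and v: "v = (\<lambda>x. ln_ext
              (c powr (1 / (p - 1)) * S20 * exp ((a2 - 1 / 2 * \<sigma>2\<^sup>2 - \<beta> / (p - 1)) * T)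
               / (S10 * S20 * exp ((\<mu> - 1 / 2 * (\<sigma>1\<^sup>2 + \<sigma>2\<^sup>2)) * T + x) - K)))"
begin

text \<open>The option value before taking the positive part, in the coordinates
  \<open>(X, Y)\<close>.\<close>

definition payoff :: "real \<Rightarrow> real \<Rightarrow> real" where
  "payoff x y = S10 * exp ((a1 - 1 / 2 * \<sigma>1\<^sup>2) * T + \<sigma>1 * (k1 * x + k2 * y))
     - K / (S20 * exp ((a2 - 1 / 2 * \<sigma>2\<^sup>2) * T + \<sigma>2 * (k3 * x + k4 * y)))"

text \<open>\<open>(c * Z) powr (1 / (p - 1))\<close> in the coordinates \<open>(X, Y)\<close>: on
  \<open>{H > 0}\<close> the part of the claim left uncovered by \<open>risk_phi\<close> is the
  minimum of this level and \<open>H\<close>.\<close>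

definition level :: "real \<Rightarrow> real \<Rightarrow> real" where
  "level x y = c powr (1 / (p - 1)) * exp (- (\<beta> * T) / (p - 1))
     * exp (- A1 / (p - 1) * (k1 * x + k2 * y) - A2 / (p - 1) * (k3 * x + k4 * y))"

lemma v_measurable: "v \<in> borel_measurable borel"
  unfolding v by (intro measurable_compose[OF _ borel_measurable_ln_ext]) measurable

lemma payoff_measurable: "(\<lambda>z. payoff (fst z) (snd z)) \<in> borel_measurable borel"
  unfolding payoff_def borel_prod[symmetric] by measurable

lemma exponential_measurable:
  "(\<lambda>z. exp (a * (k1 * fst z + k2 * snd z) - b * (k3 * fst z + k4 * snd z)) :: real) \<in> borel_measurable borel"
  unfolding borel_prod[symmetric] by measurable

text \<open>The free exponent \<open>q\<close> covers both uses: \<open>q = 1\<close> is the level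
  itself and \<open>q = p\<close> its p-th power, which enters the loss.\<close>

lemma level_powr: "(c * Z \<omega>) powr (q / (p - 1)) = c powr (q / (p - 1)) * exp (- (q * \<beta> * T) / (p - 1))
     * exp (- (q * A1) / (p - 1) * U1 \<omega> - q * A2 / (p - 1) * U2 \<omega>)"
proof -
  have "Z \<omega> powr (q / (p - 1)) = exp (- (q * \<beta> * T) / (p - 1) + (- (q * A1) / (p - 1) * U1 \<omega> - q * A2 / (p - 1) * U2 \<omega>))"
    unfolding Z powr_def using params(4) by (simp add: divide_simps) (simp add: algebra_simps)
  then show ?thesis
    using params(5) by (simp add: powr_mult Z exp_add[symmetric])
qed

text \<open>\<open>S1 * S2\<close> depends on \<open>Y\<close> alone, and \<open>level\<close> times
  \<open>S2\<close> is a constant times \<open>exp (- X)\<close>; multiplying payoff and level by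
  \<open>S2\<close> therefore turns their comparison into one between \<open>X\<close> and
  \<open>v Y\<close>. The bound by \<open>S1\<close> is recorded for domination.\<close>

lemma AE_pointwise:
  "AE \<omega> in N. H \<omega> = (if d < Y \<omega> then payoff (X \<omega>) (Y \<omega>) else 0) \<and>
     (c * Z \<omega>) powr (1 / (p - 1)) = level (X \<omega>) (Y \<omega>) \<and>
     (d < Y \<omega> \<longrightarrow> 0 < payoff (X \<omega>) (Y \<omega>) \<and> payoff (X \<omega>) (Y \<omega>) \<le> S1 \<omega> \<and>
       (ereal (X \<omega>) < v (Y \<omega>) \<longleftrightarrow> payoff (X \<omega>) (Y \<omega>) < level (X \<omega>) (Y \<omega>)) \<and>
       (v (Y \<omega>) < ereal (X \<omega>) \<longleftrightarrow> level (X \<omega>) (Y \<omega>) < payoff (X \<omega>) (Y \<omega>)))"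
  using S1 S2 k
proof eventually_elim
  case (elim \<omega>)
  define x y u w where "x = X \<omega>" and "y = Y \<omega>" and "u = U1 \<omega>" and "w = U2 \<omega>"
  define m where "m = (\<mu> - 1 / 2 * (\<sigma>1\<^sup>2 + \<sigma>2\<^sup>2)) * T"
  define s1 s2 where "s1 = S1 \<omega>" and "s2 = S2 \<omega>"
  have s1: "s1 = S10 * exp ((a1 - 1 / 2 * \<sigma>1\<^sup>2) * T + \<sigma>1 * u)"
    and s2: "s2 = S20 * exp ((a2 - 1 / 2 * \<sigma>2\<^sup>2) * T + \<sigma>2 * w)"
    using elim by (simp_all add: s1_def s2_def u_def w_def)
  have uw: "u = k1 * x + k2 * y" "w = k3 * x + k4 * y"
    using elim by (simp_all add: u_def w_def x_def y_def)
  have x: "x = A1 / (p - 1) * u + (A2 / (p - 1) - \<sigma>2) * w" and y: "y = \<sigma>1 * u + \<sigma>2 * w"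
    by (simp_all add: x_def y_def u_def w_def X_def Y_def)
  have pos: "s1 > 0" "s2 > 0" using params by (simp_all add: s1 s2)
  have payoff: "payoff x y = s1 - K / s2"
    by (simp add: payoff_def s1 s2 uw)
  have prod: "s1 * s2 = S10 * S20 * exp (m + y)"
  proof -
    have "(a1 - 1 / 2 * \<sigma>1\<^sup>2) * T + \<sigma>1 * u + ((a2 - 1 / 2 * \<sigma>2\<^sup>2) * T + \<sigma>2 * w) = m + y"
      by (simp add: m_def y \<mu> algebra_simps)
    then have "exp (m + y) = exp ((a1 - 1 / 2 * \<sigma>1\<^sup>2) * T + \<sigma>1 * u) * exp ((a2 - 1 / 2 * \<sigma>2\<^sup>2) * T + \<sigma>2 * w)"
      by (simp only: exp_add[symmetric])
    then show ?thesis by (simp add: s1 s2)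
  qed
  have lvl: "(c * Z \<omega>) powr (1 / (p - 1)) = level x y"
    using level_powr[of \<omega> 1] by (simp add: level_def uw[symmetric] u_def w_def)
  have iff_d: "d < y \<longleftrightarrow> K < s1 * s2"
  proof -
    have "d < y \<longleftrightarrow> ln (K / (S10 * S20)) < m + y"
      by (auto simp: d m_def)
    also have "\<dots> \<longleftrightarrow> K / (S10 * S20) < exp (m + y)"
      using params by (subst exp_less_cancel_iff[symmetric]) simp
    also have "\<dots> \<longleftrightarrow> K < s1 * s2"
      unfolding prod using params by (simp add: divide_simps mult.commute)
    finally show ?thesis .
  qed
  have H': "H \<omega> = (if d < y then payoff x y else 0)"
  proof -
    have "H \<omega> = max 0 (s1 - K / s2)" by (simp add: H s1_def s2_def)
    moreover have "0 < s1 - K / s2 \<longleftrightarrow> d < y"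
      using pos by (simp add: iff_d divide_simps)
    ultimately show ?thesis by (auto simp: payoff max_def)
  qed
  have "0 < payoff x y \<and> payoff x y \<le> s1 \<and> (ereal x < v y \<longleftrightarrow> payoff x y < level x y)
       \<and> (v y < ereal x \<longleftrightarrow> level x y < payoff x y)" if dy: "d < y"
  proof -
    have h: "payoff x y > 0" using dy pos by (simp add: payoff iff_d divide_simps)
    have le: "payoff x y \<le> s1" using pos params by (simp add: payoff)
    \<comment> \<open>\<open>E\<close> is \<open>S1 * S2 - K\<close>, the denominator in
      \<open>v\<close>. It is positive for \<open>d < y\<close>, where alone the logarithm has its
      intended meaning.\<close>
    define E where "E = S10 * S20 * exp (m + y) - K"
    have E: "E = payoff x y * s2"
      unfolding E_def prod[symmetric] payoff using pos by (simp add: left_diff_distrib)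
    then have E0: "E > 0" using h pos by simp
    define c' where "c' = c powr (1 / (p - 1))"
    define n where "n = c' * S20 * exp ((a2 - 1 / 2 * \<sigma>2\<^sup>2 - \<beta> / (p - 1)) * T)"
    have vy: "v y = ln_ext (n / E)"
      by (simp add: v n_def E_def m_def c'_def)
    \<comment> \<open>\<open>D\<close> is \<open>exp x * s2\<close>, where the coefficient
      \<open>- \<sigma>2\<close> in \<open>X\<close> cancels the volatility of the second stock.
      Multiplied by \<open>level\<close> it loses all randomness and becomes the numerator
      \<open>n\<close> of \<open>v\<close>.\<close>
    define D where "D = exp (A1 / (p - 1) * u + A2 / (p - 1) * w) * (S20 * exp ((a2 - 1 / 2 * \<sigma>2\<^sup>2) * T))"
    have D0: "D > 0" using params by (simp add: D_def)
    have xs2: "exp x * s2 = D"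
    proof -
      have "x + ((a2 - 1 / 2 * \<sigma>2\<^sup>2) * T + \<sigma>2 * w) = (A1 / (p - 1) * u + A2 / (p - 1) * w) + (a2 - 1 / 2 * \<sigma>2\<^sup>2) * T"
        by (simp add: x algebra_simps)
      then have "exp x * exp ((a2 - 1 / 2 * \<sigma>2\<^sup>2) * T + \<sigma>2 * w)
        = exp (A1 / (p - 1) * u + A2 / (p - 1) * w) * exp ((a2 - 1 / 2 * \<sigma>2\<^sup>2) * T)"
        by (simp only: exp_add[symmetric])
      then show ?thesis by (simp add: s2 D_def)
    qed
    have nD: "n = level x y * D"
    proof -
      have "- (\<beta> * T) / (p - 1) + (- A1 / (p - 1) * u - A2 / (p - 1) * w)
        + ((A1 / (p - 1) * u + A2 / (p - 1) * w) + (a2 - 1 / 2 * \<sigma>2\<^sup>2) * T) = (a2 - 1 / 2 * \<sigma>2\<^sup>2 - \<beta> / (p - 1)) * T"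
        by (simp add: algebra_simps)
      then have "exp ((a2 - 1 / 2 * \<sigma>2\<^sup>2 - \<beta> / (p - 1)) * T) = exp (- (\<beta> * T) / (p - 1)) * exp (- A1 / (p - 1) * u - A2 / (p - 1) * w)
        * (exp (A1 / (p - 1) * u + A2 / (p - 1) * w) * exp ((a2 - 1 / 2 * \<sigma>2\<^sup>2) * T))"
        by (simp only: exp_add[symmetric])
      then show ?thesis
        unfolding n_def D_def level_def uw[symmetric] c'_def by (simp only: ac_simps)
    qed
    have xE: "exp x * E = payoff x y * D"
      using xs2 by (simp add: E mult.left_commute)
    show ?thesis
    proof (cases "n = 0")
      \<comment> \<open>This is \<open>c = 0\<close>: then \<open>v y\<close> is
        \<open>- \<infinity>\<close> by the convention for the logarithm of 0 and the level is 0, so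
        every point lies above the curve, in agreement with a positive payoff.\<close>
      case True
      then have "level x y = 0" using nD D0 by simp
      then show ?thesis using h le by (simp add: vy True ln_ext_def)
    next
      case False
      have "n \<ge> 0" using params by (simp add: n_def c'_def)
      with False have R: "n / E > 0" using E0 by simp
      have vR: "v y = ereal (ln (n / E))" using False E0 by (simp add: vy ln_ext_def)
      have "x < ln (n / E) \<longleftrightarrow> exp x < n / E"
        using R by (metis exp_less_cancel_iff exp_ln)
      also have "\<dots> \<longleftrightarrow> exp x * E < n" using E0 by (simp add: pos_less_divide_eq)
      also have "\<dots> \<longleftrightarrow> payoff x y < level x y" unfolding xE nD using D0 by simp
      finally have 1: "x < ln (n / E) \<longleftrightarrow> payoff x y < level x y" .
      have "ln (n / E) < x \<longleftrightarrow> n / E < exp x"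
        using R by (metis exp_less_cancel_iff exp_ln)
      also have "\<dots> \<longleftrightarrow> n < exp x * E" using E0 by (simp add: pos_divide_less_eq)
      also have "\<dots> \<longleftrightarrow> level x y < payoff x y" unfolding xE nD using D0 by simp
      finally show ?thesis using 1 h le by (simp add: vR)
    qed
  qed
  then show ?case
    using H' lvl by (simp add: x_def y_def s1_def)
qed

lemma region_measurable:
  assumes "(\<lambda>z. E (fst z) (snd z)) \<in> borel_measurable borel"
  shows "(\<lambda>\<omega>. if d < Y \<omega> \<and> ereal (X \<omega>) < v (Y \<omega>) then E (X \<omega>) (Y \<omega>) else 0 :: real) \<in> borel_measurable N"
    and "(\<lambda>\<omega>. if d < Y \<omega> \<and> v (Y \<omega>) < ereal (X \<omega>) then E (X \<omega>) (Y \<omega>) else 0 :: real) \<in> borel_measurable N"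
proof -
  note v_measurable [measurable]
  have [measurable]: "(\<lambda>\<omega>. E (X \<omega>) (Y \<omega>)) \<in> borel_measurable N"
    using measurable_compose[OF _ assms, of "\<lambda>\<omega>. (X \<omega>, Y \<omega>)" N] by (simp add: borel_prod[symmetric])
  show "(\<lambda>\<omega>. if d < Y \<omega> \<and> ereal (X \<omega>) < v (Y \<omega>) then E (X \<omega>) (Y \<omega>) else 0 :: real) \<in> borel_measurable N"
    "(\<lambda>\<omega>. if d < Y \<omega> \<and> v (Y \<omega>) < ereal (X \<omega>) then E (X \<omega>) (Y \<omega>) else 0 :: real) \<in> borel_measurable N"
    by measurable
qed

lemma region_integral_below:
  assumes E: "(\<lambda>z. E (fst z) (snd z)) \<in> borel_measurable borel"
    and int: "integrable N (\<lambda>\<omega>. if d < Y \<omega> \<and> ereal (X \<omega>) < v (Y \<omega>) then E (X \<omega>) (Y \<omega>) else 0 :: real)"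
  shows "(LBINT y=ereal d..\<infinity>. (LBINT x=-\<infinity>..v y. E x y * cond_pdf N X Y y x * pdf N Y y))
    = (\<integral>\<omega>. (if d < Y \<omega> \<and> ereal (X \<omega>) < v (Y \<omega>) then E (X \<omega>) (Y \<omega>) else 0) \<partial>N)"
  using region_integral[of d "\<lambda>_. - \<infinity>" v E] E int v_measurable by simp

lemma region_integral_above:
  assumes E: "(\<lambda>z. E (fst z) (snd z)) \<in> borel_measurable borel"
    and int: "integrable N (\<lambda>\<omega>. if d < Y \<omega> \<and> v (Y \<omega>) < ereal (X \<omega>) then E (X \<omega>) (Y \<omega>) else 0 :: real)"
  shows "(LBINT y=ereal d..\<infinity>. (LBINT x=v y..\<infinity>. E x y * cond_pdf N X Y y x * pdf N Y y))
    = (\<integral>\<omega>. (if d < Y \<omega> \<and> v (Y \<omega>) < ereal (X \<omega>) then E (X \<omega>) (Y \<omega>) else 0) \<partial>N)"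
  using region_integral[of d v "\<lambda>_. \<infinity>" E] E int v_measurable by simp

text \<open>On \<open>{H > 0}\<close> the uncovered claim is the minimum of \<open>H\<close> and the
  level: the payoff below the curve \<open>X = v Y\<close>, the level above it. The p-th power of
  the level is a constant \<open>C\<close> times an exponential, which produces the prefactor of the
  second integral.\<close>

lemma risk_Psi1_eq:
  "risk_Psi1 N p Z H c =
       1 / p * (LBINT y=ereal d..\<infinity>. (LBINT x=-\<infinity>..v y. payoff x y powr p * cond_pdf N X Y y x * pdf N Y y))
       + 1 / p * c powr (p / (p - 1)) * exp (- (p * \<beta> * T) / (p - 1)) *
         (LBINT y=ereal d..\<infinity>. (LBINT x=v y..\<infinity>.
            exp (- (p * A1) / (p - 1) * (k1 * x + k2 * y) - p * A2 / (p - 1) * (k3 * x + k4 * y))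
            * cond_pdf N X Y y x * pdf N Y y))"
proof -
  let ?e = "\<lambda>x y. exp (- (p * A1) / (p - 1) * (k1 * x + k2 * y) - p * A2 / (p - 1) * (k3 * x + k4 * y))"
  define C where "C = c powr (p / (p - 1)) * exp (- (p * \<beta> * T) / (p - 1))"
  define f1 where "f1 \<omega> = (if d < Y \<omega> \<and> ereal (X \<omega>) < v (Y \<omega>) then payoff (X \<omega>) (Y \<omega>) powr p else 0)" for \<omega>
  define f2 where "f2 \<omega> = (if d < Y \<omega> \<and> v (Y \<omega>) < ereal (X \<omega>) then ?e (X \<omega>) (Y \<omega>) else 0)" for \<omega>
  have pm: "(\<lambda>z. payoff (fst z) (snd z) powr p) \<in> borel_measurable borel"
    using payoff_measurable by measurable
  note em = exponential_measurable[of "- (p * A1) / (p - 1)" "p * A2 / (p - 1)"]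
  have f1m: "f1 \<in> borel_measurable N" and f2m: "f2 \<in> borel_measurable N"
    unfolding f1_def f2_def by (rule region_measurable[OF pm] region_measurable[OF em])+
  have C0: "C \<ge> 0" using params by (simp add: C_def)
  have lp: "AE \<omega> in N. level (X \<omega>) (Y \<omega>) powr p = C * exp (- (p * A1) / (p - 1) * U1 \<omega> + - (p * A2 / (p - 1)) * U2 \<omega>)
      \<and> level (X \<omega>) (Y \<omega>) powr p = C * ?e (X \<omega>) (Y \<omega>)"
    using AE_pointwise k
  proof eventually_elim
    case (elim \<omega>)
    have "level (X \<omega>) (Y \<omega>) powr p = ((c * Z \<omega>) powr (1 / (p - 1))) powr p" using elim by simp
    also have "\<dots> = (c * Z \<omega>) powr (p / (p - 1))" by (simp add: powr_powr)
    also have "\<dots> = C * exp (- (p * A1) / (p - 1) * U1 \<omega> - p * A2 / (p - 1) * U2 \<omega>)"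
      unfolding C_def by (rule level_powr)
    finally show ?case using elim by simp
  qed
  have dom: "integrable N (\<lambda>\<omega>. C * exp (- (p * A1) / (p - 1) * U1 \<omega> + - (p * A2 / (p - 1)) * U2 \<omega>))"
    by (intro integrable_mult_right exp_integrable)
  \<comment> \<open>Below the curve the payoff is smaller than the level, so its p-th power is
    dominated by one exponential of \<open>U1\<close> and \<open>U2\<close>.\<close>
  have i1: "integrable N f1"
  proof (rule Bochner_Integration.integrable_bound[OF dom f1m])
    show "AE \<omega> in N. norm (f1 \<omega>) \<le> norm (C * exp (- (p * A1) / (p - 1) * U1 \<omega> + - (p * A2 / (p - 1)) * U2 \<omega>))"
      using AE_pointwise lp
    proof eventually_elim
      case (elim \<omega>)
      have "f1 \<omega> \<le> level (X \<omega>) (Y \<omega>) powr p"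
      proof (cases "d < Y \<omega> \<and> ereal (X \<omega>) < v (Y \<omega>)")
        case True
        then have "0 < payoff (X \<omega>) (Y \<omega>)" "payoff (X \<omega>) (Y \<omega>) < level (X \<omega>) (Y \<omega>)"
          using elim(1) by auto
        then have "payoff (X \<omega>) (Y \<omega>) powr p \<le> level (X \<omega>) (Y \<omega>) powr p"
          using params(4) by (intro powr_mono2) auto
        then show ?thesis using True by (simp add: f1_def)
      next
        case False
        then have "f1 \<omega> = 0" unfolding f1_def by (rule if_not_P)
        then show ?thesis by simp
      qed
      moreover have "0 \<le> f1 \<omega>" by (simp add: f1_def)
      ultimately have "norm (f1 \<omega>) \<le> level (X \<omega>) (Y \<omega>) powr p" by simp
      also have "\<dots> \<le> norm (C * exp (- (p * A1) / (p - 1) * U1 \<omega> + - (p * A2 / (p - 1)) * U2 \<omega>))"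
        unfolding conjunct1[OF elim(2)] by simp
      finally show ?case .
    qed
  qed
  have i2: "integrable N f2"
  proof (rule Bochner_Integration.integrable_bound[OF _ f2m])
    show "integrable N (\<lambda>\<omega>. exp (- (p * A1) / (p - 1) * U1 \<omega> + - (p * A2 / (p - 1)) * U2 \<omega>))"
      by (rule exp_integrable)
    show "AE \<omega> in N. norm (f2 \<omega>) \<le> norm (exp (- (p * A1) / (p - 1) * U1 \<omega> + - (p * A2 / (p - 1)) * U2 \<omega>))"
      using k by eventually_elim (simp add: f2_def)
  qed
  have int: "(\<integral>\<omega>. ((1 - risk_phi p c Z H \<omega>) * H \<omega>) powr p \<partial>N) = (\<integral>\<omega>. f1 \<omega> + C * f2 \<omega> \<partial>N)"
  proof (rule integral_cong_AE)
    show "(\<lambda>\<omega>. f1 \<omega> + C * f2 \<omega>) \<in> borel_measurable N" using f1m f2m by measurable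
    have "Z \<in> borel_measurable N" unfolding Z[abs_def] using U by measurable
    then have "risk_phi p c Z H \<in> borel_measurable N"
      unfolding risk_phi_def[abs_def] using H_measurable by (simp add: indicator_def) measurable
    then show "(\<lambda>\<omega>. ((1 - risk_phi p c Z H \<omega>) * H \<omega>) powr p) \<in> borel_measurable N"
      using H_measurable by measurable
    show "AE \<omega> in N. ((1 - risk_phi p c Z H \<omega>) * H \<omega>) powr p = f1 \<omega> + C * f2 \<omega>"
      using AE_pointwise lp AE_neq_graph[OF v_measurable]
    proof eventually_elim
      case (elim \<omega>)
      show ?case
      proof (cases "d < Y \<omega>")
        case False
        then show ?thesis using elim by (simp add: f1_def f2_def)
      next
        case True
        let ?h = "payoff (X \<omega>) (Y \<omega>)" and ?q = "level (X \<omega>) (Y \<omega>)"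
        have h: "?h > 0" "H \<omega> = ?h" using elim True by auto
        \<comment> \<open>With \<open>H > 0\<close>, multiplying \<open>min (q / H) 1\<close> by
          \<open>H\<close> gives the minimum of \<open>q\<close> and \<open>H\<close>.\<close>
        have m: "(1 - risk_phi p c Z H \<omega>) * H \<omega> = min ?q ?h"
          using elim True h by (auto simp: risk_phi_def min_def field_simps)
        consider "ereal (X \<omega>) < v (Y \<omega>)" | "v (Y \<omega>) < ereal (X \<omega>)"
          using elim by (metis linorder_neqE)
        then show ?thesis
        proof cases
          case 1
          then have "\<not> v (Y \<omega>) < ereal (X \<omega>)" by simp
          with 1 show ?thesis using elim True unfolding m by (auto simp: f1_def f2_def min_def)
        next
          case 2
          then have "\<not> ereal (X \<omega>) < v (Y \<omega>)" by simp
          with 2 show ?thesis using elim True unfolding m by (auto simp: f1_def f2_def min_def)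
        qed
      qed
    qed
  qed
  show ?thesis
    unfolding risk_Psi1_def int
    using region_integral_below[OF pm] region_integral_above[OF em] i1 i2
    by (simp add: f1_def[abs_def] f2_def[abs_def] C_def distrib_left mult.assoc)
qed

text \<open>The covered claim is the positive part of payoff minus level on \<open>{H > 0}\<close>.
  It vanishes on the curve \<open>X = v Y\<close>, so the open region above the curve carries the
  whole integral.\<close>

lemma risk_Psi2_eq:
  "risk_Psi2 N p Z H c =
       (LBINT y=ereal d..\<infinity>. (LBINT x=v y..\<infinity>. payoff x y * cond_pdf N X Y y x * pdf N Y y))
       - c powr (1 / (p - 1)) * exp (- (\<beta> * T) / (p - 1)) *
         (LBINT y=ereal d..\<infinity>. (LBINT x=v y..\<infinity>.
            exp (- A1 / (p - 1) * (k1 * x + k2 * y) - A2 / (p - 1) * (k3 * x + k4 * y))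
            * cond_pdf N X Y y x * pdf N Y y))"
proof -
  let ?e = "\<lambda>x y. exp (- A1 / (p - 1) * (k1 * x + k2 * y) - A2 / (p - 1) * (k3 * x + k4 * y))"
  define C where "C = c powr (1 / (p - 1)) * exp (- (\<beta> * T) / (p - 1))"
  define f1 where "f1 \<omega> = (if d < Y \<omega> \<and> v (Y \<omega>) < ereal (X \<omega>) then payoff (X \<omega>) (Y \<omega>) else 0)" for \<omega>
  define f2 where "f2 \<omega> = (if d < Y \<omega> \<and> v (Y \<omega>) < ereal (X \<omega>) then ?e (X \<omega>) (Y \<omega>) else 0)" for \<omega>
  note em = exponential_measurable[of "- A1 / (p - 1)" "A2 / (p - 1)"]
  have f1m: "f1 \<in> borel_measurable N" and f2m: "f2 \<in> borel_measurable N"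
    unfolding f1_def f2_def by (rule region_measurable[OF payoff_measurable] region_measurable[OF em])+
  have level: "level x y = C * ?e x y" for x y
    by (simp add: level_def C_def)
  \<comment> \<open>The payoff is at most \<open>S1\<close>, an exponential in \<open>U1\<close>
    alone.\<close>
  have i1: "integrable N f1"
  proof (rule Bochner_Integration.integrable_bound[OF _ f1m])
    show "integrable N (\<lambda>\<omega>. (S10 * exp ((a1 - 1 / 2 * \<sigma>1\<^sup>2) * T)) * exp (\<sigma>1 * U1 \<omega> + 0 * U2 \<omega>))"
      by (intro integrable_mult_right exp_integrable)
    show "AE \<omega> in N. norm (f1 \<omega>) \<le> norm ((S10 * exp ((a1 - 1 / 2 * \<sigma>1\<^sup>2) * T)) * exp (\<sigma>1 * U1 \<omega> + 0 * U2 \<omega>))"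
      using AE_pointwise S1
    proof eventually_elim
      case (elim \<omega>)
      have "(S10 * exp ((a1 - 1 / 2 * \<sigma>1\<^sup>2) * T)) * exp (\<sigma>1 * U1 \<omega> + 0 * U2 \<omega>) = S1 \<omega>"
        using elim by (simp add: exp_add)
      moreover have "S1 \<omega> > 0" using elim(2) params by simp
      moreover have "norm (f1 \<omega>) \<le> S1 \<omega>" using elim(1) \<open>S1 \<omega> > 0\<close> by (auto simp: f1_def)
      ultimately show ?case by (simp only: real_norm_def abs_of_pos)
    qed
  qed
  have i2: "integrable N f2"
  proof (rule Bochner_Integration.integrable_bound[OF _ f2m])
    show "integrable N (\<lambda>\<omega>. exp (- A1 / (p - 1) * U1 \<omega> + - (A2 / (p - 1)) * U2 \<omega>))"
      by (rule exp_integrable)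
    show "AE \<omega> in N. norm (f2 \<omega>) \<le> norm (exp (- A1 / (p - 1) * U1 \<omega> + - (A2 / (p - 1)) * U2 \<omega>))"
      using k by eventually_elim (simp add: f2_def)
  qed
  have int: "(\<integral>\<omega>. H \<omega> * risk_phi p c Z H \<omega> \<partial>N) = (\<integral>\<omega>. f1 \<omega> - C * f2 \<omega> \<partial>N)"
  proof (rule integral_cong_AE)
    show "(\<lambda>\<omega>. f1 \<omega> - C * f2 \<omega>) \<in> borel_measurable N" using f1m f2m by measurable
    have "Z \<in> borel_measurable N" unfolding Z[abs_def] using U by measurable
    then have "risk_phi p c Z H \<in> borel_measurable N"
      unfolding risk_phi_def[abs_def] using H_measurable by (simp add: indicator_def) measurable
    then show "(\<lambda>\<omega>. H \<omega> * risk_phi p c Z H \<omega>) \<in> borel_measurable N"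
      using H_measurable by measurable
    show "AE \<omega> in N. H \<omega> * risk_phi p c Z H \<omega> = f1 \<omega> - C * f2 \<omega>"
      using AE_pointwise
    proof eventually_elim
      case (elim \<omega>)
      show ?case
      proof (cases "d < Y \<omega>")
        case False
        then show ?thesis using elim by (simp add: f1_def f2_def)
      next
        case True
        let ?h = "payoff (X \<omega>) (Y \<omega>)" and ?q = "level (X \<omega>) (Y \<omega>)"
        have h: "?h > 0" "H \<omega> = ?h" using elim True by auto
        have "H \<omega> * risk_phi p c Z H \<omega> = (if ?q < ?h then ?h - ?q else 0)"
          using elim True h by (auto simp: risk_phi_def min_def field_simps)
        also have "\<dots> = f1 \<omega> - C * f2 \<omega>"
          using elim True by (simp add: f1_def f2_def level)
        finally show ?thesis .
      qed
    qed
  qed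
  show ?thesis
    unfolding risk_Psi2_def int
    using region_integral_above[OF payoff_measurable] region_integral_above[OF em] i1 i2
    by (simp add: f1_def[abs_def] f2_def[abs_def] C_def)
qed

end

text \<open>If \<open>(X, Y)\<close> lies in \<open>B\<close>, then \<open>V\<close> lies in the
  image of \<open>B\<close> under an affine map, and this image is again negligible. The offsets
  \<open>e1\<close> and \<open>e2\<close> allow for the drift between \<open>W\<close> and
  \<open>Wt\<close>.\<close>

lemma null_set_preimage_pair:
  fixes X Y :: "'a \<Rightarrow> real" and V :: "'a \<Rightarrow> real ^ 2"
  assumes V: "\<And>B. B \<in> null_sets lborel \<Longrightarrow> AE \<omega> in N. V \<omega> \<notin> B"
    and k: "AE \<omega> in N. V \<omega> $ 1 = k1 * X \<omega> + k2 * Y \<omega> + e1" "AE \<omega> in N. V \<omega> $ 2 = k3 * X \<omega> + k4 * Y \<omega> + e2"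
    and B: "B \<in> null_sets lborel"
  shows "AE \<omega> in N. (X \<omega>, Y \<omega>) \<notin> B"
proof -
  define f where "f z = (k1 * fst z + k2 * snd z + e1) *\<^sub>R axis 1 1
     + (k3 * fst z + k4 * snd z + e2) *\<^sub>R (axis 2 1 :: real ^ 2)" for z :: "real \<times> real"
  have "negligible B"
    using B by (simp add: negligible_iff_null_sets null_sets_completionI)
  moreover have "f differentiable_on B"
    unfolding f_def by (intro differentiable_on_add differentiable_on_scaleR differentiable_on_mult
        differentiable_on_const bounded_linear_imp_differentiable_on bounded_linear_fst bounded_linear_snd)
  ultimately have "negligible (f ` B)"
    by (intro negligible_differentiable_image_negligible) auto
  \<comment> \<open>The image is only known to be negligible, so it is enclosed in a Borel null set
    before the hypothesis on \<open>V\<close> is applied.\<close>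
  then obtain B' where B': "B' \<in> null_sets lborel" "f ` B \<subseteq> B'"
    by (auto simp: negligible_iff_null_sets null_sets_completion_iff2)
  show ?thesis
    using V[OF B'(1)] k
  proof eventually_elim
    case (elim \<omega>)
    have "V \<omega> = f (X \<omega>, Y \<omega>)"
      using elim by (simp add: f_def vec_eq_iff forall_2 axis_def)
    then show ?case using elim B'(2) by auto
  qed
qed

theorem mainTheorem6:
  fixes M :: "'a measure" and F :: "real \<Rightarrow> 'a measure" and W :: "real \<Rightarrow> 'a \<Rightarrow> real ^ 2"
    and S1 S2 :: "real \<Rightarrow> 'a \<Rightarrow> real"
    and T \<rho> r \<alpha>1 \<alpha>2 \<sigma>1 \<sigma>2 S10 S20 K p c :: real
    and k1 k2 k3 k4 :: real
  assumes params: "T > 0" "\<sigma>1 > 0" "\<sigma>2 > 0" "S10 > 0" "S20 > 0" "K > 0" "p > 1" "c \<ge> 0"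
    and Q: "Q = corr_matrix \<rho>" "pos_definite Q"
    and W: "wiener_process M F T Q W"
    and S1: "black_scholes_stock M F T (\<lambda>t \<omega>. W t \<omega> $ 1) \<alpha>1 \<sigma>1 S10 S1"
    and S2: "black_scholes_stock M F T (\<lambda>t \<omega>. W t \<omega> $ 2) \<alpha>2 \<sigma>2 S20 S2"
    and \<theta>: "\<theta> = (vector [(\<alpha>1 - r) / \<sigma>1, (\<alpha>2 - r) / \<sigma>2] :: real ^ 2)"
    and Wt: "Wt = (\<lambda>t \<omega>. W t \<omega> + t *\<^sub>R \<theta>)"
    and A: "A = matrix_inv Q *v \<theta>" "A1 = A $ 1" "A2 = A $ 2"
    and B: "B = 1 / 2 * (norm (matrix_inv (matrix_sqrt Q) *v \<theta>))\<^sup>2"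
    and Bt: "Bt = B - A1 * \<theta> $ 1 - A2 * \<theta> $ 2"
    and Z: "Z = (\<lambda>\<omega>. exp (- A1 * W T \<omega> $ 1 - A2 * W T \<omega> $ 2 - B * T))"
    and Mt: "Mt = density M (\<lambda>\<omega>. ennreal (Z \<omega>))"
    and H: "H = (\<lambda>\<omega>. max 0 (S1 T \<omega> - K / S2 T \<omega>))"
    and d: "d = ln (K / (S10 * S20)) - (\<alpha>1 + \<alpha>2 - 1 / 2 * (\<sigma>1\<^sup>2 + \<sigma>2\<^sup>2)) * T"
    and dt: "dt = ln (K / (S10 * S20)) - (2 * r - 1 / 2 * (\<sigma>1\<^sup>2 + \<sigma>2\<^sup>2)) * T"
    and X: "X = (\<lambda>\<omega>. A1 / (p - 1) * W T \<omega> $ 1 + (A2 / (p - 1) - \<sigma>2) * W T \<omega> $ 2)"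
    and Y: "Y = (\<lambda>\<omega>. \<sigma>1 * W T \<omega> $ 1 + \<sigma>2 * W T \<omega> $ 2)"
    and Xt: "Xt = (\<lambda>\<omega>. A1 / (p - 1) * Wt T \<omega> $ 1 + (A2 / (p - 1) - \<sigma>2) * Wt T \<omega> $ 2)"
    and Yt: "Yt = (\<lambda>\<omega>. \<sigma>1 * Wt T \<omega> $ 1 + \<sigma>2 * Wt T \<omega> $ 2)"
    and k: "AE \<omega> in M. W T \<omega> $ 1 = k1 * X \<omega> + k2 * Y \<omega>"
           "AE \<omega> in M. W T \<omega> $ 2 = k3 * X \<omega> + k4 * Y \<omega>"
           "AE \<omega> in Mt. Wt T \<omega> $ 1 = k1 * Xt \<omega> + k2 * Yt \<omega>"
           "AE \<omega> in Mt. Wt T \<omega> $ 2 = k3 * Xt \<omega> + k4 * Yt \<omega>"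
      \<comment> \<open>Arguments of the logarithms oriented so that \<open>X \<le> v(Y)\<close> is equivalent to
        \<open>H \<le> (c Z)\<^bsup>1/(p-1)\<^esup>\<close> on \<open>{H > 0}\<close>; they vanish for \<open>c = 0\<close>.\<close>
    and v: "v = (\<lambda>x. ln_ext
              (c powr (1 / (p - 1)) * S20 * exp ((\<alpha>2 - 1 / 2 * \<sigma>2\<^sup>2 - B / (p - 1)) * T)
               / (S10 * S20 * exp ((\<alpha>1 + \<alpha>2 - 1 / 2 * (\<sigma>1\<^sup>2 + \<sigma>2\<^sup>2)) * T + x) - K)))"
    and vt: "vt = (\<lambda>x. ln_ext
              (c powr (1 / (p - 1)) * S20 * exp ((r - 1 / 2 * \<sigma>2\<^sup>2 - Bt / (p - 1)) * T)
               / (S10 * S20 * exp ((2 * r - 1 / 2 * (\<sigma>1\<^sup>2 + \<sigma>2\<^sup>2)) * T + x) - K)))"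
  shows
    "risk_Psi1 M p Z H c =
       1 / p * (LBINT y=ereal d..\<infinity>. (LBINT x=-\<infinity>..v y.
          (S10 * exp ((\<alpha>1 - 1 / 2 * \<sigma>1\<^sup>2) * T + \<sigma>1 * (k1 * x + k2 * y))
            - K / (S20 * exp ((\<alpha>2 - 1 / 2 * \<sigma>2\<^sup>2) * T + \<sigma>2 * (k3 * x + k4 * y)))) powr p
          * cond_pdf M X Y y x * pdf M Y y))
       + 1 / p * c powr (p / (p - 1)) * exp (- (p * B * T) / (p - 1)) *
         (LBINT y=ereal d..\<infinity>. (LBINT x=v y..\<infinity>.
            exp (- (p * A1) / (p - 1) * (k1 * x + k2 * y) - p * A2 / (p - 1) * (k3 * x + k4 * y))
            * cond_pdf M X Y y x * pdf M Y y))
     \<and>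
     risk_Psi2 Mt p Z H c =
       (LBINT y=ereal dt..\<infinity>. (LBINT x=vt y..\<infinity>.
          (S10 * exp ((r - 1 / 2 * \<sigma>1\<^sup>2) * T + \<sigma>1 * (k1 * x + k2 * y))
            - K / (S20 * exp ((r - 1 / 2 * \<sigma>2\<^sup>2) * T + \<sigma>2 * (k3 * x + k4 * y))))
          * cond_pdf Mt Xt Yt y x * pdf Mt Yt y))
       - c powr (1 / (p - 1)) * exp (- (Bt * T) / (p - 1)) *
         (LBINT y=ereal dt..\<infinity>. (LBINT x=vt y..\<infinity>.
            exp (- A1 / (p - 1) * (k1 * x + k2 * y) - A2 / (p - 1) * (k3 * x + k4 * y))
            * cond_pdf Mt Xt Yt y x * pdf Mt Yt y))"
proof -
  have \<rho>: "\<bar>\<rho>\<bar> < 1" using Q corr_matrix_pos_definite by simp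
  have W': "wiener_process M F T (corr_matrix \<rho>) W" using W Q(1) by simp
  note bm = wiener_process_component[OF W' \<rho>]
  interpret B1: brownian_motion M F T "\<lambda>t \<omega>. W t \<omega> $ 1" by (rule bm)
  interpret B2: brownian_motion M F T "\<lambda>t \<omega>. W t \<omega> $ 2" by (rule bm)
  have T: "T \<in> {0..T}" using params by simp
  have bs1: "black_scholes M F T (\<lambda>t \<omega>. W t \<omega> $ 1) \<alpha>1 \<sigma>1 S10 S1"
    by (intro black_scholes.intro bm black_scholes_axioms.intro S1)
  have bs2: "black_scholes M F T (\<lambda>t \<omega>. W t \<omega> $ 2) \<alpha>2 \<sigma>2 S20 S2"
    by (intro black_scholes.intro bm black_scholes_axioms.intro S2)
  note sol1 = black_scholes.solution[OF bs1 T] and sol2 = black_scholes.solution[OF bs2 T]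
  have Wm [measurable]: "(\<lambda>\<omega>. W T \<omega> $ 1) \<in> borel_measurable M" "(\<lambda>\<omega>. W T \<omega> $ 2) \<in> borel_measurable M"
    using B1.measurable_b[of T] B2.measurable_b[of T] params by simp_all
  have "S1 T \<in> borel_measurable M" "S2 T \<in> borel_measurable M"
    using black_scholes.square_integrable_S[OF bs1 T] black_scholes.square_integrable_S[OF bs2 T]
    by (auto simp: square_integrable_def)
  then have Hm: "H \<in> borel_measurable M" unfolding H by measurable
  have exp_int: "integrable M (\<lambda>\<omega>. exp (u * W T \<omega> $ 1 + w * W T \<omega> $ 2))" for u w
    using square_integrable_mult[OF B1.square_integrable_exp[OF T, of u] B2.square_integrable_exp[OF T, of w]]
    by (simp add: exp_add)
  have Zm [measurable]: "Z \<in> borel_measurable M" unfolding Z by measurable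
  have Z0: "Z \<omega> > 0" for \<omega> by (simp add: Z)
  note null = wiener_process_absolutely_continuous[OF W params(1)]
  \<comment> \<open>\<open>Z\<close> is strictly positive, so \<open>M\<close> and \<open>Mt\<close>
    have the same null sets. In particular the solutions of the stock equations, found under
    \<open>M\<close>, remain valid under \<open>Mt\<close>.\<close>
  have AE_Mt: "(AE \<omega> in Mt. R \<omega>) \<longleftrightarrow> (AE \<omega> in M. R \<omega>)" for R
    unfolding Mt using Z0 by (subst AE_density) auto
  have Mt_meas [simp]: "(borel_measurable Mt :: ('a \<Rightarrow> real) set) = borel_measurable M"
    by (intro measurable_cong_sets) (simp_all add: Mt)
  \<comment> \<open>The weight \<open>Z\<close> lowers the exponents by \<open>A1\<close> and
    \<open>A2\<close>, and passing from \<open>W\<close> to \<open>Wt\<close> costs a constant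
    factor, so exponential moments under \<open>M\<close> suffice.\<close>
  have exp_int_t: "integrable Mt (\<lambda>\<omega>. exp (u * Wt T \<omega> $ 1 + w * Wt T \<omega> $ 2))" for u w
  proof -
    have "integrable M (\<lambda>\<omega>. exp (T * (u * \<theta> $ 1 + w * \<theta> $ 2) - B * T)
        * exp ((u - A1) * W T \<omega> $ 1 + (w - A2) * W T \<omega> $ 2))"
      by (intro integrable_mult_right exp_int)
    moreover have "Z \<omega> * exp (u * Wt T \<omega> $ 1 + w * Wt T \<omega> $ 2) = exp (T * (u * \<theta> $ 1 + w * \<theta> $ 2) - B * T)
        * exp ((u - A1) * W T \<omega> $ 1 + (w - A2) * W T \<omega> $ 2)" for \<omega>
      by (simp add: Z Wt exp_add[symmetric] algebra_simps)
    moreover have "(\<lambda>\<omega>. exp (u * Wt T \<omega> $ 1 + w * Wt T \<omega> $ 2)) \<in> borel_measurable M"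
      by (simp add: Wt)
    ultimately show ?thesis
      unfolding Mt using Z0 by (subst integrable_density) (auto intro: less_imp_le)
  qed
  \<comment> \<open>The exponential moment with \<open>u = w = 0\<close> is the total mass.\<close>
  have fin_Mt: "finite_measure Mt"
  proof
    have "integrable Mt (\<lambda>\<omega>. 1 :: real)" using exp_int_t[of 0 0] by simp
    then have "(\<integral>\<^sup>+ \<omega>. 1 \<partial>Mt) < \<infinity>" by (simp add: integrable_iff_bounded)
    then show "emeasure Mt (space Mt) \<noteq> \<infinity>" by simp
  qed
  have p1: "absolutely_continuous_pair M X Y"
  proof (intro absolutely_continuous_pair.intro absolutely_continuous_pair_axioms.intro)
    show "finite_measure M" by (rule B1.finite_measure_axioms)
    show "X \<in> borel_measurable M" "Y \<in> borel_measurable M" unfolding X Y by measurable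
    show "AE \<omega> in M. (X \<omega>, Y \<omega>) \<notin> B" if "B \<in> null_sets lborel" for B
    proof (rule null_set_preimage_pair[OF null _ _ that])
      show "AE \<omega> in M. W T \<omega> $ 1 = k1 * X \<omega> + k2 * Y \<omega> + 0"
        "AE \<omega> in M. W T \<omega> $ 2 = k3 * X \<omega> + k4 * Y \<omega> + 0"
        using k(1,2) by simp_all
    qed
  qed
  have p2: "absolutely_continuous_pair Mt Xt Yt"
  proof (intro absolutely_continuous_pair.intro absolutely_continuous_pair_axioms.intro fin_Mt)
    show "Xt \<in> borel_measurable Mt" "Yt \<in> borel_measurable Mt"
      unfolding Xt Yt Wt Mt_meas vector_add_component by measurable
    show "AE \<omega> in Mt. (Xt \<omega>, Yt \<omega>) \<notin> B" if "B \<in> null_sets lborel" for B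
      unfolding AE_Mt
    \<comment> \<open>Null sets are tested on \<open>W T\<close> under \<open>M\<close>; the offsets
      remove the drift \<open>T * \<theta>\<close> contained in \<open>Wt T\<close>.\<close>
    proof (rule null_set_preimage_pair[OF null _ _ that])
      show "AE \<omega> in M. W T \<omega> $ 1 = k1 * Xt \<omega> + k2 * Yt \<omega> + (- T * \<theta> $ 1)"
        using k(3) unfolding AE_Mt by eventually_elim (simp add: Wt)
      show "AE \<omega> in M. W T \<omega> $ 2 = k3 * Xt \<omega> + k4 * Yt \<omega> + (- T * \<theta> $ 2)"
        using k(4) unfolding AE_Mt by eventually_elim (simp add: Wt)
    qed
  qed
  \<comment> \<open>The market price of risk is scaled by the volatility so that rewriting a stock
    in terms of \<open>Wt\<close> replaces its rate of return by \<open>r\<close>.\<close>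
  have \<theta>': "\<sigma>1 * \<theta> $ 1 = \<alpha>1 - r" "\<sigma>2 * \<theta> $ 2 = \<alpha>2 - r"
    using params by (simp_all add: \<theta>)
  have q1: "quanto M X Y (\<lambda>\<omega>. W T \<omega> $ 1) (\<lambda>\<omega>. W T \<omega> $ 2) (S1 T) (S2 T) Z H T \<alpha>1 \<alpha>2 (\<alpha>1 + \<alpha>2) \<sigma>1 \<sigma>2 S10 S20 K p c
      A1 A2 B k1 k2 k3 k4 d v"
  proof (intro quanto.intro quanto_axioms.intro p1 Wm exp_int params sol1 sol2 k H Hm d v refl)
    show "Z \<omega> = exp (- A1 * W T \<omega> $ 1 - A2 * W T \<omega> $ 2 - B * T)"
      "X \<omega> = A1 / (p - 1) * W T \<omega> $ 1 + (A2 / (p - 1) - \<sigma>2) * W T \<omega> $ 2"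
      "Y \<omega> = \<sigma>1 * W T \<omega> $ 1 + \<sigma>2 * W T \<omega> $ 2" for \<omega>
      by (simp_all add: Z X Y)
  qed
  have q2: "quanto Mt Xt Yt (\<lambda>\<omega>. Wt T \<omega> $ 1) (\<lambda>\<omega>. Wt T \<omega> $ 2) (S1 T) (S2 T) Z H T r r (2 * r) \<sigma>1 \<sigma>2 S10 S20 K p c
      A1 A2 Bt k1 k2 k3 k4 dt vt"
  proof (intro quanto.intro quanto_axioms.intro p2 exp_int_t params k H dt vt)
    show "(\<lambda>\<omega>. Wt T \<omega> $ 1) \<in> borel_measurable Mt" "(\<lambda>\<omega>. Wt T \<omega> $ 2) \<in> borel_measurable Mt"
      unfolding Wt Mt_meas vector_add_component by measurable
    show "H \<in> borel_measurable Mt" using Hm by simp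
    show "2 * r = r + r" by simp
    \<comment> \<open>Replacing \<open>W\<close> by \<open>Wt - T \<theta>\<close> adds
      \<open>T * (A1 * \<theta> $ 1 + A2 * \<theta> $ 2)\<close> to the exponent, which is the
      difference between \<open>B * T\<close> and \<open>Bt * T\<close>.\<close>
    show "Z \<omega> = exp (- A1 * Wt T \<omega> $ 1 - A2 * Wt T \<omega> $ 2 - Bt * T)"
      "Xt \<omega> = A1 / (p - 1) * Wt T \<omega> $ 1 + (A2 / (p - 1) - \<sigma>2) * Wt T \<omega> $ 2"
      "Yt \<omega> = \<sigma>1 * Wt T \<omega> $ 1 + \<sigma>2 * Wt T \<omega> $ 2" for \<omega>
      by (simp_all add: Z Xt Yt Wt Bt algebra_simps)
    have e1: "(r - 1 / 2 * \<sigma>1\<^sup>2) * T + \<sigma>1 * Wt T \<omega> $ 1 = (\<alpha>1 - 1 / 2 * \<sigma>1\<^sup>2) * T + \<sigma>1 * W T \<omega> $ 1" for \<omega>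
    proof -
      have "\<sigma>1 * Wt T \<omega> $ 1 = \<sigma>1 * W T \<omega> $ 1 + T * (\<sigma>1 * \<theta> $ 1)" by (simp add: Wt algebra_simps)
      then show ?thesis unfolding \<theta>' by (simp add: algebra_simps)
    qed
    have e2: "(r - 1 / 2 * \<sigma>2\<^sup>2) * T + \<sigma>2 * Wt T \<omega> $ 2 = (\<alpha>2 - 1 / 2 * \<sigma>2\<^sup>2) * T + \<sigma>2 * W T \<omega> $ 2" for \<omega>
    proof -
      have "\<sigma>2 * Wt T \<omega> $ 2 = \<sigma>2 * W T \<omega> $ 2 + T * (\<sigma>2 * \<theta> $ 2)" by (simp add: Wt algebra_simps)
      then show ?thesis unfolding \<theta>' by (simp add: algebra_simps)
    qed
    show "AE \<omega> in Mt. S1 T \<omega> = S10 * exp ((r - 1 / 2 * \<sigma>1\<^sup>2) * T + \<sigma>1 * Wt T \<omega> $ 1)"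
      "AE \<omega> in Mt. S2 T \<omega> = S20 * exp ((r - 1 / 2 * \<sigma>2\<^sup>2) * T + \<sigma>2 * Wt T \<omega> $ 2)"
      unfolding AE_Mt e1 e2 by (rule sol1, rule sol2)
  qed
  show ?thesis
    using quanto.risk_Psi1_eq[OF q1] quanto.risk_Psi2_eq[OF q2]
    unfolding quanto.payoff_def[OF q1] quanto.payoff_def[OF q2] by blast
qed

end
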